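(* Consider the stochastic $K$-armed bandit problem with arm means $\mu_1,\dots,\mu_K\in[0,1]$, where the time horizon $T$ is unknown to the algorithm. Let $\mu_*=\max_{i\in[K]}\mu_i$, $\Delta_i=\mu_*-\mu_i$, and $\Delta=\min_{i:\Delta_i>0}\Delta_i$. For any $\gamma>0$, there exists an algorithm that uses $O(1)$ words of space and, for any $T>0$, achieves pseudo-regret \[ \overline{\Psi}_T = O\left(\sum_{i:\Delta_i>0}\frac{1}{\Delta_i}\left(\log^{\gamma}\frac{1}{\Delta_i}+\frac{\log(\Delta_i/\Delta)}{\gamma\log\log(\Delta_i/\Delta)}\right)\log T\right). \]
   Context: Stochastic bandit model: there are $K$ arms; arm $i\in[K]$ has a distribution $\mathcal{D}_i$ supported on $[0,1]$ with mean $\mu_i$. At each time step $t=1,2,\dots,T$ the player chooses an arm $I_t\in[K]$ (depending only on past observations and internal randomness) and receives reward $X_{I_t,t}$, where the rewards $X_{i,t}$ are drawn from $\mathcal{D}_i$ independently across $i$ and $t$. The pseudo-regret is $\overline{\Psi}_T=\max_{i\in[K]}\left(\mathbb{E}\left[\sum_{t=1}^T X_{i,t}\right]-\mathbb{E}\left[\sum_{t=1}^T X_{I_t,t}\right]\right)$. Space is measured in words in the word-RAM model: each input value (such as $K$, $T$, a reward) and each variable occupies $O(1)$ words of $O(\log(KT))$ bits. The $O(\cdot)$ hides an absolute constant independent of $\gamma$, $K$, $T$ and the arm distributions.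
   Formalization: The factors log T, log(1/Δ_i) and log log(Δ_i/Δ) are read as max(1, ·) of the natural logarithm, since as written the bound vanishes at T = 1 and as Δ_i tends to 1, and is undefined at Δ_i = Δ. *)

theory Defs
  imports "HOL-Probability.Probability"
begin

section \<open>Word-RAM bandit algorithms\<close>

text \<open>
  A player is a RAM program: a finite list of instructions over registers holding natural numbers.
  Registers are unbounded in the semantics, so that the run of a program does not depend on the
  horizon \<open>T\<close> (a word length fixed in advance would reveal \<open>T\<close>); that all contents fit into words
  of \<open>O(log (K T))\<close> bits is demanded separately in \<open>runs_in_space\<close>. Immediate operands and the
  program counter belong to the fixed program and are not counted as storage. As the number of
  registers is constant, indirect addressing is not needed.
\<close>

datatype operand = Imm nat | Reg nat

text \<open>
  \<open>Flip r\<close> stores a fresh fair bit in register \<open>r\<close>. \<open>Pull r a d\<close> plays the arm given by \<open>a\<close> and stores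
  the observed reward \<open>x\<close> in \<open>r\<close> as the fixed-point number \<open>\<lfloor>x d\<rfloor>\<close>: a real reward does not fit into
  a word, so it is observed at a resolution \<open>1/d\<close> chosen by the program. \<open>JumpLess a b l\<close> continues
  at instruction \<open>l\<close> if \<open>a < b\<close>.
\<close>

datatype instr =
    Add nat operand operand
  | Sub nat operand operand
  | Mul nat operand operand
  | Div nat operand operand
  | Mod nat operand operand
  | Flip nat
  | JumpLess operand operand nat
  | Pull nat operand operand

type_synonym program = "instr list"

text \<open>
  The fields \<open>flips\<close> (number of bits drawn) and \<open>arms\<close> (arms played so far, in order) are bookkeeping
  of the environment; programs cannot read them.
\<close>

record config =
  pc :: nat
  mem :: "nat \<Rightarrow> nat"
  flips :: nat
  arms :: "nat list"

fun val :: "config \<Rightarrow> operand \<Rightarrow> nat" where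
  "val s (Imm n) = n"
| "val s (Reg r) = mem s r"

definition store :: "nat \<Rightarrow> nat \<Rightarrow> config \<Rightarrow> config" where
  "store r v s = s\<lparr>pc := Suc (pc s), mem := (mem s)(r := v)\<rparr>"

text \<open>
  In the reward table \<open>x\<close>, the entry \<open>x (i, t)\<close> is the reward of arm \<open>i\<close> at time \<open>t\<close>; arms and time
  steps are numbered from 0. The sequence \<open>u\<close> holds the random bits.
\<close>

fun exec :: "(nat \<times> nat \<Rightarrow> real) \<Rightarrow> (nat \<Rightarrow> bool) \<Rightarrow> instr \<Rightarrow> config \<Rightarrow> config" where
  "exec x u (Add r a b) s = store r (val s a + val s b) s"
| "exec x u (Sub r a b) s = store r (val s a - val s b) s"
| "exec x u (Mul r a b) s = store r (val s a * val s b) s"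
| "exec x u (Div r a b) s = store r (val s a div val s b) s"
| "exec x u (Mod r a b) s = store r (val s a mod val s b) s"
| "exec x u (Flip r) s = (store r (of_bool (u (flips s))) s)\<lparr>flips := Suc (flips s)\<rparr>"
| "exec x u (JumpLess a b l) s = s\<lparr>pc := if val s a < val s b then l else Suc (pc s)\<rparr>"
| "exec x u (Pull r a d) s =
     (store r (nat \<lfloor>x (val s a, length (arms s)) * real (val s d)\<rfloor>) s)\<lparr>arms := arms s @ [val s a]\<rparr>"

definition step :: "program \<Rightarrow> (nat \<times> nat \<Rightarrow> real) \<Rightarrow> (nat \<Rightarrow> bool) \<Rightarrow> config \<Rightarrow> config" where
  "step P x u s = (if pc s < length P then exec x u (P ! pc s) s else s)"

text \<open>The only input, the number \<open>K\<close> of arms, is initially in register 0.\<close>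

definition init :: "nat \<Rightarrow> config" where
  "init K = \<lparr>pc = 0, mem = (\<lambda>_. 0)(0 := K), flips = 0, arms = []\<rparr>"

definition run :: "program \<Rightarrow> nat \<Rightarrow> (nat \<times> nat \<Rightarrow> real) \<Rightarrow> (nat \<Rightarrow> bool) \<Rightarrow> nat \<Rightarrow> config" where
  "run P K x u n = (step P x u ^^ n) (init K)"

text \<open>The arm \<open>I\<^sub>t\<close> played at time \<open>t\<close>.\<close>

definition chosen_arm :: "program \<Rightarrow> nat \<Rightarrow> (nat \<times> nat \<Rightarrow> real) \<Rightarrow> (nat \<Rightarrow> bool) \<Rightarrow> nat \<Rightarrow> nat" where
  "chosen_arm P K x u t = arms (run P K x u (LEAST n. t < length (arms (run P K x u n)))) ! t"

definition reward_table :: "nat \<Rightarrow> (nat \<times> nat \<Rightarrow> real) \<Rightarrow> bool" where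
  "reward_table K x \<longleftrightarrow> (\<forall>i<K. \<forall>t. x (i, t) \<in> {0..1})"

definition bandit_algorithm :: "program \<Rightarrow> bool" where
  "bandit_algorithm P \<longleftrightarrow>
     (\<forall>K x u. K \<ge> 1 \<longrightarrow> reward_table K x \<longrightarrow>
        (\<forall>t. \<exists>n. t < length (arms (run P K x u n))) \<and>
        (\<forall>n. set (arms (run P K x u n)) \<subseteq> {..<K}))"


section \<open>Space\<close>

text \<open>
  Logarithms in asymptotic bounds are read as \<open>max 1 (ln x)\<close> where the literal value would vanish,
  be negative or be undefined, e.g. in \<open>log T\<close> for \<open>T = 1\<close>.
\<close>

definition lg :: "real \<Rightarrow> real" where
  "lg x = max 1 (ln x)"

fun operand_regs :: "operand \<Rightarrow> nat set" where
  "operand_regs (Imm n) = {}"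
| "operand_regs (Reg r) = {r}"

fun instr_regs :: "instr \<Rightarrow> nat set" where
  "instr_regs (Add r a b) = {r} \<union> operand_regs a \<union> operand_regs b"
| "instr_regs (Sub r a b) = {r} \<union> operand_regs a \<union> operand_regs b"
| "instr_regs (Mul r a b) = {r} \<union> operand_regs a \<union> operand_regs b"
| "instr_regs (Div r a b) = {r} \<union> operand_regs a \<union> operand_regs b"
| "instr_regs (Mod r a b) = {r} \<union> operand_regs a \<union> operand_regs b"
| "instr_regs (Flip r) = {r}"
| "instr_regs (JumpLess a b l) = operand_regs a \<union> operand_regs b"
| "instr_regs (Pull r a d) = {r} \<union> operand_regs a \<union> operand_regs d"

text \<open>
  \<open>runs_in_space P W b\<close>: the program has \<open>W\<close> words of storage, and for every horizon \<open>T\<close> all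
  their contents in a run of \<open>T\<close> time steps, including intermediate results, have at most
  \<open>b lg (K T)\<close> bits, whatever the rewards and random bits are.
\<close>

definition runs_in_space :: "program \<Rightarrow> nat \<Rightarrow> real \<Rightarrow> bool" where
  "runs_in_space P W b \<longleftrightarrow>
     card (\<Union>(instr_regs ` set P)) \<le> W \<and>
     (\<forall>K T x u n r. K \<ge> 1 \<longrightarrow> T \<ge> 1 \<longrightarrow> reward_table K x \<longrightarrow> length (arms (run P K x u n)) \<le> T \<longrightarrow>
        real (mem (run P K x u n) r) < 2 powr (b * lg (real K * real T)))"


section \<open>Stochastic bandits and pseudo-regret\<close>

definition reward_distribution :: "real measure \<Rightarrow> bool" where
  "reward_distribution M \<longleftrightarrow> prob_space M \<and> sets M = sets borel \<and> (AE y in M. y \<in> {0..1})"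

text \<open>Independent rewards \<open>X\<^sub>i\<^sub>t\<close> with distribution \<open>D i\<close>, and independent fair internal bits.\<close>

definition bandit_space ::
    "nat \<Rightarrow> (nat \<Rightarrow> real measure) \<Rightarrow> ((nat \<times> nat \<Rightarrow> real) \<times> (nat \<Rightarrow> bool)) measure" where
  "bandit_space K D =
     (\<Pi>\<^sub>M (i, t) \<in> {..<K} \<times> UNIV. D i) \<Otimes>\<^sub>M (\<Pi>\<^sub>M n \<in> UNIV. measure_pmf (bernoulli_pmf (1/2)))"

definition pseudo_regret :: "program \<Rightarrow> nat \<Rightarrow> (nat \<Rightarrow> real measure) \<Rightarrow> nat \<Rightarrow> real" where
  "pseudo_regret P K D T =
     (MAX i\<in>{..<K}. (\<integral>(x, u). (\<Sum>t<T. x (i, t)) \<partial>bandit_space K D)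
                    - (\<integral>(x, u). (\<Sum>t<T. x (chosen_arm P K x u t, t)) \<partial>bandit_space K D))"

definition arm_mean :: "real measure \<Rightarrow> real" where
  "arm_mean M = (\<integral>y. y \<partial>M)"

definition best_mean :: "nat \<Rightarrow> (nat \<Rightarrow> real measure) \<Rightarrow> real" where
  "best_mean K D = (MAX i\<in>{..<K}. arm_mean (D i))"

definition gap :: "nat \<Rightarrow> (nat \<Rightarrow> real measure) \<Rightarrow> nat \<Rightarrow> real" where
  "gap K D i = best_mean K D - arm_mean (D i)"

text \<open>Meaningful only if some arm is suboptimal.\<close>

definition min_gap :: "nat \<Rightarrow> (nat \<Rightarrow> real measure) \<Rightarrow> real" where
  "min_gap K D = Min {gap K D i | i. i < K \<and> gap K D i > 0}"

end

theory Submission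
  imports Defs "HOL-Library.Discrete_Functions"
begin

text \<open>
  Time is cut into epochs of \<open>2 ^ L\<close> pulls with \<open>L = 64, 128, 256, \<dots>\<close>, at whose starts everything is
  forgotten. As the logarithms of the epoch lengths double, it suffices to bound the regret inside
  one epoch by \<open>L\<close> times a factor that depends on the gaps only.

  In round \<open>s = 0, 1, \<dots>\<close> of an epoch, the reward of a champion \<open>c\<close> is measured up to about
  \<open>1 / 2 ^ s\<close>, and then the arms are tested against it one after another, so that only the champion
  and the current test have to be stored. A test refines its accuracy \<open>1 / 2 ^ e\<close> step by step
  and stops as soon as the arm is seen to be worse; an arm that is better at accuracy
  \<open>1 / 2 ^ s\<close> becomes the champion. There are at most \<open>L\<close> rounds, so a test of arm \<open>k\<close> may cost
  only \<open>O(kap k / \<Delta>\<^sub>k)\<close> and cannot afford confidence \<open>L\<close>. The level \<open>E\<close> is the largest \<open>e\<close> at which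
  some arm has been rejected with confidence \<open>L\<close>, which estimates \<open>log (1 / \<Delta>)\<close> from below; only arms
  with gap below \<open>1 / 2 ^ E\<close> need confidence \<open>L\<close> at all, and each such rejection raises \<open>E\<close>, so it is
  paid once per arm. The early refinements use confidence \<open>conf E e\<close>, about the square root of
  \<open>min e (E - e)\<close>: then an optimal arm is wrongly rejected with probability at most \<open>1/8\<close> per
  round, which makes the expected cost of a suboptimal champion a geometric series, and the price is
  a factor \<open>kap k\<close> of order \<open>1 + sqrt (min (log (1 / \<Delta>\<^sub>k)) (log (\<Delta>\<^sub>k / \<Delta>)))\<close>. For \<open>\<gamma> \<ge> 1\<close> this is at most of
  the order of the first summand of the claimed factor and for \<open>\<gamma> < 1\<close> of the second, so one program
  serves all \<open>\<gamma>\<close>.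
\<close>

section \<open>The algorithm as a Markov chain\<close>

text \<open>The threshold \<open>(2 - 1 / y) / 2 ^ e\<close> moves with the confidence. At a fixed
  threshold, an arm whose gap sits on it would be rejected about half of the time at every
  \<open>y\<close>, mostly before full confidence, so that \<open>E\<close> would not rise and the
  expensive test could recur in every round. With the moving threshold the normalised distance z =
  \<open>margin\<close> becomes 2 z + 1 when \<open>y\<close> doubles: at each \<open>y\<close> the
  arm is rejected with probability at least 7/8, or it is clearly above the threshold now or after
  the next doubling. The expected regret is bounded by a potential \<open>psi\<close> of the current
  block, by induction on the number of pulls left. An event of probability at most
  \<open>1 / 4 ^ L\<close> in a block may cost the whole epoch, that is \<open>2 ^ L\<close> pulls;
  as there are at most \<open>2 ^ L\<close> blocks, all such events together cost at most 1. A hard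
  test in round \<open>s\<close> costs of the order of \<open>4 ^ s\<close>, so each round is 4
  times as expensive as the one before, while a bad champion survives a round with probability at
  most 1/8. The resulting series has ratio 1/2.\<close>

text \<open>
  \<open>Ref s c E i\<close> is a block of pulls of the champion \<open>c\<close> in round \<open>s\<close> after which testing resumes at
  arm \<open>i\<close>. \<open>Test s c M E i e y\<close> is a block of pulls of arm \<open>i\<close> at accuracy \<open>1 / 2 ^ e\<close>; \<open>M\<close> is the total
  reward of the last reference block, and the confidence is multiplied by \<open>y\<^sup>2\<close>, so that it is full
  when \<open>L \<le> y\<^sup>2\<close>.
\<close>

datatype block =
    Ref nat nat nat nat
  | Test nat nat nat nat nat nat nat

text \<open>The square root grows fast enough for \<open>exp (- 512 * conf E e)\<close> to be
  summable over the levels like inverse squares, and slowly enough for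
  \<open>sqrt j \<le> j / lg j\<close> to give the second summand of the rate.\<close>

definition conf :: "nat \<Rightarrow> nat \<Rightarrow> nat" where
  "conf E e = Suc (floor_sqrt (min e (E - e)))"

text \<open>With the factor 512, a deviation by \<open>1 / (8 * 2 ^ s)\<close> has exponent
  \<open>8 * L\<close>.\<close>

definition ref_size :: "nat \<Rightarrow> nat \<Rightarrow> nat" where
  "ref_size L s = 512 * L * 4 ^ s"

definition test_size :: "nat \<Rightarrow> nat \<Rightarrow> nat \<Rightarrow> nat" where
  "test_size E e y = 512 * 4 ^ e * conf E e * y\<^sup>2"

fun block_arm :: "block \<Rightarrow> nat" where
  "block_arm (Ref s c E i) = c"
| "block_arm (Test s c M E i e y) = i"

fun block_size :: "nat \<Rightarrow> block \<Rightarrow> nat" where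
  "block_size L (Ref s c E i) = ref_size L s"
| "block_size L (Test s c M E i e y) = test_size E e y"

definition next_arm :: "nat \<Rightarrow> nat \<Rightarrow> nat \<Rightarrow> nat \<Rightarrow> nat \<Rightarrow> nat \<Rightarrow> block" where
  "next_arm K s c M E i = (if i < K then Test s c M E i 0 1 else Ref (Suc s) c E 0)"

definition ref_mean :: "nat \<Rightarrow> nat \<Rightarrow> nat \<Rightarrow> real" where
  "ref_mean L s M = real M / (real (ref_size L s) * 2 ^ L)"

definition test_mean :: "nat \<Rightarrow> nat \<Rightarrow> nat \<Rightarrow> nat \<Rightarrow> nat \<Rightarrow> real" where
  "test_mean L E e y S = real S / (real (test_size E e y) * 2 ^ L)"

text \<open>For \<open>e \<ge> E\<close> the statistical accuracy is proportional to
  \<open>1 / (y * 2 ^ e)\<close>, so the slack \<open>1 / y\<close> stays a fixed number of such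
  units.\<close>

definition threshold :: "nat \<Rightarrow> nat \<Rightarrow> real" where
  "threshold e y = (2 - 1 / real y) / 2 ^ e"

definition rejects :: "nat \<Rightarrow> nat \<Rightarrow> nat \<Rightarrow> nat \<Rightarrow> nat \<Rightarrow> nat \<Rightarrow> nat \<Rightarrow> bool" where
  "rejects L s M E e y S \<longleftrightarrow> test_mean L E e y S < ref_mean L s M - threshold e y"

definition accepts :: "nat \<Rightarrow> nat \<Rightarrow> nat \<Rightarrow> nat \<Rightarrow> nat \<Rightarrow> nat \<Rightarrow> nat \<Rightarrow> bool" where
  "accepts L s M E e y S \<longleftrightarrow> test_mean L E e y S > ref_mean L s M + 1 / 2 ^ s"

text \<open>The offset 3 lets an arm with \<open>ell i \<le> E + 1\<close> reach level
  \<open>ell i + 2\<close> while \<open>y = 1\<close>; there it is rejected with high probability,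
  so it rarely sees increased confidence.\<close>

fun after :: "nat \<Rightarrow> nat \<Rightarrow> block \<Rightarrow> nat \<Rightarrow> block" where
  "after L K (Ref s c E i) S = next_arm K s c S E i"
| "after L K (Test s c M E i e y) S =
     (if rejects L s M E e y S
        then next_arm K s c M (if L \<le> y\<^sup>2 \<and> E < e then e else E) (Suc i)
      else if e < s \<and> e < E + 3 then Test s c M E i (Suc e) y
      else if y\<^sup>2 < L then Test s c M E i e (2 * y)
      else if e < s then Test s c M E i (Suc e) y
      else if accepts L s M E e y S then Ref s i E (Suc i)
      else next_arm K s c M E (Suc i))"

text \<open>The last disjunction lists the three phases of a test: raising \<open>e\<close> at
  \<open>y = 1\<close>, doubling \<open>y\<close> at \<open>e = min s (E + 3)\<close>, raising
  \<open>e\<close> at full confidence. As \<open>y\<close> is doubled only if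
  \<open>y\<^sup>2 < L\<close>, it stays below \<open>2 * sqrt L\<close>.\<close>

fun valid :: "nat \<Rightarrow> nat \<Rightarrow> block \<Rightarrow> bool" where
  "valid L K (Ref s c E i) \<longleftrightarrow> c < K \<and> i \<le> K \<and> E \<le> s"
| "valid L K (Test s c M E i e y) \<longleftrightarrow>
     c < K \<and> i < K \<and> E \<le> s \<and> e \<le> s \<and> 0 < y \<and> y\<^sup>2 < 4 * L \<and>
     (y = 1 \<and> e \<le> E + 3 \<or> e = min s (E + 3) \<or> L \<le> y\<^sup>2 \<and> E + 3 < e)"

lemma conf_pos [simp]: "0 < conf E e"
  by (simp add: conf_def)

lemma conf_eq_1: "E \<le> e \<Longrightarrow> conf E e = 1"
  by (simp add: conf_def)

lemma conf_0 [simp]: "conf E 0 = 1"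
  by (simp add: conf_def)

lemma block_size_pos: "valid L K b \<Longrightarrow> 0 < L \<Longrightarrow> 0 < block_size L b"
  by (cases b) (auto simp: ref_size_def test_size_def)

lemma valid_arm: "valid L K b \<Longrightarrow> block_arm b < K"
  by (cases b) auto

lemma valid_next_arm:
  "c < K \<Longrightarrow> i \<le> K \<Longrightarrow> E \<le> s \<Longrightarrow> 0 < L \<Longrightarrow> valid L K (next_arm K s c M E i)"
  by (auto simp: next_arm_def)

lemma valid_after: "valid L K b \<Longrightarrow> 64 \<le> L \<Longrightarrow> valid L K (after L K b S)"
proof (cases b)
  case (Ref s c E i)
  then show "valid L K b \<Longrightarrow> 64 \<le> L \<Longrightarrow> ?thesis" by (auto intro: valid_next_arm)
next
  case (Test s c M E i e y)
  assume v: "valid L K b" and L: "64 \<le> L"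
  show ?thesis
    using v L unfolding Test
    by (auto simp: power_mult_distrib min_def intro!: valid_next_arm split: if_splits)
qed

lemma floor_sqrt_Suc_le: "floor_sqrt (Suc n) \<le> Suc (floor_sqrt n)"
proof -
  have "Suc n < (Suc (Suc (floor_sqrt n)))\<^sup>2"
    using Suc_floor_sqrt_power2_gt[of n] by (simp add: power2_eq_square)
  then have "\<not> Suc (Suc (floor_sqrt n)) \<le> floor_sqrt (Suc n)"
    by (simp add: le_floor_sqrt_iff)
  then show ?thesis by simp
qed

text \<open>Used twice: consecutive block sizes stay within constant factors, and the program can
  maintain \<open>conf\<close> without computing roots.\<close>

lemma conf_Suc_bounds: "conf E (Suc e) \<le> Suc (conf E e)" "conf E e \<le> Suc (conf E (Suc e))"
proof -
  have "min (Suc e) (E - Suc e) \<le> Suc (min e (E - e))" by auto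
  then have "floor_sqrt (min (Suc e) (E - Suc e)) \<le> floor_sqrt (Suc (min e (E - e)))"
    by (rule mono_floor_sqrt')
  also have "\<dots> \<le> Suc (floor_sqrt (min e (E - e)))" by (rule floor_sqrt_Suc_le)
  finally show "conf E (Suc e) \<le> Suc (conf E e)" by (simp add: conf_def)
  have "min e (E - e) \<le> Suc (min (Suc e) (E - Suc e))" by auto
  then have "floor_sqrt (min e (E - e)) \<le> floor_sqrt (Suc (min (Suc e) (E - Suc e)))"
    by (rule mono_floor_sqrt')
  also have "\<dots> \<le> Suc (floor_sqrt (min (Suc e) (E - Suc e)))" by (rule floor_sqrt_Suc_le)
  finally show "conf E e \<le> Suc (conf E (Suc e))" by (simp add: conf_def)
qed

text \<open>\<open>4 ^ e\<close> gains a factor 4, of which a drop of \<open>conf\<close> loses at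
  most 2. Hence the sizes in one test grow at least geometrically and the last block
  dominates.\<close>

lemma test_size_Suc_ge: "2 * test_size E e y \<le> test_size E (Suc e) y"
proof -
  have "conf E e \<le> 2 * conf E (Suc e)"
    using conf_Suc_bounds(2)[of E e] conf_pos[of E "Suc e"] by linarith
  then have "2 * (512 * 4 ^ e * y\<^sup>2) * conf E e \<le> 2 * (512 * 4 ^ e * y\<^sup>2) * (2 * conf E (Suc e))"
    by (rule mult_le_mono2)
  then show ?thesis by (simp add: test_size_def algebra_simps)
qed

lemma test_size_Suc_le: "test_size E (Suc e) y \<le> 8 * test_size E e y"
proof -
  have "conf E (Suc e) \<le> 2 * conf E e"
    using conf_Suc_bounds(1)[of E e] conf_pos[of E e] by linarith
  then have "512 * 4 ^ Suc e * y\<^sup>2 * conf E (Suc e) \<le> 512 * 4 ^ Suc e * y\<^sup>2 * (2 * conf E e)"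
    by (rule mult_le_mono2)
  then show ?thesis by (simp add: test_size_def algebra_simps)
qed

lemma test_size_double: "test_size E e (2 * y) = 4 * test_size E e y"
  by (simp add: test_size_def power_mult_distrib)

lemma test_size_mono: "e \<le> e' \<Longrightarrow> test_size E e y \<le> test_size E e' y"
proof (induction rule: dec_induct)
  case (step n)
  then show ?case using test_size_Suc_ge[of E n y] by linarith
qed simp

lemma conf_le: "conf E e \<le> Suc E"
  unfolding conf_def using floor_sqrt_le[of "min e (E - e)"] by linarith


text \<open>
  \<open>p a d r\<close> is the probability that a reward of arm \<open>a\<close> is observed as \<open>r / d\<close>. The last assumption is
  Hoeffding's lemma up to the rounding error.
\<close>

locale arm_model =
  fixes K :: nat and mu :: "nat \<Rightarrow> real" and p :: "nat \<Rightarrow> nat \<Rightarrow> nat \<Rightarrow> real"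
  assumes K_pos: "0 < K"
    and mu_nonneg: "a < K \<Longrightarrow> 0 \<le> mu a" and mu_le_1: "a < K \<Longrightarrow> mu a \<le> 1"
    and p_nonneg: "a < K \<Longrightarrow> 0 \<le> p a d r"
    and p_sum: "a < K \<Longrightarrow> (\<Sum>r\<le>d. p a d r) = 1"
    and p_mgf: "a < K \<Longrightarrow> 0 < d \<Longrightarrow>
      (\<Sum>r\<le>d. p a d r * exp (l * (real r / real d - mu a))) \<le> exp (l\<^sup>2 / 8 + \<bar>l\<bar> / real d)"
begin

section \<open>Expectations and tail bounds for one block of observed rewards\<close>

fun EB :: "nat \<Rightarrow> nat \<Rightarrow> nat \<Rightarrow> (nat \<Rightarrow> real) \<Rightarrow> nat \<Rightarrow> real" where
  "EB a d 0 F S = F S"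
| "EB a d (Suc n) F S = (\<Sum>r\<le>d. p a d r * EB a d n F (S + r))"

lemma EB_mono:
  "a < K \<Longrightarrow> (\<And>S. F S \<le> G S) \<Longrightarrow> EB a d n F S \<le> EB a d n G S"
  by (induction n arbitrary: S) (auto intro!: sum_mono mult_left_mono p_nonneg)

lemma EB_const: "a < K \<Longrightarrow> EB a d n (\<lambda>_. c) S = c"
  by (induction n arbitrary: S) (auto simp: p_sum simp flip: sum_distrib_right)

lemma EB_add: "EB a d n (\<lambda>S. F S + G S) S = EB a d n F S + EB a d n G S"
  by (induction n arbitrary: S) (auto simp: sum.distrib algebra_simps)

lemma EB_cmult: "EB a d n (\<lambda>S. c * F S) S = c * EB a d n F S"
  by (induction n arbitrary: S) (auto simp: sum_distrib_left algebra_simps)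

lemma EB_mgf:
  assumes "a < K" "0 < d"
  shows "EB a d n (\<lambda>S. exp (l * (real S / real d - c))) S
    \<le> exp (l * (real S / real d + real n * mu a - c) + real n * (l\<^sup>2 / 8 + \<bar>l\<bar> / real d))"
proof (induction n arbitrary: S)
  case (Suc n)
  let ?B = "l\<^sup>2 / 8 + \<bar>l\<bar> / real d"
  let ?A = "l * (real S / real d + real (Suc n) * mu a - c) + real n * ?B"
  have "EB a d (Suc n) (\<lambda>S. exp (l * (real S / real d - c))) S
      \<le> (\<Sum>r\<le>d. p a d r * exp (l * (real (S + r) / real d + real n * mu a - c) + real n * ?B))"
    unfolding EB.simps by (intro sum_mono mult_left_mono p_nonneg assms Suc.IH)
  also have "\<dots> = (\<Sum>r\<le>d. exp ?A * (p a d r * exp (l * (real r / real d - mu a))))"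
  proof (intro sum.cong refl)
    fix r
    have "l * (real (S + r) / real d + real n * mu a - c) + real n * ?B
        = ?A + l * (real r / real d - mu a)"
      by (simp add: add_divide_distrib algebra_simps)
    then show "p a d r * exp (l * (real (S + r) / real d + real n * mu a - c) + real n * ?B)
        = exp ?A * (p a d r * exp (l * (real r / real d - mu a)))"
      by (simp add: exp_add)
  qed
  also have "\<dots> = exp ?A * (\<Sum>r\<le>d. p a d r * exp (l * (real r / real d - mu a)))"
    by (simp add: sum_distrib_left)
  also have "\<dots> \<le> exp ?A * exp ?B"
    by (intro mult_left_mono p_mgf assms) auto
  also have "\<dots> = exp (l * (real S / real d + real (Suc n) * mu a - c) + real (Suc n) * ?B)"
    by (simp add: algebra_simps add_divide_distrib flip: exp_add)
  finally show ?case .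
qed simp

definition PB :: "nat \<Rightarrow> nat \<Rightarrow> nat \<Rightarrow> (nat \<Rightarrow> bool) \<Rightarrow> real" where
  "PB a d n X = EB a d n (\<lambda>S. of_bool (X S)) 0"

lemma PB_mono: "a < K \<Longrightarrow> (\<And>S. X S \<Longrightarrow> Y S) \<Longrightarrow> PB a d n X \<le> PB a d n Y"
  unfolding PB_def by (intro EB_mono) auto

lemma PB_empty: "a < K \<Longrightarrow> PB a d n (\<lambda>_. False) = 0"
  by (simp add: PB_def EB_const)

lemma PB_disj: "a < K \<Longrightarrow> PB a d n (\<lambda>S. X S \<or> Y S) \<le> PB a d n X + PB a d n Y"
  unfolding PB_def EB_add[symmetric] by (intro EB_mono) auto

text \<open>Chernoff bound with parameter \<open>4 * t\<close>: the exponent is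
  \<open>n * (- 4 * t\<^sup>2 + 2 * t\<^sup>2 + 4 * t / d)\<close>, and \<open>4 \<le> d * t\<close>
  lets the rounding term eat only half of Hoeffding's \<open>2 * n * t\<^sup>2\<close>.\<close>

lemma PB_upper:
  assumes a: "a < K" and d: "0 < d" and n: "0 < n" and t: "0 < t" "4 \<le> real d * t"
  shows "PB a d n (\<lambda>S. mu a + t \<le> real S / (real n * real d)) \<le> exp (- real n * t\<^sup>2)"
proof -
  let ?c = "real n * (mu a + t)"
  have "PB a d n (\<lambda>S. mu a + t \<le> real S / (real n * real d))
    \<le> EB a d n (\<lambda>S. exp (4 * t * (real S / real d - ?c))) 0"
    unfolding PB_def
  proof (rule EB_mono[OF a])
    fix S
    show "of_bool (mu a + t \<le> real S / (real n * real d)) \<le> exp (4 * t * (real S / real d - ?c))"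
    proof (cases "mu a + t \<le> real S / (real n * real d)")
      case True
      then have "?c \<le> real S / real d" using n d by (simp add: field_simps)
      then have "0 \<le> 4 * t * (real S / real d - ?c)" using t by simp
      then show ?thesis by auto
    qed auto
  qed
  also have "\<dots> \<le> exp (4 * t * (real 0 / real d + real n * mu a - ?c)
      + real n * ((4 * t)\<^sup>2 / 8 + \<bar>4 * t\<bar> / real d))"
    by (rule EB_mgf[OF a d])
  also have "\<dots> \<le> exp (- real n * t\<^sup>2)"
  proof -
    have "4 * t / real d \<le> t\<^sup>2" using d t by (simp add: field_simps power2_eq_square)
    then have "real n * (4 * t / real d) \<le> real n * t\<^sup>2" by (intro mult_left_mono) auto
    then show ?thesis using t by (simp add: algebra_simps power2_eq_square)
  qed
  finally show ?thesis .
qed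

lemma PB_lower:
  assumes a: "a < K" and d: "0 < d" and n: "0 < n" and t: "0 < t" "4 \<le> real d * t"
  shows "PB a d n (\<lambda>S. real S / (real n * real d) \<le> mu a - t) \<le> exp (- real n * t\<^sup>2)"
proof -
  let ?c = "real n * (mu a - t)"
  have "PB a d n (\<lambda>S. real S / (real n * real d) \<le> mu a - t)
    \<le> EB a d n (\<lambda>S. exp ((- 4 * t) * (real S / real d - ?c))) 0"
    unfolding PB_def
  proof (rule EB_mono[OF a])
    fix S
    show "of_bool (real S / (real n * real d) \<le> mu a - t) \<le> exp ((- 4 * t) * (real S / real d - ?c))"
    proof (cases "real S / (real n * real d) \<le> mu a - t")
      case True
      then have "real S / real d \<le> ?c" using n d by (simp add: field_simps)
      then have "0 \<le> (- 4 * t) * (real S / real d - ?c)"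
        using t by (intro mult_nonpos_nonpos) auto
      then show ?thesis by auto
    qed auto
  qed
  also have "\<dots> \<le> exp ((- 4 * t) * (real 0 / real d + real n * mu a - ?c)
      + real n * ((- 4 * t)\<^sup>2 / 8 + \<bar>- 4 * t\<bar> / real d))"
    by (rule EB_mgf[OF a d])
  also have "\<dots> \<le> exp (- real n * t\<^sup>2)"
  proof -
    have "4 * t / real d \<le> t\<^sup>2" using d t by (simp add: field_simps power2_eq_square)
    then have "real n * (4 * t / real d) \<le> real n * t\<^sup>2" by (intro mult_left_mono) auto
    then show ?thesis using t by (simp add: algebra_simps power2_eq_square)
  qed
  finally show ?thesis .
qed

section \<open>Gaps and the expected regret of the last pulls of an epoch\<close>

definition best :: real where "best = Max (mu ` {..<K})"

definition gp :: "nat \<Rightarrow> real" where "gp a = best - mu a"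

lemma gp_nonneg: "a < K \<Longrightarrow> 0 \<le> gp a"
  by (auto simp: gp_def best_def)

lemma gp_le_1: "a < K \<Longrightarrow> gp a \<le> 1"
proof -
  assume a: "a < K"
  have "best \<le> 1" using K_pos by (auto simp: best_def mu_le_1 lessThan_empty_iff)
  then show ?thesis using mu_nonneg[OF a] by (simp add: gp_def)
qed

lemma ex_optimal: "\<exists>i<K. gp i = 0"
proof -
  have "best \<in> mu ` {..<K}" unfolding best_def using K_pos by (intro Max_in) auto
  then show ?thesis by (auto simp: gp_def)
qed

text \<open>
  \<open>V L f b n S\<close> is the expected regret of the last \<open>f\<close> pulls of an epoch, started in block \<open>b\<close> when \<open>n\<close> of
  its pulls have been made with total observed reward \<open>S\<close>.
\<close>

fun V :: "nat \<Rightarrow> nat \<Rightarrow> block \<Rightarrow> nat \<Rightarrow> nat \<Rightarrow> real" where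
  "V L 0 b n S = 0"
| "V L (Suc f) b n S = gp (block_arm b) + (\<Sum>r\<le>2 ^ L. p (block_arm b) (2 ^ L) r *
     (if Suc n < block_size L b then V L f b (Suc n) (S + r) else V L f (after L K b (S + r)) 0 0))"

lemma V_le: "valid L K b \<Longrightarrow> 64 \<le> L \<Longrightarrow> V L f b n S \<le> real f"
proof (induction f arbitrary: b n S)
  case (Suc f)
  have "V L (Suc f) b n S \<le> 1 + (\<Sum>r\<le>2 ^ L. p (block_arm b) (2 ^ L) r * real f)"
    unfolding V.simps
    by (intro add_mono sum_mono mult_left_mono p_nonneg gp_le_1 valid_arm[OF Suc.prems(1)])
      (simp add: Suc.IH valid_after Suc.prems)
  also have "\<dots> = real (Suc f)"
    using p_sum[OF valid_arm[OF Suc.prems(1)]] by (simp flip: sum_distrib_right)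
  finally show ?case .
qed simp

text \<open>If the epoch ends inside the block, the truncated subtraction leaves
  \<open>V L 0 = 0\<close> as continuation and the full block is charged, which only increases the
  bound.\<close>

lemma V_block:
  assumes b: "valid L K b" and L: "64 \<le> L"
  shows "n < block_size L b \<Longrightarrow> V L f b n S \<le> real (block_size L b - n) * gp (block_arm b)
    + EB (block_arm b) (2 ^ L) (block_size L b - n)
        (\<lambda>S'. V L (f - (block_size L b - n)) (after L K b S') 0 0) S"
proof (induction f arbitrary: n S)
  case 0
  have "0 \<le> EB (block_arm b) (2 ^ L) (block_size L b - n) (\<lambda>_. 0) S"
    by (simp add: EB_const valid_arm[OF b])
  then show ?case using gp_nonneg[OF valid_arm[OF b]] by simp
next
  case (Suc f)
  let ?a = "block_arm b" and ?m = "block_size L b"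
  have a: "?a < K" using b by (rule valid_arm)
  show ?case
  proof (cases "Suc n < ?m")
    case True
    let ?F = "\<lambda>S'. V L (f - (?m - Suc n)) (after L K b S') 0 0"
    have eq: "?m - n = Suc (?m - Suc n)" using True by simp
    have "V L (Suc f) b n S = gp ?a + (\<Sum>r\<le>2 ^ L. p ?a (2 ^ L) r * V L f b (Suc n) (S + r))"
      using True by simp
    also have "\<dots> \<le> gp ?a + (\<Sum>r\<le>2 ^ L. p ?a (2 ^ L) r *
        (real (?m - Suc n) * gp ?a + EB ?a (2 ^ L) (?m - Suc n) ?F (S + r)))"
      by (intro add_left_mono sum_mono mult_left_mono Suc.IH True p_nonneg a)
    also have "\<dots> = gp ?a + (\<Sum>r\<le>2 ^ L. p ?a (2 ^ L) r) * (real (?m - Suc n) * gp ?a)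
        + EB ?a (2 ^ L) (Suc (?m - Suc n)) ?F S"
      by (simp add: ring_distribs sum.distrib sum_distrib_right)
    also have "\<dots> = real (?m - n) * gp ?a + EB ?a (2 ^ L) (?m - n) (\<lambda>S'. V L (Suc f - (?m - n)) (after L K b S') 0 0) S"
      unfolding eq using p_sum[OF a, of "2 ^ L"] by (simp add: algebra_simps)
    finally show ?thesis .
  next
    case False
    then have "?m - n = 1" using Suc.prems by simp
    then show ?thesis using False by simp
  qed
qed

end

section \<open>The potential function\<close>

text \<open>One optimal arm \<open>istar\<close> is singled out; only the risk of losing this one is
  tracked, since any other optimal arm that becomes champion serves as well.\<close>

locale epoch = arm_model +
  fixes L :: nat and istar :: nat
  assumes L_ge: "64 \<le> L" and istar: "istar < K" "gp istar = 0" and suboptimal: "\<exists>i<K. gp i > 0"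
begin

definition SO :: "nat set" where "SO = {k. k < K \<and> gp k > 0}"

text \<open>The logarithm of \<open>1 / gp k\<close> to base 2, rounded up, so that
  \<open>1 / 2 ^ ell k \<le> gp k < 2 / 2 ^ ell k\<close>.\<close>

definition ell :: "nat \<Rightarrow> nat" where "ell k = (LEAST n. 1 / 2 ^ n \<le> gp k)"

definition e0 :: nat where "e0 = Max (ell ` SO)"

lemma SO_I: "k < K \<Longrightarrow> gp k \<noteq> 0 \<Longrightarrow> k \<in> SO"
  using gp_nonneg[of k] by (simp add: SO_def)

lemma SO_D: "k \<in> SO \<Longrightarrow> k < K" "k \<in> SO \<Longrightarrow> 0 < gp k"
  by (auto simp: SO_def)

lemma finite_SO [simp]: "finite SO"
  by (simp add: SO_def)

lemma ell_le: "k \<in> SO \<Longrightarrow> 1 / 2 ^ ell k \<le> gp k"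
proof -
  assume "k \<in> SO"
  then obtain n where "1 / gp k < 2 ^ n" using real_arch_pow[of 2 "1 / gp k"] by auto
  then have "1 / 2 ^ n \<le> gp k" using SO_D(2)[OF \<open>k \<in> SO\<close>] by (simp add: field_simps)
  then show ?thesis unfolding ell_def by (rule LeastI)
qed

lemma ell_gt: "k \<in> SO \<Longrightarrow> gp k < 2 / 2 ^ ell k"
proof (cases "ell k")
  case 0
  assume "k \<in> SO"
  then show ?thesis using gp_le_1[of k] 0 by (simp add: SO_def)
next
  case (Suc n)
  then have "\<not> 1 / 2 ^ n \<le> gp k" unfolding ell_def using not_less_Least by (metis lessI)
  then show ?thesis using Suc by simp
qed

lemma ell_le_e0: "k \<in> SO \<Longrightarrow> ell k \<le> e0"
  by (simp add: e0_def)

lemma gp_ge_e0: "k < K \<Longrightarrow> gp k \<noteq> 0 \<Longrightarrow> 1 / 2 ^ e0 \<le> gp k"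
proof -
  assume k: "k < K" "gp k \<noteq> 0"
  then have "k \<in> SO" by (rule SO_I)
  have "1 / 2 ^ e0 \<le> (1 :: real) / 2 ^ ell k"
    using ell_le_e0[OF \<open>k \<in> SO\<close>] by (intro divide_left_mono power_increasing) auto
  also have "\<dots> \<le> gp k" by (rule ell_le[OF \<open>k \<in> SO\<close>])
  finally show ?thesis .
qed

text \<open>
  In the following, \<open>g\<close> is the gap of the champion. Arm \<open>k\<close> is hard in round \<open>s\<close> if it cannot be rejected
  early, because the reference is too inaccurate or not sufficiently better than \<open>k\<close>. The number
  \<open>q\<close> bounds the probability that the round ends with a champion that is not yet good; then \<open>nx\<close>
  pays for the hard tests of all later rounds, \<open>ovr\<close> for the confidence lost when \<open>E\<close> exceeds the
  true level \<open>e0\<close>, and the last summand of \<open>phi\<close> for the test of \<open>k\<close> with full confidence that raises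
  \<open>E\<close> to \<open>ell k\<close>.
\<close>

definition hard :: "nat \<Rightarrow> nat \<Rightarrow> real \<Rightarrow> bool" where
  "hard k s g \<longleftrightarrow> s < ell k + 8 \<or> gp k < 4 * g"

definition nx :: "nat \<Rightarrow> nat \<Rightarrow> real \<Rightarrow> real \<Rightarrow> real" where
  "nx k s g q = (if s + 1 < ell k + 8 then 10 * (2 * 4 ^ (ell k + 9) - 4 ^ (s + 1) / 3)
     else if 4 * g \<le> gp k then 0
     else 20 * 4 ^ (s + 1) * (if ell k + 8 \<le> s then q else 1))"

definition kap :: "nat \<Rightarrow> real" where
  "kap k = 1 + sqrt (real (min (ell k + 2) (e0 + 6 - ell k)))"

definition ovr :: "nat \<Rightarrow> real \<Rightarrow> nat \<Rightarrow> real" where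
  "ovr s g E = sqrt (real ((if g = 0 then E else s) - (e0 + 8)))"

definition phi :: "nat \<Rightarrow> nat \<Rightarrow> real \<Rightarrow> nat \<Rightarrow> nat \<Rightarrow> real \<Rightarrow> real" where
  "phi k s g E i q =
     512 * real L * gp k * ((if i \<le> k \<and> hard k s g then 9 * 4 ^ s else 0) + nx k s g q)
     + 200000 / gp k * (real (L + 1 - s - (if k < i then 1 else 0)) * (kap k + ovr s g E)
         + (if 0 < g then 2 * real (L + 1) * (if e0 + 8 \<le> s then q else 1) else 0))
     + (if E + 1 < ell k then 1000000 * real L / gp k else 0)"

definition Phi :: "nat \<Rightarrow> real \<Rightarrow> nat \<Rightarrow> nat \<Rightarrow> real \<Rightarrow> real" where
  "Phi s g E i q = (\<Sum>k\<in>SO. phi k s g E i q)"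

section \<open>Monotonicity of the potential\<close>

lemma kap_ge_1: "1 \<le> kap k" by (simp add: kap_def)
lemma ovr_nonneg: "0 \<le> ovr s g E" by (simp add: ovr_def)

lemma nx_nonneg: "0 \<le> q \<Longrightarrow> 0 \<le> nx k s g q"
proof -
  assume q: "0 \<le> q"
  have "(4::real) ^ (s + 1) \<le> 4 ^ (ell k + 9)" if "s + 1 < ell k + 8"
    using that by (intro power_increasing) auto
  moreover have "(0::real) < 4 ^ (ell k + 9)" by simp
  ultimately show ?thesis using q by (auto simp: nx_def field_simps simp del: zero_less_power)
qed

lemma phi_nonneg: "0 \<le> q \<Longrightarrow> k \<in> SO \<Longrightarrow> 0 \<le> phi k s g E i q"
  unfolding phi_def using SO_D(2)[of k] kap_ge_1[of k] ovr_nonneg[of s g E] nx_nonneg[of q k s g]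
  by (intro add_nonneg_nonneg mult_nonneg_nonneg) auto

lemma Phi_nonneg: "0 \<le> q \<Longrightarrow> 0 \<le> Phi s g E i q"
  by (simp add: Phi_def sum_nonneg phi_nonneg)

lemma Phi_le: "(\<And>k. k \<in> SO \<Longrightarrow> phi k s g E i q \<le> phi k s' g' E' i' q') \<Longrightarrow> Phi s g E i q \<le> Phi s' g' E' i' q'"
  by (simp add: Phi_def sum_mono)

lemma Phi_le_extra:
  assumes "j \<in> SO" "\<And>k. k \<in> SO \<Longrightarrow> phi k s g E i q + (if k = j then x else 0) \<le> phi k s' g' E' i' q'"
  shows "Phi s g E i q + x \<le> Phi s' g' E' i' q'"
proof -
  have "Phi s g E i q + x = (\<Sum>k\<in>SO. phi k s g E i q + (if k = j then x else 0))"
    using assms(1) by (simp add: Phi_def sum.distrib sum.delta)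
  also have "\<dots> \<le> Phi s' g' E' i' q'" unfolding Phi_def by (intro sum_mono assms)
  finally show ?thesis .
qed

lemma nx_mono_q: "q \<le> q' \<Longrightarrow> nx k s g q \<le> nx k s g q'"
  by (auto simp: nx_def)

lemma Phi_mono_q: "q \<le> q' \<Longrightarrow> Phi s g E i q \<le> Phi s g E i q'"
proof (rule Phi_le)
  fix k assume q: "q \<le> q'" and k: "k \<in> SO"
  show "phi k s g E i q \<le> phi k s g E i q'"
    unfolding phi_def using SO_D(2)[OF k] q
    by (intro add_mono mult_left_mono nx_mono_q order_refl) auto
qed

lemma Phi_mono_i: "Phi s g E (Suc i) q \<le> Phi s g E i q"
proof (rule Phi_le)
  fix k assume k: "k \<in> SO"
  show "phi k s g E (Suc i) q \<le> phi k s g E i q"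
    unfolding phi_def using SO_D(2)[OF k] kap_ge_1[of k] ovr_nonneg[of s g E]
    by (intro add_mono mult_left_mono mult_right_mono order_refl) auto
qed

text \<open>Passing arm \<open>i\<close> releases its budget for the current round: the hard test,
  and one of the \<open>L + 1 - s\<close> early tests still reserved. The bound
  \<open>s \<le> L\<close> makes the truncated count really drop by one.\<close>

lemma Phi_own:
  assumes i: "i \<in> SO" and s: "s \<le> L"
  shows "Phi s g E (Suc i) q + ((if hard i s g then 512 * real L * gp i * (9 * 4 ^ s) else 0)
    + 200000 / gp i * (kap i + ovr s g E)) \<le> Phi s g E i q"
proof (rule Phi_le_extra[OF i])
  fix k assume k: "k \<in> SO"
  have R: "real (L + 1 - s) = real (L - s) + 1" using s by (simp add: Suc_diff_le)
  show "phi k s g E (Suc i) q + (if k = i then (if hard i s g then 512 * real L * gp i * (9 * 4 ^ s) else 0)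
    + 200000 / gp i * (kap i + ovr s g E) else 0) \<le> phi k s g E i q"
  proof (cases "k = i")
    case True
    then show ?thesis using R by (simp add: phi_def ring_distribs add_divide_distrib)
  next
    case False
    then have eq: "(Suc i \<le> k) = (i \<le> k)" "(k < Suc i) = (k < i)" by auto
    show ?thesis unfolding phi_def eq using False by simp
  qed
qed

text \<open>A larger \<open>E\<close> can hurt only through \<open>ovr\<close>, and there only for
  \<open>g = 0\<close> beyond level \<open>e0 + 8\<close>; the disjunction excludes exactly
  that.\<close>

lemma phi_mono_E:
  assumes "k \<in> SO" "E \<le> E'" "0 < g \<or> E' \<le> e0 + 8 \<or> E' = E" "0 \<le> g"
  shows "phi k s g E' i q + (if E + 1 < ell k \<and> ell k \<le> E' + 1 then 1000000 * real L / gp k else 0) \<le> phi k s g E i q"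
proof -
  have o: "ovr s g E' \<le> ovr s g E" using assms by (auto simp: ovr_def)
  have "200000 / gp k * (real (L + 1 - s - (if k < i then 1 else 0)) * (kap k + ovr s g E')
         + (if 0 < g then 2 * real (L + 1) * (if e0 + 8 \<le> s then q else 1) else 0))
     \<le> 200000 / gp k * (real (L + 1 - s - (if k < i then 1 else 0)) * (kap k + ovr s g E)
         + (if 0 < g then 2 * real (L + 1) * (if e0 + 8 \<le> s then q else 1) else 0))"
    using o SO_D(2)[OF assms(1)] by (intro mult_left_mono add_mono order_refl) auto
  then show ?thesis unfolding phi_def using assms(2) SO_D(2)[OF assms(1)] by auto
qed

lemma Phi_mono_E:
  assumes "E \<le> E'" "0 < g \<or> E' \<le> e0 + 8 \<or> E' = E" "0 \<le> g"
  shows "Phi s g E' i q \<le> Phi s g E i q"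
proof (rule Phi_le)
  fix k assume k: "k \<in> SO"
  have "0 \<le> (if E + 1 < ell k \<and> ell k \<le> E' + 1 then 1000000 * real L / gp k else 0)"
    using SO_D(2)[OF k] by auto
  with phi_mono_E[OF k assms, of s i q] show "phi k s g E' i q \<le> phi k s g E i q" by linarith
qed

text \<open>A rejection that lifts \<open>E\<close> to at least \<open>ell j - 1\<close> frees the
  last summand of \<open>phi\<close> for arm \<open>j\<close>. This is what pays for a test at full
  confidence.\<close>

lemma Phi_credit:
  assumes "E \<le> E'" "0 < g \<or> E' \<le> e0 + 8 \<or> E' = E" "0 \<le> g" "j \<in> SO" "E + 1 < ell j" "ell j \<le> E' + 1"
  shows "Phi s g E' i q + 1000000 * real L / gp j \<le> Phi s g E i q"
proof (rule Phi_le_extra[OF assms(4)])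
  fix k assume k: "k \<in> SO"
  have "(if k = j then 1000000 * real L / gp j else 0)
      \<le> (if E + 1 < ell k \<and> ell k \<le> E' + 1 then 1000000 * real L / gp k else 0)"
    using SO_D(2)[OF k] assms(5,6) by auto
  with phi_mono_E[OF k assms(1,2,3), of s i q]
  show "phi k s g E' i q + (if k = j then 1000000 * real L / gp j else 0) \<le> phi k s g E i q" by linarith
qed

lemma Phi_mono_g:
  assumes "0 \<le> g'" "g' \<le> g" "E \<le> s" "0 \<le> q"
  shows "Phi s g' E i q \<le> Phi s g E i q"
proof (rule Phi_le)
  fix k assume k: "k \<in> SO"
  have h: "hard k s g' \<Longrightarrow> hard k s g" using assms by (auto simp: hard_def)
  have n: "nx k s g' q \<le> nx k s g q" using assms by (auto simp: nx_def)
  have o: "ovr s g' E \<le> ovr s g E" using assms by (auto simp: ovr_def)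
  show "phi k s g' E i q \<le> phi k s g E i q"
    unfolding phi_def using SO_D(2)[OF k] h n o assms
    by (intro add_mono mult_left_mono order_refl) auto
qed

lemma Phi_0: "Phi s 0 E i q = Phi s 0 E i q'"
proof -
  have "phi k s 0 E i q = phi k s 0 E i q'" if "k \<in> SO" for k
    using SO_D(2)[OF that] by (simp add: phi_def nx_def)
  then show ?thesis by (simp add: Phi_def)
qed

lemma Phi_found:
  assumes "0 \<le> g" "E \<le> s"
  shows "Phi s 0 E i q \<le> Phi s g E i 0"
  using Phi_mono_g[of 0 g E s 0 i] assms Phi_0[of s E i q 0] by simp

text \<open>By affinity, the potential at \<open>q\<close> is the mean over success
  (\<open>q = 0\<close>) and failure (\<open>q = 1\<close>) with failure probability
  \<open>q\<close>. So failure probabilities of the blocks of a test simply add up in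
  \<open>q\<close>.\<close>

lemma Phi_affine: "Phi s g E i q = Phi s g E i 0 + q * (Phi s g E i 1 - Phi s g E i 0)"
proof -
  have "phi k s g E i q = phi k s g E i 0 + q * (phi k s g E i 1 - phi k s g E i 0)" for k
    by (simp add: phi_def nx_def algebra_simps)
  then have "Phi s g E i q = (\<Sum>k\<in>SO. phi k s g E i 0 + q * (phi k s g E i 1 - phi k s g E i 0))"
    by (simp add: Phi_def)
  also have "\<dots> = Phi s g E i 0 + q * (Phi s g E i 1 - Phi s g E i 0)"
    by (simp add: Phi_def sum.distrib sum_subtractf flip: sum_distrib_left)
  finally show ?thesis .
qed

section \<open>The potential between rounds\<close>

lemma pow2_div_le: "m \<le> n \<Longrightarrow> (1::real) / 2 ^ n \<le> 1 / 2 ^ m"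
  by (intro divide_left_mono power_increasing) auto

text \<open>Both terms with \<open>q\<close> are inactive for such a champion:
  \<open>ell k + 8 \<le> s\<close> gives \<open>4 * gp c \<le> gp k\<close>, and
  \<open>e0 + 8 \<le> s\<close> even forces \<open>gp c = 0\<close>. So the fate of
  \<open>istar\<close> matters only if \<open>gp c > 64 / 2 ^ s\<close>.\<close>

lemma Phi_cold:
  assumes c: "c < K" and g: "gp c \<le> 64 / 2 ^ s"
  shows "Phi s (gp c) E i q = Phi s (gp c) E i q'"
proof -
  have "phi k s (gp c) E i q = phi k s (gp c) E i q'" if k: "k \<in> SO" for k
  proof -
    have "4 * gp c \<le> gp k" if "ell k + 8 \<le> s"
    proof -
      have "4 * gp c \<le> 256 / 2 ^ s" using g by simp
      also have "\<dots> \<le> 256 * (1 / 2 ^ (ell k + 8))" using pow2_div_le[OF that] by simp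
      also have "\<dots> = 1 / 2 ^ ell k" by (simp add: power_add)
      finally show ?thesis using ell_le[OF k] by simp
    qed
    moreover have "gp c = 0" if "e0 + 8 \<le> s"
    proof (rule ccontr)
      assume "gp c \<noteq> 0"
      then have "1 / 2 ^ e0 \<le> gp c" using c by (intro gp_ge_e0)
      also have "\<dots> \<le> 64 * (1 / 2 ^ (e0 + 8))" using g pow2_div_le[OF that] by simp
      also have "\<dots> < 1 / 2 ^ e0" by (simp add: power_add divide_less_eq)
      finally show False by simp
    qed
    ultimately show ?thesis by (auto simp: phi_def nx_def)
  qed
  then show ?thesis by (simp add: Phi_def)
qed

text \<open>Before level \<open>ell k + 8\<close> the formula telescopes, since
  \<open>4 ^ (s + 2) / 3 - 4 ^ (s + 1) = 4 ^ (s + 1) / 3\<close>. Afterwards it is the series of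
  ratio 4/8: \<open>10 + 20 * 4 / 8 = 20\<close>.\<close>

lemma nx_round: "(if hard k (Suc s) g then 10 * 4 ^ Suc s else 0) + nx k (Suc s) g (1 / 8) \<le> nx k s g 1"
proof -
  consider "s + 2 < ell k + 8" | "s + 2 = ell k + 8" | "ell k + 8 \<le> s + 1" by linarith
  then show ?thesis
  proof cases
    case 1
    then show ?thesis by (auto simp: nx_def hard_def)
  next
    case 2
    then have s: "ell k = s - 6" "6 \<le> s" by auto
    then have "(4::real) ^ (ell k + 9) = 4 ^ (s + 3)" by simp
    then show ?thesis using 2 by (auto simp: nx_def hard_def power_add)
  next
    case 3
    then show ?thesis by (auto simp: nx_def hard_def)
  qed
qed

lemma sqrt_Suc_le: "sqrt (real (Suc n)) \<le> sqrt (real n) + 1"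
  by (rule real_le_lsqrt) (auto simp: power2_eq_square algebra_simps)

text \<open>While the champion is suboptimal, \<open>ovr\<close> grows by at most 1 per round, which
  costs at most \<open>L + 1\<close> over the rounds left; the series closes because
  \<open>(L + 1) + 2 * (L + 1) / 8 \<le> 2 * (L + 1)\<close>.\<close>

lemma ovr_round:
  assumes "R \<le> real (L + 1)" "0 \<le> R" "0 \<le> g"
  shows "R * ovr (Suc s) g E + (if 0 < g then 2 * real (L + 1) * (if e0 + 8 \<le> Suc s then 1 / 8 else 1) else 0)
    \<le> R * ovr s g E + (if 0 < g then 2 * real (L + 1) * (if e0 + 8 \<le> s then 1 else 1) else 0)"
proof (cases "0 < g")
  case True
  show ?thesis
  proof (cases "e0 + 8 \<le> s")
    case t: True
    have "ovr (Suc s) g E \<le> ovr s g E + 1"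
      using sqrt_Suc_le[of "s - (e0 + 8)"] True t by (simp add: ovr_def Suc_diff_le)
    then have "R * ovr (Suc s) g E \<le> R * (ovr s g E + 1)" using assms by (intro mult_left_mono)
    then show ?thesis using True t assms by (simp add: algebra_simps)
  next
    case False
    then have "ovr (Suc s) g E = 0" "ovr s g E = 0" using True by (auto simp: ovr_def)
    then show ?thesis using True by simp
  qed
next
  case False
  then show ?thesis using assms by (cases "g = 0") (auto simp: ovr_def intro!: mult_left_mono)
qed

text \<open>The reference block of the new round is charged to the champion itself, which is hard
  whenever suboptimal because \<open>gp c < 4 * gp c\<close>. That is the step from 9 in
  \<open>phi\<close> to 10 in \<open>nx\<close>.\<close>

lemma Phi_round:
  assumes c: "c < K" and s: "s \<le> L"
  shows "Phi (Suc s) (gp c) E 0 (1 / 8) + 512 * real L * 4 ^ Suc s * gp c \<le> Phi s (gp c) E K 1"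
proof -
  let ?g = "gp c"
  have main: "phi k (Suc s) ?g E 0 (1 / 8) + (if k = c then 512 * real L * 4 ^ Suc s * ?g else 0) \<le> phi k s ?g E K 1"
    if k: "k \<in> SO" for k
  proof -
    have kK: "k < K" and gk: "0 < gp k" using SO_D[OF k] by auto
    define R where "R = real (L - s)"
    have R1: "real (L + 1 - Suc s - (if k < 0 then 1 else 0)) = R" "real (L + 1 - s - (if k < K then 1 else 0)) = R"
      using kK s by (auto simp: R_def)
    have o: "R * ovr (Suc s) ?g E + (if 0 < ?g then 2 * real (L + 1) * (if e0 + 8 \<le> Suc s then 1 / 8 else 1) else 0)
      \<le> R * ovr s ?g E + (if 0 < ?g then 2 * real (L + 1) * (if e0 + 8 \<le> s then 1 else 1) else 0)"
      using gp_nonneg[OF c] by (intro ovr_round) (auto simp: R_def)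
    have "200000 / gp k * (R * (kap k + ovr (Suc s) ?g E) + (if 0 < ?g then 2 * real (L + 1) * (if e0 + 8 \<le> Suc s then 1 / 8 else 1) else 0))
      \<le> 200000 / gp k * (R * (kap k + ovr s ?g E) + (if 0 < ?g then 2 * real (L + 1) * (if e0 + 8 \<le> s then 1 else 1) else 0))"
      using o gk by (intro mult_left_mono) (auto simp: ring_distribs)
    moreover have "512 * real L * gp k * ((if 0 \<le> k \<and> hard k (Suc s) ?g then 9 * 4 ^ Suc s else 0) + nx k (Suc s) ?g (1 / 8))
        + (if k = c then 512 * real L * 4 ^ Suc s * ?g else 0)
      \<le> 512 * real L * gp k * ((if K \<le> k \<and> hard k s ?g then 9 * 4 ^ s else 0) + nx k s ?g 1)"
    proof -
      have "(if k = c then 512 * real L * 4 ^ Suc s * ?g else 0)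
        \<le> 512 * real L * gp k * (if hard k (Suc s) ?g then 4 ^ Suc s else 0)"
        using gk by (auto simp: hard_def)
      moreover have "512 * real L * gp k * ((if hard k (Suc s) ?g then 10 * 4 ^ Suc s else 0) + nx k (Suc s) ?g (1 / 8))
        \<le> 512 * real L * gp k * nx k s ?g 1"
        using gk by (intro mult_left_mono nx_round) auto
      ultimately show ?thesis using kK by (cases "hard k (Suc s) ?g") (auto simp: ring_distribs)
    qed
    ultimately show ?thesis unfolding phi_def R1 by linarith
  qed
  show ?thesis
  proof (cases "gp c = 0")
    case True
    have "phi k (Suc s) ?g E 0 (1 / 8) \<le> phi k s ?g E K 1" if "k \<in> SO" for k
      using main[OF that] True by (cases "k = c") auto
    then show ?thesis using True by (simp add: Phi_le)
  next
    case False
    then have "c \<in> SO" using c by (intro SO_I)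
    then show ?thesis by (rule Phi_le_extra) (use main in blast)
  qed
qed

end

section \<open>One block of the chain\<close>

context epoch
begin

text \<open>Once \<open>istar\<close> has had its turn in the round, nothing guarantees that a bad
  champion is replaced before the next round, hence the trivial bound 1.\<close>

definition qf :: "nat \<Rightarrow> real" where "qf i = (if i \<le> istar then 1 / 8 else 1)"

definition mean_ok :: "nat \<Rightarrow> nat \<Rightarrow> nat \<Rightarrow> bool" where
  "mean_ok s c M \<longleftrightarrow> \<bar>ref_mean L s M - mu c\<bar> \<le> 1 / (8 * 2 ^ s)"

text \<open>The fuel condition says that at least \<open>4 ^ s - 1\<close> pulls precede round
  \<open>s\<close>, and \<open>4 ^ Suc s - 1\<close> once a reference block of the round is
  complete; a \<open>Ref\<close> with \<open>i > 0\<close> follows such a block. The last clause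
  says that an easy arm reaches full confidence only if \<open>E\<close> is still too low for it,
  and never passes level \<open>ell i + 2\<close> then; violations are put into rare events.\<close>

fun good :: "nat \<Rightarrow> block \<Rightarrow> bool" where
  "good f (Ref s c E i) \<longleftrightarrow> valid L K (Ref s c E i) \<and>
     (0 < f \<longrightarrow> f + 4 ^ (if i = 0 then s else Suc s) \<le> 2 ^ L + 1)"
| "good f (Test s c M E i e y) \<longleftrightarrow> valid L K (Test s c M E i e y) \<and>
     (0 < f \<longrightarrow> f + 4 ^ Suc s \<le> 2 ^ L + 1) \<and> mean_ok s c M \<and>
     (gp i = 0 \<or> hard i s (gp c) \<or> y\<^sup>2 < L \<or> E + 1 < ell i \<and> e \<le> ell i + 2)"

text \<open>One summand per phase of a test: the early levels, the doublings of \<open>y\<close> (a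
  series bounded by twice its first term), and the levels at full confidence.\<close>

definition miss :: "nat \<Rightarrow> nat \<Rightarrow> nat \<Rightarrow> nat \<Rightarrow> real" where
  "miss s E e y = (\<Sum>e'\<in>{e..<min s (E + 3)}. exp (- 512 * real (conf E e')))
     + 2 * exp (- 512 * real (y\<^sup>2)) + real (s - e) * exp (- 512 * real L)"

text \<open>At \<open>e = E + 3\<close> the mean of arm \<open>i\<close> exceeds the rejection bound
  by \<open>margin / (y * 2 ^ e)\<close>, so the probability of the wrong outcome depends on this
  number alone.\<close>

definition margin :: "nat \<Rightarrow> nat \<Rightarrow> nat \<Rightarrow> nat \<Rightarrow> nat \<Rightarrow> real" where
  "margin s M E i y = real y * (2 - (ref_mean L s M - mu i) * 2 ^ (E + 3)) - 1"

text \<open>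
  The terms \<open>- n\<close> record that the current test still has a geometric series of block sizes ahead.
  \<open>miss\<close> bounds the probability that the remaining blocks reject the optimal arm \<open>istar\<close>.
\<close>

fun psi :: "block \<Rightarrow> real" where
  "psi (Ref s c E i) = Phi s (gp c) E i (qf i) + 512 * real L * 4 ^ s * gp c"
| "psi (Test s c M E i e y) =
     (let B = Phi s (gp c) E (Suc i) (qf (Suc i)); n = real (test_size E e y) in
      if gp i = 0 then
        (if i = istar \<and> 64 / 2 ^ s < gp c then Phi s (gp c) E (Suc i) (miss s E e y) else B)
      else if hard i s (gp c) then B + gp i * (9 * (512 * real L * 4 ^ s) - n)
      else if ell i \<le> E + 1 then
        B + gp i * (if ell i + 2 \<le> e then 2 * n else 3 * real (test_size E (ell i + 2) 1) - n)
      else if e < E + 3 then B + gp i * (3 * real (test_size E (E + 3) 1) - n)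
      else if e = E + 3 \<and> margin s M E i y < 1 / 2 then B + gp i * (2 * n)
      else B - 1000000 * real L / gp i + gp i * (3 * (512 * 4 ^ (ell i + 2) * (4 * real L)) - n)
        + (if e = E + 3 then 2 * exp (- 256 * margin s M E i y) * (1000000 * real L / gp i) else 0))"

text \<open>\<open>X\<close> is a failure whose cost \<open>w\<close> is part of the potential.
  \<open>Y\<close> is so rare that the trivial cost \<open>2 ^ L\<close> suffices: it adds
  \<open>1 / 2 ^ L\<close>, and a block consumes at least one pull, so these errors sum up to
  \<open>f / 2 ^ L\<close>.\<close>

lemma V_step:
  assumes b: "valid L K b" and f: "0 < f" and n: "n = block_size L b"
    and W: "\<And>S. V L (f - n) (after L K b S) 0 0
      \<le> x + w * of_bool (X S) + 2 ^ L * of_bool (Y S) + real (f - n) / 2 ^ L"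
    and X: "PB (block_arm b) (2 ^ L) n X \<le> px" and Y: "PB (block_arm b) (2 ^ L) n Y \<le> 1 / 4 ^ L"
    and v: "real n * gp (block_arm b) + x + w * px \<le> v" and w: "0 \<le> w"
  shows "V L f b 0 0 \<le> v + real f / 2 ^ L"
proof -
  let ?a = "block_arm b"
  have a: "?a < K" using b by (rule valid_arm)
  have n0: "0 < n" using block_size_pos[OF b] L_ge n by simp
  have "V L f b 0 0 \<le> real n * gp ?a + EB ?a (2 ^ L) n (\<lambda>S. V L (f - n) (after L K b S) 0 0) 0"
    using V_block[OF b L_ge, of 0 f 0] n0 n by simp
  also have "\<dots> \<le> real n * gp ?a + EB ?a (2 ^ L) n
      (\<lambda>S. (x + w * of_bool (X S)) + (2 ^ L * of_bool (Y S) + real (f - n) / 2 ^ L)) 0"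
    by (intro add_left_mono EB_mono[OF a]) (use W in \<open>simp add: add.assoc\<close>)
  also have "\<dots> = real n * gp ?a + x + w * PB ?a (2 ^ L) n X + 2 ^ L * PB ?a (2 ^ L) n Y + real (f - n) / 2 ^ L"
    unfolding EB_add EB_cmult by (simp add: EB_const[OF a] PB_def)
  also have "\<dots> \<le> real n * gp ?a + x + w * px + 2 ^ L * (1 / 4 ^ L) + real (f - n) / 2 ^ L"
    by (intro add_mono mult_left_mono X Y w order_refl) auto
  also have "\<dots> \<le> v + (1 + real (f - n)) / 2 ^ L"
  proof -
    have "(4::real) ^ L = 2 ^ L * 2 ^ L" by (simp flip: power_mult_distrib)
    then have "2 ^ L * (1 / 4 ^ L) = (1::real) / 2 ^ L" by simp
    then show ?thesis using v by (simp add: add_divide_distrib)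
  qed
  also have "\<dots> \<le> v + real f / 2 ^ L"
    using f n0 by (intro add_left_mono divide_right_mono) auto
  finally show ?thesis .
qed

section \<open>Numerical bounds for probabilities, resolution and block sizes\<close>

lemma exp_delta: "4 * exp (- 4 * real L) \<le> 1 / 4 ^ L"
proof -
  have e1: "4 \<le> exp (2::real)"
  proof -
    have "(2::real) \<le> exp 1" using exp_ge_add_one_self[of "1::real"] by simp
    then have "2 * 2 \<le> exp (1::real) * exp 1" by (intro mult_mono) auto
    then show ?thesis by (simp flip: exp_add)
  qed
  have "(4::real) ^ Suc L \<le> exp 2 ^ Suc L" using e1 by (intro power_mono) auto
  also have "\<dots> = exp (2 * real (Suc L))" by (simp add: exp_of_nat_mult[symmetric] mult.commute del: power_Suc of_nat_Suc)
  also have "\<dots> \<le> exp (4 * real L)" using L_ge by simp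
  finally show ?thesis by (simp add: exp_minus field_simps)
qed

lemma exp_delta1:
  assumes "4 * real L \<le> x" shows "exp (- x) \<le> 1 / 4 ^ L / 4"
  using exp_delta order_trans[of "exp (- x)" "exp (- 4 * real L)"] assms by simp

lemma exp_delta2:
  assumes "4 * real L \<le> x" shows "exp (- x) \<le> 1 / 4 ^ L"
proof -
  have "1 / 4 ^ L / 4 \<le> (1::real) / 4 ^ L" by (simp add: field_simps)
  with exp_delta1[OF assms] show ?thesis by (rule order_trans)
qed

lemma add_quarters: "a \<le> d / 4 \<Longrightarrow> b \<le> d / 4 \<Longrightarrow> 0 \<le> d \<Longrightarrow> a + b \<le> d" for d :: real
  by simp

text \<open>Squaring reduces the claim to
  \<open>65536 * (4 * L) * 4 ^ s \<le> 2 ^ L * 2 ^ L\<close>, which splits into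
  \<open>65536 * L \<le> 2 ^ L\<close>, from \<open>L \<ge> 64\<close>, and
  \<open>4 ^ Suc s \<le> 2 ^ L\<close>, from the number of rounds.\<close>

lemma resolution:
  assumes s: "2 * Suc s \<le> L" and y: "y\<^sup>2 < 4 * L" "0 < y" and t: "1 / (64 * real y * 2 ^ s) \<le> t"
  shows "4 \<le> 2 ^ L * t"
proof -
  have "(2::real) ^ 16 * real L \<le> 2 ^ L"
  proof -
    have "L - 16 \<ge> 48" using L_ge by simp
    have "L < 2 ^ (L - 16)"
      using L_ge
    proof (induction L rule: dec_induct)
      case (step n)
      then have "Suc n - 16 = Suc (n - 16)" by simp
      then have "2 ^ (Suc n - 16) = (2::nat) * 2 ^ (n - 16)" by (simp only: power_Suc)
      with step show ?case by linarith
    qed simp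
    then have "2 ^ 16 * L \<le> 2 ^ 16 * 2 ^ (L - 16)" by simp
    also have "\<dots> = (2::nat) ^ (16 + (L - 16))" by (simp only: power_add)
    also have "\<dots> = 2 ^ L" using L_ge by simp
    finally have "real (2 ^ 16 * L) \<le> real (2 ^ L)" unfolding of_nat_le_iff .
    then show ?thesis by simp
  qed
  then have A: "65536 * real L \<le> 2 ^ L" by simp
  have "(4::real) ^ Suc s = 2 ^ (2 * Suc s)" by (metis power_mult num_double numeral_times_numeral power2_eq_square)
  also have "\<dots> \<le> 2 ^ L" using s by (intro power_increasing) auto
  finally have B: "4 * (2 ^ s)\<^sup>2 \<le> (2::real) ^ L" by (simp add: power2_eq_square flip: power_mult_distrib)
  have "(256 * real y * 2 ^ s)\<^sup>2 = 65536 * (real y)\<^sup>2 * (2 ^ s)\<^sup>2" by (simp add: power_mult_distrib)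
  also have "\<dots> \<le> 65536 * (4 * real L) * (2 ^ s)\<^sup>2"
  proof (intro mult_right_mono mult_left_mono)
    have "real (y\<^sup>2) \<le> real (4 * L)" using y(1) by (intro of_nat_mono) simp
    then show "(real y)\<^sup>2 \<le> 4 * real L" by simp
  qed auto
  also have "\<dots> = (65536 * real L) * (4 * (2 ^ s)\<^sup>2)" by simp
  also have "\<dots> \<le> 2 ^ L * 2 ^ L" by (rule mult_mono[OF A B]) simp_all
  also have "\<dots> = (2 ^ L)\<^sup>2" by (rule power2_eq_square[symmetric])
  finally have "256 * real y * 2 ^ s \<le> 2 ^ L"
    by (rule power2_le_imp_le) simp
  then have "4 \<le> 2 ^ L * (1 / (64 * real y * 2 ^ s))" using y(2) by (simp add: field_simps)
  also have "\<dots> \<le> 2 ^ L * t" using t by (intro mult_left_mono) auto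
  finally show ?thesis .
qed

lemma test_size_pos: "0 < y \<Longrightarrow> 0 < test_size E e y"
  by (simp add: test_size_def)

lemma test_upper:
  assumes "i < K" "0 < y" "0 < t" "4 \<le> 2 ^ L * t" "x \<le> real (test_size E e y) * t\<^sup>2"
    and X: "\<And>S. X S \<Longrightarrow> mu i + t \<le> test_mean L E e y S"
  shows "PB i (2 ^ L) (test_size E e y) X \<le> exp (- x)"
proof -
  have "PB i (2 ^ L) (test_size E e y) X \<le> PB i (2 ^ L) (test_size E e y) (\<lambda>S. mu i + t \<le> test_mean L E e y S)"
    by (intro PB_mono assms X)
  also have "\<dots> \<le> exp (- real (test_size E e y) * t\<^sup>2)"
    using PB_upper[OF assms(1), of "2 ^ L" "test_size E e y" t] assms by (simp add: test_size_pos test_mean_def)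
  also have "\<dots> \<le> exp (- x)" using assms(5) by simp
  finally show ?thesis .
qed

lemma test_lower:
  assumes "i < K" "0 < y" "0 < t" "4 \<le> 2 ^ L * t" "x \<le> real (test_size E e y) * t\<^sup>2"
    and X: "\<And>S. X S \<Longrightarrow> test_mean L E e y S \<le> mu i - t"
  shows "PB i (2 ^ L) (test_size E e y) X \<le> exp (- x)"
proof -
  have "PB i (2 ^ L) (test_size E e y) X \<le> PB i (2 ^ L) (test_size E e y) (\<lambda>S. test_mean L E e y S \<le> mu i - t)"
    by (intro PB_mono assms X)
  also have "\<dots> \<le> exp (- real (test_size E e y) * t\<^sup>2)"
    using PB_lower[OF assms(1), of "2 ^ L" "test_size E e y" t] assms by (simp add: test_size_pos test_mean_def)
  also have "\<dots> \<le> exp (- x)" using assms(5) by simp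
  finally show ?thesis .
qed

definition final :: "nat \<Rightarrow> nat \<Rightarrow> nat \<Rightarrow> bool" where
  "final s e y \<longleftrightarrow> s \<le> e \<and> L \<le> y\<^sup>2"

definition adv_e :: "nat \<Rightarrow> nat \<Rightarrow> nat \<Rightarrow> nat \<Rightarrow> nat" where
  "adv_e s E e y = (if e < s \<and> e < E + 3 \<or> L \<le> y\<^sup>2 then Suc e else e)"

definition adv_y :: "nat \<Rightarrow> nat \<Rightarrow> nat \<Rightarrow> nat \<Rightarrow> nat" where
  "adv_y s E e y = (if e < s \<and> e < E + 3 \<or> L \<le> y\<^sup>2 then y else 2 * y)"

text \<open>All ways of continuing a test are merged into one, because each of them multiplies the
  block size by a factor between 2 and 8.\<close>

lemma after_Test:
  "after L K (Test s c M E i e y) S =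
     (if rejects L s M E e y S
        then next_arm K s c M (if L \<le> y\<^sup>2 \<and> E < e then e else E) (Suc i)
      else if final s e y
        then (if accepts L s M E e y S then Ref s i E (Suc i) else next_arm K s c M E (Suc i))
      else Test s c M E i (adv_e s E e y) (adv_y s E e y))"
  by (auto simp: after.simps(2) final_def adv_e_def adv_y_def)

declare after.simps(2) [simp del]

lemma adv_size: "2 * test_size E e y \<le> test_size E (adv_e s E e y) (adv_y s E e y)"
    "test_size E (adv_e s E e y) (adv_y s E e y) \<le> 8 * test_size E e y"
  by (auto simp: adv_e_def adv_y_def test_size_Suc_ge test_size_Suc_le test_size_double)

lemma fuel_rounds:
  fixes f :: nat
  assumes "0 < f" "f + 4 ^ t \<le> 2 ^ L + 1"
  shows "2 * t \<le> L"
proof -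
  have "(2::nat) ^ (2 * t) \<le> 2 ^ L" using assms by (simp add: power_mult)
  then show ?thesis by simp
qed

text \<open>Either \<open>y = 1\<close>, and \<open>conf E e\<close> is at most
  \<open>E + 1\<close>; or \<open>e \<ge> E\<close>, so that \<open>conf E e = 1\<close> and only
  \<open>y\<^sup>2 < 4 * L\<close> matters. The two confidence factors are never large
  together.\<close>

lemma test_size_le:
  assumes v: "valid L K (Test s c M E i e y)" and s: "s \<le> L"
  shows "test_size E e y \<le> 4 * (512 * L * 4 ^ s)"
proof -
  have v': "E \<le> s" "e \<le> s" "0 < y" "y\<^sup>2 < 4 * L"
    "y = 1 \<and> e \<le> E + 3 \<or> e = min s (E + 3) \<or> L \<le> y\<^sup>2 \<and> E + 3 < e" using v by auto
  have "conf E e * y\<^sup>2 \<le> 4 * L"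
  proof (cases "y = 1")
    case True
    then show ?thesis using conf_le[of E e] v' s L_ge by simp
  next
    case False
    then have "E \<le> e" using v' by auto
    then show ?thesis using v' by (simp add: conf_eq_1)
  qed
  moreover have "(4::nat) ^ e \<le> 4 ^ s" using v' by (intro power_increasing) auto
  ultimately have "4 ^ e * (conf E e * y\<^sup>2) \<le> 4 ^ s * (4 * L)" by (rule mult_le_mono[rotated])
  then show ?thesis by (simp add: test_size_def algebra_simps)
qed

section \<open>The probability that a test rejects the optimal arm\<close>

lemma exp_512_le: "exp (- 512 * real m) \<le> 1 / (1024 * real m ^ 4)" if "0 < m"
proof -
  have "(1 + 128 * real m) ^ 4 \<le> exp (128 * real m) ^ 4"
    by (intro power_mono exp_ge_add_one_self_aux) auto
  then have "(128 * real m) ^ 4 \<le> exp (128 * real m) ^ 4"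
    by (intro order_trans[OF power_mono[of "128 * real m" "1 + 128 * real m" 4]]) auto
  also have "\<dots> = exp (512 * real m)" by (simp flip: exp_of_nat_mult)
  finally have "268435456 * real m ^ 4 \<le> exp (512 * real m)" by (simp add: power_mult_distrib)
  moreover have "1024 * real m ^ 4 \<le> 268435456 * real m ^ 4" by simp
  ultimately have "1024 * real m ^ 4 \<le> exp (512 * real m)" by linarith
  then show ?thesis using that by (simp add: exp_minus divide_simps mult.commute)
qed

text \<open>As \<open>(conf E e)\<^sup>2\<close> exceeds \<open>min e (E - e)\<close>, the
  exponential is below an inverse square of one plus the minimum. Replacing the minimum by both
  candidates makes the sum over \<open>e\<close> two copies of the same series.\<close>

lemma exp_conf_le:
  "exp (- 512 * real (conf E e)) \<le> 1 / (1024 * (1 + real e)\<^sup>2) + 1 / (1024 * (1 + real (E - e))\<^sup>2)"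
proof -
  have *: "1 / (1024 * real (conf E e) ^ 4) \<le> 1 / (1024 * (1 + real k)\<^sup>2)" if "k = min e (E - e)" for k
  proof -
    have "Suc k \<le> (conf E e)\<^sup>2" unfolding conf_def using Suc_floor_sqrt_power2_gt[of k] that by simp
    then have "(Suc k)\<^sup>2 \<le> ((conf E e)\<^sup>2)\<^sup>2" by (intro power_mono) auto
    then have "(1 + real k)\<^sup>2 \<le> real (conf E e) ^ 4"
      by (metis (no_types, lifting) mult_2 numeral_Bit0 of_nat_Suc of_nat_le_iff of_nat_power power2_eq_square power_add)
    then show ?thesis by (intro divide_left_mono mult_left_mono) auto
  qed
  have "exp (- 512 * real (conf E e)) \<le> 1 / (1024 * real (conf E e) ^ 4)" by (rule exp_512_le) simp
  then show ?thesis using *[of e] *[of "E - e"]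
    by (cases "e \<le> E - e") (auto simp: min_def intro: order_trans add_increasing add_increasing2)
qed

lemma sum_inverse_squares: "0 < n \<Longrightarrow> (\<Sum>k<n. 1 / (1 + real k)\<^sup>2) \<le> 2 - 1 / real n"
proof (induction n rule: nat_induct_non_zero)
  case (Suc n)
  have "1 / (1 + real n)\<^sup>2 \<le> 1 / real n - 1 / (1 + real n)"
    using Suc.hyps by (simp add: divide_simps) (simp add: algebra_simps power2_eq_square)
  then show ?case using Suc.IH by simp
qed simp

text \<open>The two series of inverse squares give at most \<open>4 / 1024\<close>, levels
  \<open>E + 1\<close> and \<open>E + 2\<close>, where \<open>conf\<close> is 1, two more
  exponentials, the doublings another two, and full confidence at most
  \<open>1 / 1024\<close>.\<close>

lemma miss_start:
  assumes s: "s \<le> L"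
  shows "miss s E 0 1 \<le> 1 / 8"
proof -
  let ?a = "\<lambda>k. 1 / (1024 * (1 + real k)\<^sup>2)"
  have "(\<Sum>e<Suc E. ?a e) = (\<Sum>e<Suc E. 1 / (1 + real e)\<^sup>2) / 1024"
    by (simp add: sum_divide_distrib mult.commute del: sum.lessThan_Suc)
  also have "\<dots> \<le> 2 / 1024"
    using sum_inverse_squares[of "Suc E"] order_trans[of _ "2 - 1 / real (Suc E)" 2]
    by (intro divide_right_mono) auto
  finally have half: "(\<Sum>e<Suc E. ?a e) \<le> 2 / 1024" .
  have rev: "(\<Sum>e<Suc E. ?a (E - e)) = (\<Sum>e<Suc E. ?a e)"
    using sum.nat_diff_reindex[of ?a "Suc E"] by (simp del: sum.lessThan_Suc)
  have "(\<Sum>e\<in>{0..<min s (E + 3)}. exp (- 512 * real (conf E e))) \<le> (\<Sum>e<Suc E + 2. exp (- 512 * real (conf E e)))"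
    by (intro sum_mono2) auto
  also have "\<dots> = (\<Sum>e<Suc E. exp (- 512 * real (conf E e))) + 2 * exp (- 512)"
    by (simp add: conf_eq_1 numeral_2_eq_2)
  also have "\<dots> \<le> (\<Sum>e<Suc E. ?a e + ?a (E - e)) + 2 * exp (- 512)"
    by (intro add_right_mono sum_mono exp_conf_le)
  also have "\<dots> \<le> 4 / 1024 + 2 * exp (- 512)"
    using half rev by (simp only: sum.distrib)
  finally have "(\<Sum>e\<in>{0..<min s (E + 3)}. exp (- 512 * real (conf E e))) \<le> 4 / 1024 + 2 * exp (- 512)" .
  moreover have "exp (- 512) \<le> (1::real) / 1024" using exp_512_le[of 1] by simp
  moreover have "real s * exp (- 512 * real L) \<le> 1 / 1024"
  proof -
    have "real s * exp (- 512 * real L) \<le> real L * (1 / (1024 * real L ^ 4))"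
      using s L_ge by (intro mult_mono exp_512_le) auto
    also have "\<dots> \<le> 1 / 1024"
      using L_ge one_le_power[of "real L" 3] by (simp add: divide_simps power_numeral_reduce)
    finally show ?thesis .
  qed
  ultimately show ?thesis by (simp add: miss_def)
qed

text \<open>In the doubling phase, one of the two copies of \<open>exp (- 512 * y\<^sup>2)\<close>
  pays for the current block and the other dominates the whole rest of the series.\<close>

lemma miss_step:
  assumes v: "valid L K (Test s c M E i e y)"
  shows "exp (- 512 * real (conf E e * y\<^sup>2))
    + (if final s e y then 0 else miss s E (adv_e s E e y) (adv_y s E e y)) \<le> miss s E e y"
proof -
  have v': "E \<le> s" "e \<le> s" "0 < y" "y\<^sup>2 < 4 * L"
    "y = 1 \<and> e \<le> E + 3 \<or> e = min s (E + 3) \<or> L \<le> y\<^sup>2 \<and> E + 3 < e" using v by auto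
  show ?thesis
  proof (cases "e < s \<and> e < E + 3")
    case True
    then have y: "y = 1" using v' by auto
    have "{e..<min s (E + 3)} = insert e {Suc e..<min s (E + 3)}" using True by auto
    moreover have "real (s - Suc e) * exp (- 512 * real L) \<le> real (s - e) * exp (- 512 * real L)"
      by (intro mult_right_mono) auto
    ultimately show ?thesis using True y by (simp add: miss_def adv_e_def adv_y_def final_def)
  next
    case False
    then have F: "min s (E + 3) \<le> e" "E \<le> e" using v' by auto
    then have c1: "conf E e = 1" by (simp add: conf_eq_1)
    have emp: "{e..<min s (E + 3)} = {}" "{Suc e..<min s (E + 3)} = {}" using F by auto
    have q0: "0 \<le> real (s - e) * exp (- 512 * real L)" by simp
    have e0: "0 < exp (- 512 * real (y\<^sup>2))" by simp
    show ?thesis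
    proof (cases "y\<^sup>2 < L")
      case y: True
      have "2 * exp (- 512 * real ((2 * y)\<^sup>2)) \<le> exp (- 512 * real (y\<^sup>2))"
      proof -
        have "1 \<le> real (y\<^sup>2)" using v'(3) by (metis One_nat_def Suc_leI of_nat_1 of_nat_le_iff zero_less_power)
        then have "2 \<le> exp (1536 * real (y\<^sup>2))"
          using exp_ge_add_one_self[of "1536 * real (y\<^sup>2)"] by linarith
        then have "2 * exp (- 512 * real ((2 * y)\<^sup>2)) \<le> exp (1536 * real (y\<^sup>2)) * exp (- 512 * real ((2 * y)\<^sup>2))"
          by (intro mult_right_mono) auto
        also have "\<dots> = exp (- 512 * real (y\<^sup>2))" by (simp add: power_mult_distrib flip: exp_add)
        finally show ?thesis .
      qed
      then show ?thesis using y False c1 by (auto simp: miss_def adv_e_def adv_y_def final_def emp)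
    next
      case y: False
      show ?thesis
      proof (cases "e < s")
        case True
        have "exp (- 512 * real (y\<^sup>2)) \<le> exp (- 512 * real L)" using y by simp
        moreover have "real (s - e) = real (s - Suc e) + 1" using True by simp
        ultimately show ?thesis using y False c1 True
          by (simp add: miss_def adv_e_def adv_y_def final_def emp ring_distribs)
      next
        case e: False
        then show ?thesis using y False c1 q0 e0
          by (simp add: miss_def final_def emp)
      qed
    qed
  qed
qed

lemma miss_nonneg: "0 \<le> miss s E e y"
  by (auto simp: miss_def intro!: add_nonneg_nonneg sum_nonneg)

end

context epoch
begin

lemma gp_sq_le: "k \<in> SO \<Longrightarrow> gp k * gp k * 4 ^ ell k \<le> 4"
proof -
  assume k: "k \<in> SO"
  have "gp k * 2 ^ ell k \<le> 2" using ell_gt[OF k] by (simp add: field_simps)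
  then have "(gp k * 2 ^ ell k) * (gp k * 2 ^ ell k) \<le> 2 * 2"
    using SO_D(2)[OF k] by (intro mult_mono) auto
  then show ?thesis by (simp add: algebra_simps flip: power_mult_distrib)
qed

lemma gp_sq_ge: "k \<in> SO \<Longrightarrow> 1 \<le> gp k * gp k * 4 ^ ell k"
proof -
  assume k: "k \<in> SO"
  have "1 \<le> gp k * 2 ^ ell k" using ell_le[OF k] by (simp add: field_simps)
  then have "1 * 1 \<le> (gp k * 2 ^ ell k) * (gp k * 2 ^ ell k)"
    by (intro mult_mono) auto
  then show ?thesis by (simp add: algebra_simps flip: power_mult_distrib)
qed

text \<open>\<open>E - (ell k + 2)\<close> is at most \<open>e0 + 6 - ell k\<close>, as in
  \<open>kap\<close>, plus the excess of \<open>E\<close> over \<open>e0 + 8\<close>, as in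
  \<open>ovr\<close>; the square root is subadditive.\<close>

lemma conf_le_kap:
  assumes "k \<in> SO" "E \<le> s" shows "real (conf E (ell k + 2)) \<le> kap k + ovr s g E"
proof -
  let ?m = "min (ell k + 2) (E - (ell k + 2))" and ?a = "min (ell k + 2) (e0 + 6 - ell k)"
  have "(real (floor_sqrt ?m))\<^sup>2 \<le> real ?m"
    by (metis floor_sqrt_power2_le of_nat_le_iff of_nat_power)
  then have "real (floor_sqrt ?m) \<le> sqrt (real ?m)" by (intro real_le_rsqrt)
  also have "\<dots> \<le> sqrt (real ?a + real (E - (e0 + 8)))"
    using ell_le_e0[OF assms(1)] by (intro real_sqrt_le_mono) (auto simp: min_def simp flip: of_nat_add)
  also have "\<dots> \<le> sqrt (real ?a) + sqrt (real (E - (e0 + 8)))"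
    by (intro sqrt_add_le_add_sqrt) auto
  also have "sqrt (real (E - (e0 + 8))) \<le> ovr s g E"
    using assms(2) by (auto simp: ovr_def)
  finally show ?thesis by (simp add: conf_def kap_def)
qed

lemma Suc_i_qf: "i \<noteq> istar \<Longrightarrow> qf (Suc i) = qf i"
  by (auto simp: qf_def)

lemma qf_nonneg: "0 \<le> qf i" by (simp add: qf_def)

text \<open>The budget freed by \<open>Phi_own\<close> covers a whole test. For \<open>istar\<close>
  under a hot champion, \<open>q\<close> changes from 1/8 to the miss probability of a fresh
  test.\<close>

lemma psi_start:
  assumes c: "c < K" and i: "i < K" and E: "E \<le> s" and s: "s \<le> L"
  shows "psi (Test s c M E i 0 1) \<le> Phi s (gp c) E i (qf i)"
proof -
  let ?g = "gp c"
  let ?B = "Phi s ?g E (Suc i) (qf (Suc i))"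
  have mono: "?B \<le> Phi s ?g E i (qf i)" if "i \<noteq> istar \<or> \<not> 64 / 2 ^ s < ?g"
  proof -
    have "?B = Phi s ?g E (Suc i) (qf i)"
    proof (cases "i = istar")
      case True
      then show ?thesis using that c by (intro Phi_cold) auto
    qed (simp add: Suc_i_qf)
    also have "\<dots> \<le> Phi s ?g E i (qf i)" by (rule Phi_mono_i)
    finally show ?thesis .
  qed
  show ?thesis
  proof (cases "gp i = 0")
    case opt: True
    show ?thesis
    proof (cases "i = istar \<and> 64 / 2 ^ s < ?g")
      case True
      have "Phi s ?g E (Suc i) (miss s E 0 1) \<le> Phi s ?g E (Suc i) (1 / 8)"
        by (intro Phi_mono_q miss_start s)
      also have "\<dots> \<le> Phi s ?g E i (1 / 8)" by (rule Phi_mono_i)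
      finally show ?thesis using True opt by (simp add: qf_def)
    next
      case False
      then show ?thesis using opt mono by (cases "i = istar") auto
    qed
  next
    case False
    then have iS: "i \<in> SO" using i by (intro SO_I)
    then have g0: "0 < gp i" by (rule SO_D)
    have ni: "i \<noteq> istar" using False istar by auto
    have own: "?B + ((if hard i s ?g then 512 * real L * gp i * (9 * 4 ^ s) else 0)
        + 200000 / gp i * (kap i + ovr s ?g E)) \<le> Phi s ?g E i (qf i)"
      unfolding Suc_i_qf[OF ni] by (rule Phi_own[OF iS s])
    have k1: "1 \<le> kap i + ovr s ?g E" using kap_ge_1[of i] ovr_nonneg[of s ?g E] by simp
    have pos: "0 \<le> 200000 / gp i * (kap i + ovr s ?g E)" using g0 k1 by (intro mult_nonneg_nonneg) auto
    \<comment> \<open>\<open>gp i\<^sup>2 * 4 ^ (ell i + 2) \<le> 64\<close>, so the left side is at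
      most \<open>3 * 512 * 64 = 98304\<close> times \<open>conf E k / gp i\<close>.\<close>
    have sz: "gp i * (3 * real (test_size E k 1)) \<le> 200000 / gp i * (kap i + ovr s ?g E)"
      if "k \<le> ell i + 2" "real (conf E k) \<le> kap i + ovr s ?g E" for k
    proof -
      have "(4::real) ^ k \<le> 4 ^ (ell i + 2)" using that by (intro power_increasing) auto
      then have "gp i * gp i * 4 ^ k \<le> gp i * gp i * 4 ^ (ell i + 2)" using g0 by (intro mult_left_mono) auto
      also have "\<dots> \<le> 64" using gp_sq_le[OF iS] by (simp add: power_add)
      finally have "1536 * (gp i * gp i * 4 ^ k) * real (conf E k) \<le> 200000 * (kap i + ovr s ?g E)"
        using that k1 by (intro mult_mono) auto
      then show ?thesis using g0 by (simp add: test_size_def field_simps)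
    qed
    have n0: "0 \<le> gp i * real (test_size E 0 1)" using g0 by simp
    consider "hard i s ?g" | "\<not> hard i s ?g" "ell i \<le> E + 1" | "\<not> hard i s ?g" "E + 1 < ell i" by linarith
    then show ?thesis
    proof cases
      case 1
      then show ?thesis using own pos n0 False by (simp add: algebra_simps)
    next
      case 2
      then show ?thesis using own n0 False sz[of "ell i + 2"] conf_le_kap[OF iS E, of ?g]
        by (simp add: algebra_simps)
    next
      case 3
      then show ?thesis using own n0 False sz[of "E + 3"] k1
        by (simp add: algebra_simps conf_eq_1)
    qed
  qed
qed

end

section \<open>Induction step for reference blocks\<close>

locale epoch_step = epoch +
  fixes f :: nat
  assumes f: "0 < f"
    and IH: "\<And>f' b. f' < f \<Longrightarrow> good f' b \<Longrightarrow> V L f' b 0 0 \<le> max 0 (psi b) + real f' / 2 ^ L"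
begin

text \<open>Also covers the end of a round, where \<open>qf K = 1\<close> because
  \<open>istar < K\<close>. The bound \<open>s \<le> L\<close> comes from the fuel and is available
  only while pulls are left.\<close>

lemma V_next_arm:
  assumes f': "f' < f" and c: "c < K" and E: "E \<le> s" and i: "i \<le> K" and m: "mean_ok s c M"
    and fuel: "0 < f' \<Longrightarrow> f' + 4 ^ Suc s \<le> 2 ^ L + 1"
  shows "V L f' (next_arm K s c M E i) 0 0 \<le> Phi s (gp c) E i (qf i) + real f' / 2 ^ L"
proof (cases "f' = 0")
  case True
  then show ?thesis by (simp add: Phi_nonneg qf_nonneg)
next
  case False
  have "2 * Suc s \<le> L" using fuel_rounds[of f' "Suc s"] fuel False by simp
  then have s: "s \<le> L" by simp
  show ?thesis
  proof (cases "i < K")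
    case True
    then have "good f' (Test s c M E i 0 1)" using c E m fuel L_ge by simp
    from IH[OF f' this] psi_start[OF c True E s, of M] True Phi_nonneg[OF qf_nonneg[of i], of s "gp c" E i]
    show ?thesis by (simp add: next_arm_def max_def split: if_splits)
  next
    case i': False
    then have "i = K" using i by simp
    have "good f' (Ref (Suc s) c E 0)" using c E fuel by simp
    moreover have "psi (Ref (Suc s) c E 0) \<le> Phi s (gp c) E i (qf i)" "0 \<le> psi (Ref (Suc s) c E 0)"
      using Phi_round[OF c s, of E] istar(1) \<open>i = K\<close> gp_nonneg[OF c] by (simp_all add: qf_def Phi_nonneg)
    ultimately show ?thesis using IH[OF f', of "Ref (Suc s) c E 0"] i' by (simp add: next_arm_def max_absorb2)
  qed
qed

lemma step_Ref:
  assumes G: "good f (Ref s c E i)"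
  shows "V L f (Ref s c E i) 0 0 \<le> psi (Ref s c E i) + real f / 2 ^ L"
proof -
  let ?n = "ref_size L s"
  have c: "c < K" and i: "i \<le> K" and E: "E \<le> s" and v: "valid L K (Ref s c E i)" using G by auto
  have fuel: "f + 4 ^ (if i = 0 then s else Suc s) \<le> 2 ^ L + 1" using G f by auto
  have "f + 4 ^ s \<le> 2 ^ L + 1" using fuel power_increasing[of s "Suc s" "4::nat"] by (auto split: if_splits)
  then have s2: "2 * s \<le> L" using fuel_rounds[of f s] f by auto
  \<comment> \<open>Just enough to lift the fuel exponent by one:
    \<open>4 ^ s + 3 * 4 ^ s = 4 ^ Suc s\<close>.\<close>
  have n: "3 * 4 ^ s \<le> ?n" using L_ge by (simp add: ref_size_def)
  have n0: "0 < ?n" using L_ge by (simp add: ref_size_def)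
  have fuel': "f - ?n + 4 ^ Suc s \<le> 2 ^ L + 1" if "0 < f - ?n"
    using that fuel n by (cases "i = 0") auto
  have f_le: "f \<le> 2 ^ L"
    using \<open>f + 4 ^ s \<le> 2 ^ L + 1\<close> one_le_power[of "4::nat" s] by linarith
  let ?Y = "\<lambda>S. \<not> mean_ok s c S"
  let ?t = "1 / (8 * 2 ^ s) :: real"
  have d: "4 \<le> 2 ^ L * ?t"
  proof -
    have "(32::real) * 2 ^ s \<le> 2 ^ (5 + s)" by (simp add: power_add)
    also have "\<dots> \<le> 2 ^ L" using s2 L_ge by (intro power_increasing) auto
    finally show ?thesis by (simp add: field_simps)
  qed
  have nt: "real ?n * ?t\<^sup>2 = 8 * real L"
    by (simp add: ref_size_def power_mult_distrib power_divide power2_eq_square flip: power_mult_distrib)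
  have "PB c (2 ^ L) ?n ?Y \<le> PB c (2 ^ L) ?n (\<lambda>S. mu c + ?t \<le> ref_mean L s S \<or> ref_mean L s S \<le> mu c - ?t)"
    by (intro PB_mono c) (auto simp: mean_ok_def)
  also have "\<dots> \<le> PB c (2 ^ L) ?n (\<lambda>S. mu c + ?t \<le> ref_mean L s S) + PB c (2 ^ L) ?n (\<lambda>S. ref_mean L s S \<le> mu c - ?t)"
    by (intro PB_disj c)
  also have "\<dots> \<le> exp (- real ?n * ?t\<^sup>2) + exp (- real ?n * ?t\<^sup>2)"
    using PB_upper[OF c, of "2 ^ L" ?n ?t] PB_lower[OF c, of "2 ^ L" ?n ?t] n0 d
    by (intro add_mono) (simp_all add: ref_mean_def)
  also have "\<dots> \<le> 1 / 4 ^ L"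
  proof -
    have "exp (- real ?n * ?t\<^sup>2) \<le> 1 / 4 ^ L / 4"
      using exp_delta1[of "8 * real L"] nt by (simp only: mult_minus_left)
    then show ?thesis by (intro add_quarters) auto
  qed
  finally have Y: "PB c (2 ^ L) ?n ?Y \<le> 1 / 4 ^ L" .
  show ?thesis
  proof (rule V_step[OF v f, of ?n "Phi s (gp c) E i (qf i)" 0 "\<lambda>_. False" ?Y 0])
    fix S
    show "V L (f - ?n) (after L K (Ref s c E i) S) 0 0 \<le> Phi s (gp c) E i (qf i) + 0 * of_bool False
      + 2 ^ L * of_bool (\<not> mean_ok s c S) + real (f - ?n) / 2 ^ L"
    proof (cases "mean_ok s c S")
      case True
      then show ?thesis using V_next_arm[of "f - ?n" c E s i S] c E i fuel' f n0 by simp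
    next
      case False
      have "V L (f - ?n) (after L K (Ref s c E i) S) 0 0 \<le> real (f - ?n)"
        by (intro V_le valid_after v L_ge)
      also have "\<dots> \<le> real (2 ^ L)" using f_le by (intro of_nat_mono) simp
      also have "\<dots> \<le> Phi s (gp c) E i (qf i) + 2 ^ L + real (f - ?n) / 2 ^ L"
        by (simp add: Phi_nonneg qf_nonneg)
      finally show ?thesis using False by simp
    qed
  qed (use Y in \<open>simp_all add: PB_empty c ref_size_def\<close>)
qed

end

section \<open>Induction step for tests of optimal arms and hard tests\<close>

locale test_step = epoch_step +
  fixes s c M E i e y :: nat
  assumes G: "good f (Test s c M E i e y)"
begin

abbreviation "g \<equiv> gp c"
abbreviation "n \<equiv> test_size E e y"
abbreviation "m \<equiv> ref_mean L s M"
abbreviation "T \<equiv> Test s c M E i e y"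
abbreviation "B0 \<equiv> Phi s (gp c) E (Suc i) (qf (Suc i))"

lemma facts: "c < K" "i < K" "E \<le> s" "e \<le> s" "0 < y" "y\<^sup>2 < 4 * L" "valid L K T"
    "y = 1 \<and> e \<le> E + 3 \<or> e = min s (E + 3) \<or> L \<le> y\<^sup>2 \<and> E + 3 < e"
    "f + 4 ^ Suc s \<le> 2 ^ L + 1" "mean_ok s c M" "\<bar>m - mu c\<bar> \<le> 1 / (8 * 2 ^ s)"
    "gp i = 0 \<or> hard i s (gp c) \<or> y\<^sup>2 < L \<or> E + 1 < ell i \<and> e \<le> ell i + 2"
  using G f by (auto simp: mean_ok_def)

lemma rounds: "2 * Suc s \<le> L" "s \<le> L"
  using fuel_rounds[OF f facts(9)] by auto

lemma n_pos: "0 < n" using facts by (simp add: test_size_pos)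

lemma f'_less: "f - n < f" using f n_pos by simp

lemma fuel': "0 < f - n \<Longrightarrow> f - n + 4 ^ Suc s \<le> 2 ^ L + 1"
  using facts(9) by linarith

lemma next_val:
  assumes "E' \<le> s"
  shows "V L (f - n) (next_arm K s c M E' (Suc i)) 0 0 \<le> Phi s g E' (Suc i) (qf (Suc i)) + real (f - n) / 2 ^ L"
  using V_next_arm[OF f'_less facts(1) assms _ facts(10) fuel', of "Suc i"] facts(2) by simp

lemma accept_val:
  "V L (f - n) (Ref s i E (Suc i)) 0 0 \<le> Phi s (gp i) E (Suc i) (qf (Suc i)) + 512 * real L * 4 ^ s * gp i
     + real (f - n) / 2 ^ L"
proof -
  have "good (f - n) (Ref s i E (Suc i))" using facts fuel' by simp
  moreover have "0 \<le> psi (Ref s i E (Suc i))"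
    using gp_nonneg[OF facts(2)] by (simp add: Phi_nonneg qf_nonneg)
  ultimately show ?thesis using IH[OF f'_less, of "Ref s i E (Suc i)"] by (simp add: max_absorb2)
qed

lemma adv_val:
  assumes "\<not> final s e y"
    and "gp i = 0 \<or> hard i s g \<or> (adv_y s E e y)\<^sup>2 < L \<or> E + 1 < ell i \<and> adv_e s E e y \<le> ell i + 2"
    and "psi (Test s c M E i (adv_e s E e y) (adv_y s E e y)) \<le> x" "0 \<le> x"
  shows "V L (f - n) (Test s c M E i (adv_e s E e y) (adv_y s E e y)) 0 0 \<le> x + real (f - n) / 2 ^ L"
proof -
  have "valid L K (Test s c M E i (adv_e s E e y) (adv_y s E e y))"
    using facts assms(1) by (auto simp: adv_e_def adv_y_def final_def power_mult_distrib min_def split: if_splits)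
  then have "good (f - n) (Test s c M E i (adv_e s E e y) (adv_y s E e y))"
    using facts fuel' assms(2) by simp
  from IH[OF f'_less this] have "V L (f - n) (Test s c M E i (adv_e s E e y) (adv_y s E e y)) 0 0
    \<le> max 0 (psi (Test s c M E i (adv_e s E e y) (adv_y s E e y))) + real (f - n) / 2 ^ L" .
  also have "\<dots> \<le> x + real (f - n) / 2 ^ L" using assms(3,4) by (intro add_right_mono max.boundedI)
  finally show ?thesis .
qed

lemma step_T:
  assumes "\<And>S. Y S \<or> V L (f - n) (after L K T S) 0 0 \<le> x + w * of_bool (X S) + real (f - n) / 2 ^ L"
    and x: "0 \<le> x" and w: "0 \<le> w" and X: "PB i (2 ^ L) n X \<le> px" and Y: "PB i (2 ^ L) n Y \<le> 1 / 4 ^ L"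
    and v: "real n * gp i + x + w * px \<le> psi T"
  shows "V L f T 0 0 \<le> psi T + real f / 2 ^ L"
proof (rule V_step[OF facts(7) f, of n x w X Y px])
  fix S
  show "V L (f - n) (after L K T S) 0 0 \<le> x + w * of_bool (X S) + 2 ^ L * of_bool (Y S) + real (f - n) / 2 ^ L"
  proof (cases "Y S")
    case True
    have "V L (f - n) (after L K T S) 0 0 \<le> real (f - n)"
      by (intro V_le valid_after facts L_ge)
    also have "\<dots> \<le> real (2 ^ L)" using facts(9) one_le_power[of "4::nat" "Suc s"] by (intro of_nat_mono) linarith
    also have "\<dots> \<le> x + w * of_bool (X S) + 2 ^ L + real (f - n) / 2 ^ L"
      using x w by simp
    finally show ?thesis using True by simp
  next
    case False
    then show ?thesis using assms(1)[of S] by simp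
  qed
qed (use assms in simp_all)

lemma thr_bounds: "1 / 2 ^ e \<le> threshold e y" "threshold e y \<le> 2 / 2 ^ e"
proof -
  have "1 / real y \<le> 1" "0 \<le> 1 / real y" using facts(5) by auto
  then show "1 / 2 ^ e \<le> threshold e y" "threshold e y \<le> 2 / 2 ^ e"
    unfolding threshold_def by (auto intro!: divide_right_mono)
qed

lemma eps_le: "1 / 2 ^ s \<le> (1::real) / 2 ^ e"
  using pow2_div_le[OF facts(4)] .

lemma res1: "1 / (64 * 2 ^ s) \<le> t \<Longrightarrow> 4 \<le> 2 ^ L * t" for t :: real
  using resolution[OF rounds(1), of 1 t] L_ge by simp

lemma size_sq: "real n * (t / 2 ^ e)\<^sup>2 = 512 * real (conf E e * y\<^sup>2) * t\<^sup>2"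
  by (simp add: test_size_def power_divide power2_eq_square flip: power_mult_distrib)

text \<open>With an optimal champion, a rejection needs a deviation of \<open>1 - 1/8\<close> units:
  threshold at least one unit, reference error at most 1/8. This keeps optimal arms from raising
  \<open>E\<close> once \<open>g = 0\<close>.\<close>

lemma Y_rej:
  assumes i: "gp i = 0" and g: "g = 0" and y: "L \<le> y\<^sup>2"
  shows "PB i (2 ^ L) n (\<lambda>S. rejects L s M E e y S) \<le> 1 / 4 ^ L"
proof -
  let ?t = "(7 / 8) / 2 ^ e :: real"
  have "PB i (2 ^ L) n (\<lambda>S. rejects L s M E e y S) \<le> exp (- (4 * real L))"
  proof (rule test_lower)
    have "1 / (64 * 2 ^ s) \<le> (7 / 8) * (1 / 2 ^ s :: real)" by (simp add: field_simps)
    also have "\<dots> \<le> (7 / 8) * (1 / 2 ^ e)" by (intro mult_left_mono eps_le) auto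
    finally show "4 \<le> 2 ^ L * ?t" by (intro res1) simp
    have "real L \<le> real (conf E e * y\<^sup>2)"
      using y mult_le_mono1[of 1 "conf E e" "y\<^sup>2"] conf_pos[of E e]
      by (intro of_nat_mono) linarith
    moreover have "real n * ?t\<^sup>2 = 392 * real (conf E e * y\<^sup>2)"
      unfolding size_sq by (simp add: power2_eq_square)
    ultimately show "4 * real L \<le> real n * ?t\<^sup>2" by linarith
    fix S assume "rejects L s M E e y S"
    then have "test_mean L E e y S < m - 1 / 2 ^ e" using thr_bounds by (simp add: rejects_def)
    moreover have "m \<le> mu i + 1 / (8 * 2 ^ s)" using facts(11) i g by (simp add: gp_def abs_le_iff)
    moreover have "1 / (8 * 2 ^ s) \<le> (1 / 8) * (1 / 2 ^ e :: real)" using eps_le by simp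
    moreover have "?t = (7 / 8) * (1 / 2 ^ e)" by simp
    ultimately show "test_mean L E e y S \<le> mu i - ?t" by linarith
  qed (use facts in auto)
  also have "\<dots> \<le> 1 / 4 ^ L" by (rule exp_delta2) simp
  finally show ?thesis .
qed

text \<open>Pulls of an optimal arm are free and accepting it only lowers the gap of the champion.
  The only harm is a rejection at full confidence under an optimal champion, which could push
  \<open>E\<close> and thus \<open>ovr\<close> up.\<close>

lemma step_optimal:
  assumes i: "gp i = 0" and cold: "\<not> (i = istar \<and> 64 / 2 ^ s < g)"
  shows "V L f T 0 0 \<le> psi T + real f / 2 ^ L"
proof (rule step_T)
  let ?Y = "\<lambda>S. rejects L s M E e y S \<and> g = 0 \<and> L \<le> y\<^sup>2"
  show "?Y S \<or> V L (f - n) (after L K T S) 0 0 \<le> B0 + 0 * of_bool False + real (f - n) / 2 ^ L" for S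
  proof (cases "rejects L s M E e y S")
    case True
    let ?E = "if L \<le> y\<^sup>2 \<and> E < e then e else E"
    show ?thesis
    proof (cases "?Y S")
      case False
      then have "Phi s g ?E (Suc i) (qf (Suc i)) \<le> B0"
        using True gp_nonneg[OF facts(1)] by (intro Phi_mono_E) auto
      moreover have "?E \<le> s" using facts by auto
      ultimately show ?thesis using next_val[of ?E] True by (simp add: after_Test)
    qed blast
  next
    case rej: False
    have acc: "Phi s (gp i) E (Suc i) (qf (Suc i)) \<le> B0"
      using i gp_nonneg[OF facts(1)] facts(3) qf_nonneg by (intro Phi_mono_g) auto
    have adv: "psi (Test s c M E i (adv_e s E e y) (adv_y s E e y)) = B0" using i cold by auto
    show ?thesis
    proof (cases "final s e y")
      case True
      then show ?thesis using rej acc accept_val next_val[OF facts(3)] i by (simp add: after_Test)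
    next
      case False
      moreover have "0 \<le> B0" by (simp add: Phi_nonneg qf_nonneg)
      ultimately show ?thesis using rej adv_val[OF False _ eq_refl[OF adv]] i unfolding after_Test by simp
    qed
  qed
  show "PB i (2 ^ L) n ?Y \<le> 1 / 4 ^ L"
  proof (cases "g = 0 \<and> L \<le> y\<^sup>2")
    case True
    then show ?thesis using Y_rej[OF i] by simp
  next
    case False
    then have "?Y = (\<lambda>_. False)" by auto
    then show ?thesis using PB_empty facts by simp
  qed
  show "real n * gp i + B0 + 0 * 0 \<le> psi T" using i cold by (cases "i = istar") auto
qed (use facts in \<open>simp_all add: PB_empty Phi_nonneg qf_nonneg\<close>)

text \<open>Failing here moves the potential from \<open>q = 0\<close> to \<open>q = 1\<close>, so
  the cost is the slope \<open>?w\<close>. The failure probability \<open>?q\<close> of this block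
  is split off from \<open>miss\<close>; the rest \<open>?r\<close> remains for the later
  blocks.\<close>

lemma step_hot:
  assumes i: "i = istar" and hot: "64 / 2 ^ s < g"
  shows "V L f T 0 0 \<le> psi T + real f / 2 ^ L"
proof -
  let ?X = "\<lambda>S. rejects L s M E e y S \<or> final s e y \<and> \<not> accepts L s M E e y S"
  let ?q = "exp (- (512 * real (conf E e * y\<^sup>2)))"
  let ?r = "miss s E e y - ?q"
  let ?w = "Phi s g E (Suc i) 1 - Phi s g E (Suc i) 0"
  have i0: "gp i = 0" using i istar by simp
  have g0: "0 < g" using hot by (meson divide_nonneg_nonneg less_le_trans not_le zero_le_numeral zero_le_power)
  have step: "?q + (if final s e y then 0 else miss s E (adv_e s E e y) (adv_y s E e y)) \<le> miss s E e y"
    using miss_step[OF facts(7)] by simp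
  then have r0: "0 \<le> ?r" using miss_nonneg[of s E "adv_e s E e y" "adv_y s E e y"] by (auto split: if_splits)
  have qS: "qf (Suc i) = 1" using i by (simp add: qf_def)
  have w0: "0 \<le> ?w" using Phi_mono_q[of 0 1] by simp
  have rw: "Phi s g E (Suc i) ?r = Phi s g E (Suc i) 0 + ?r * ?w" by (rule Phi_affine)
  have "0 \<le> ?r * ?w" using r0 w0 by (rule mult_nonneg_nonneg)
  then have one: "Phi s g E (Suc i) 1 \<le> Phi s g E (Suc i) ?r + ?w"
    using rw by linarith
  have W: "False \<or> V L (f - n) (after L K T S) 0 0 \<le> Phi s g E (Suc i) ?r + ?w * of_bool (?X S) + real (f - n) / 2 ^ L" for S
  proof (cases "rejects L s M E e y S")
    case True
    let ?E = "if L \<le> y\<^sup>2 \<and> E < e then e else E"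
    have "Phi s g ?E (Suc i) 1 \<le> Phi s g E (Suc i) 1"
      using g0 by (intro Phi_mono_E) auto
    moreover have "?E \<le> s" using facts by auto
    ultimately show ?thesis using next_val[of ?E] True one qS by (auto simp: after_Test)
  next
    case rej: False
    show ?thesis
    proof (cases "final s e y")
      case True
      have "Phi s (gp i) E (Suc i) 1 \<le> Phi s g E (Suc i) 0"
        using Phi_found[of g E s "Suc i" 1] g0 facts i0 by simp
      also have "\<dots> \<le> Phi s g E (Suc i) ?r" using r0 by (intro Phi_mono_q)
      finally have "Phi s (gp i) E (Suc i) 1 \<le> Phi s g E (Suc i) ?r" .
      then show ?thesis using rej True accept_val next_val[OF facts(3)] one qS i0 by (simp add: after_Test)
    next
      case False
      have "psi (Test s c M E i (adv_e s E e y) (adv_y s E e y)) = Phi s g E (Suc i) (miss s E (adv_e s E e y) (adv_y s E e y))"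
        using i0 i hot by simp
      also have "\<dots> \<le> Phi s g E (Suc i) ?r" using step False by (intro Phi_mono_q) auto
      finally show ?thesis using rej False adv_val[OF False _ _ Phi_nonneg[OF r0]] i0 unfolding after_Test by simp
    qed
  qed
  have X: "PB i (2 ^ L) n ?X \<le> ?q"
  proof (rule test_lower)
    have "1 / (64 * 2 ^ s) \<le> (1 / 2 ^ s :: real)" by (simp add: field_simps)
    then show "4 \<le> 2 ^ L * (1 / 2 ^ e :: real)" using eps_le by (intro res1) linarith
    show "512 * real (conf E e * y\<^sup>2) \<le> real n * (1 / 2 ^ e)\<^sup>2" unfolding size_sq by simp
    fix S assume X: "?X S"
    \<comment> \<open>The champion is so far below \<open>istar\<close> that even a failed
      acceptance at \<open>e = s\<close> requires a deviation of more than one unit.\<close>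
    have "m \<le> mu i - 64 / 2 ^ s + 1 / (8 * 2 ^ s)" using facts(11) hot i0 by (simp add: gp_def abs_le_iff)
    also have "\<dots> = mu i - (511 / 8) * (1 / 2 ^ s)" by (simp add: field_simps)
    finally have m: "m \<le> mu i - (511 / 8) * (1 / 2 ^ s)" .
    have p: "0 < (1::real) / 2 ^ s" by simp
    show "test_mean L E e y S \<le> mu i - 1 / 2 ^ e"
    proof (cases "rejects L s M E e y S")
      case True
      then have "test_mean L E e y S < m - 1 / 2 ^ e" using thr_bounds by (simp add: rejects_def)
      then show ?thesis using m p by linarith
    next
      case False
      then have "e = s" "test_mean L E e y S \<le> m + 1 / 2 ^ s"
        using X facts by (auto simp: final_def accepts_def)
      then show ?thesis using m p by (simp only:)
    qed
  qed (use facts in auto)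
  have v: "real n * gp i + Phi s g E (Suc i) ?r + ?w * ?q \<le> psi T"
  proof -
    have "Phi s g E (Suc i) (miss s E e y) = Phi s g E (Suc i) 0 + miss s E e y * ?w" by (rule Phi_affine)
    then show ?thesis using i0 i hot rw by (simp add: algebra_simps)
  qed
  show ?thesis
    by (rule step_T[OF W Phi_nonneg[OF r0] w0 X _ v]) (simp add: PB_empty facts)
qed

end

context test_step
begin

lemma gp_pos: "gp i \<noteq> 0 \<Longrightarrow> 0 < gp i" "gp i \<noteq> 0 \<Longrightarrow> i \<in> SO"
  using gp_nonneg[OF facts(2)] SO_I[OF facts(2)] by auto

text \<open>With \<open>Q\<close> the size of a reference block, the blocks of a test are at most
  \<open>4 * Q\<close> and at least double, so they sum up to at most \<open>8 * Q\<close>; the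
  ninth \<open>Q\<close> pays for the new reference block if the arm is accepted.\<close>

lemma step_hard:
  assumes i: "gp i \<noteq> 0" and h: "hard i s g"
  shows "V L f T 0 0 \<le> psi T + real f / 2 ^ L"
proof -
  note gi = gp_pos[OF i]
  define Q where "Q = 512 * real L * 4 ^ s"
  let ?a = "B0 + gp i * (9 * Q - 2 * real n)"
  \<comment> \<open>Accepting an arm that is no better than the champion is left to the rare event;
    accepting a better one lowers the potential.\<close>
  let ?Y = "\<lambda>S. final s e y \<and> accepts L s M E e y S \<and> g \<le> gp i"
  have nQ: "real n \<le> 4 * Q"
  proof -
    have "real n \<le> real (4 * (512 * L * 4 ^ s))"
      using test_size_le[OF facts(7) rounds(2)] by (rule of_nat_mono)
    then show ?thesis by (simp add: Q_def)
  qed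
  have Q0: "0 \<le> Q" by (simp add: Q_def)
  have "0 \<le> gp i * (9 * Q - 2 * real n - Q)" using gi nQ Q0 by (intro mult_nonneg_nonneg) auto
  then have aQ: "B0 + Q * gp i \<le> ?a" by (simp add: algebra_simps)
  moreover have "0 \<le> Q * gp i" using Q0 gi by simp
  ultimately have a: "B0 \<le> ?a" by linarith
  have B0: "0 \<le> B0" by (simp add: Phi_nonneg qf_nonneg)
  have W: "?Y S \<or> V L (f - n) (after L K T S) 0 0 \<le> ?a + 0 * of_bool False + real (f - n) / 2 ^ L" for S
  proof (cases "rejects L s M E e y S")
    case True
    let ?E = "if L \<le> y\<^sup>2 \<and> E < e then e else E"
    \<comment> \<open>Under an optimal champion an arm is hard only in early rounds, so its
      rejection cannot raise \<open>E\<close> beyond \<open>e0 + 8\<close>.\<close>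
    have "s < ell i + 8" if "g = 0" using h that gi by (auto simp: hard_def)
    then have "g = 0 \<Longrightarrow> ?E \<le> e0 + 8 \<or> ?E = E" using facts(4) ell_le_e0[OF gi(2)] by auto
    then have "0 < g \<or> ?E \<le> e0 + 8 \<or> ?E = E" using gp_nonneg[OF facts(1)] by linarith
    then have "Phi s g ?E (Suc i) (qf (Suc i)) \<le> B0"
      using gp_nonneg[OF facts(1)] by (intro Phi_mono_E) auto
    moreover have "?E \<le> s" using facts by auto
    ultimately show ?thesis using next_val[of ?E] True a by (simp add: after_Test)
  next
    case rej: False
    show ?thesis
    proof (cases "final s e y")
      case fin: True
      show ?thesis
      proof (cases "accepts L s M E e y S")
        case acc: True
        show ?thesis
        proof (cases "g \<le> gp i")
          case False
          then have "Phi s (gp i) E (Suc i) (qf (Suc i)) \<le> B0"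
            using gi facts(3) qf_nonneg by (intro Phi_mono_g) auto
          then show ?thesis using accept_val aQ rej fin acc by (simp add: after_Test Q_def algebra_simps)
        qed (use fin acc in blast)
      next
        case False
        then show ?thesis using next_val[OF facts(3)] a rej fin by (simp add: after_Test)
      qed
    next
      case False
      have "gp i * (9 * Q - real (test_size E (adv_e s E e y) (adv_y s E e y))) \<le> gp i * (9 * Q - 2 * real n)"
        using adv_size(1)[of E e y s] gi by (intro mult_left_mono) auto
      then have "psi (Test s c M E i (adv_e s E e y) (adv_y s E e y)) \<le> ?a"
        using i h by (simp add: Q_def)
      then show ?thesis using adv_val[OF False _ _ order_trans[OF B0 a]] h rej False unfolding after_Test by simp
    qed
  qed
  have Y: "PB i (2 ^ L) n ?Y \<le> 1 / 4 ^ L"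
  proof (cases "final s e y \<and> g \<le> gp i")
    case True
    then have es: "e = s" and yL: "L \<le> y\<^sup>2" and gle: "g \<le> gp i" using facts by (auto simp: final_def)
    let ?t = "(7 / 8) / 2 ^ e :: real"
    have "PB i (2 ^ L) n ?Y \<le> exp (- (4 * real L))"
    proof (rule test_upper)
      have "1 / (64 * 2 ^ s) \<le> ?t" unfolding es by (simp add: field_simps)
      then show "4 \<le> 2 ^ L * ?t" by (rule res1)
      have "real L \<le> real (conf E e * y\<^sup>2)"
        using yL mult_le_mono1[of 1 "conf E e" "y\<^sup>2"] conf_pos[of E e]
        by (intro of_nat_mono) linarith
      moreover have "real n * ?t\<^sup>2 = 392 * real (conf E e * y\<^sup>2)"
        unfolding size_sq by (simp add: power2_eq_square)
      ultimately show "4 * real L \<le> real n * ?t\<^sup>2" by linarith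
      fix S assume "?Y S"
      then have "m + 1 / 2 ^ e < test_mean L E e y S" using es by (simp add: accepts_def)
      moreover have "mu i - 1 / (8 * 2 ^ e) \<le> m" using facts(11) gle es by (simp add: gp_def abs_le_iff)
      ultimately show "mu i + ?t \<le> test_mean L E e y S" by (simp add: field_simps)
    qed (use facts in auto)
    also have "\<dots> \<le> 1 / 4 ^ L" by (rule exp_delta2) simp
    finally show ?thesis .
  next
    case False
    then have "?Y = (\<lambda>_. False)" by auto
    then show ?thesis using PB_empty facts by simp
  qed
  show ?thesis
  proof (rule step_T[OF W _ order_refl _ Y])
    show "0 \<le> ?a" using a B0 by linarith
    show "real n * gp i + ?a + 0 * 0 \<le> psi T" using i h by (simp add: Q_def algebra_simps)
    show "PB i (2 ^ L) n (\<lambda>S. False) \<le> 0" using PB_empty facts by simp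
  qed
qed

section \<open>Tests of arms that can be rejected early\<close>

context
  assumes i: "gp i \<noteq> 0" and nh: "\<not> hard i s g"
begin

lemma easy: "ell i + 8 \<le> s" "4 * g \<le> gp i" "0 < gp i" "i \<in> SO" "0 \<le> g" "1 / 2 ^ ell i \<le> gp i"
  using nh gp_pos[OF i] gp_nonneg[OF facts(1)] ell_le by (auto simp: hard_def)

text \<open>The champion loses at most 1/4 of the gap, and for \<open>s \<ge> ell i + 8\<close> the
  reference error is at most \<open>gp i / 2048\<close>.\<close>

lemma gam_bounds: "74 / 100 * gp i \<le> m - mu i" "m - mu i \<le> 101 / 100 * gp i"
proof -
  have "1 / (8 * 2 ^ s) \<le> (1 / 8) * (1 / 2 ^ (ell i + 8) :: real)"
    using pow2_div_le[OF easy(1)] by simp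
  also have "\<dots> = (1 / 2048) * (1 / 2 ^ ell i)" by (simp add: power_add)
  also have "\<dots> \<le> (1 / 2048) * gp i" using easy by (intro mult_left_mono) auto
  finally have "\<bar>m - mu c\<bar> \<le> (1 / 2048) * gp i" using facts(11) by linarith
  moreover have "mu c - mu i = gp i - g" by (simp add: gp_def)
  ultimately show "74 / 100 * gp i \<le> m - mu i" "m - mu i \<le> 101 / 100 * gp i"
    using easy unfolding abs_le_iff by linarith+
qed

lemma size_gp: "ell i + 2 \<le> e \<Longrightarrow> 8192 * real (y\<^sup>2) \<le> real n * (gp i)\<^sup>2"
proof -
  assume e: "ell i + 2 \<le> e"
  have "(4::real) ^ (ell i + 2) \<le> 4 ^ e" using e by (intro power_increasing) auto
  then have "gp i * gp i * 4 ^ (ell i + 2) \<le> gp i * gp i * 4 ^ e" using easy by (intro mult_left_mono) auto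
  moreover have "16 \<le> gp i * gp i * 4 ^ (ell i + 2)" using gp_sq_ge[OF easy(4)] by (simp add: power_add)
  ultimately have "16 \<le> gp i * gp i * 4 ^ e" by linarith
  moreover have "real (y\<^sup>2) \<le> real (conf E e * y\<^sup>2)"
    using mult_le_mono1[of 1 "conf E e" "y\<^sup>2"] conf_pos[of E e] by (intro of_nat_mono) linarith
  ultimately have "16 * real (y\<^sup>2) \<le> (gp i * gp i * 4 ^ e) * real (conf E e * y\<^sup>2)"
    by (intro mult_mono) auto
  then show ?thesis by (simp add: test_size_def power2_eq_square algebra_simps)
qed

text \<open>At level \<open>ell i + 2\<close> the threshold is at most half of the gap, so passing
  needs a deviation of \<open>0.74 - 0.5 = 0.24\<close> gaps; the exponent is
  \<open>8192 * 0.24\<^sup>2 > 400\<close>, times \<open>y\<^sup>2\<close>.\<close>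

lemma pass_prob:
  assumes e: "ell i + 2 \<le> e"
  shows "PB i (2 ^ L) n (\<lambda>S. \<not> rejects L s M E e y S) \<le> exp (- (400 * real (y\<^sup>2)))"
proof (rule test_upper)
  let ?t = "24 / 100 * gp i"
  have "1 / (64 * 2 ^ s) \<le> (24 / 100) * (1 / 2 ^ s :: real)" by (simp add: field_simps)
  also have "\<dots> \<le> (24 / 100) * (1 / 2 ^ ell i)" using easy(1) by (intro mult_left_mono pow2_div_le) auto
  also have "\<dots> \<le> ?t" using easy by simp
  finally show "4 \<le> 2 ^ L * ?t" by (rule res1)
  have "real n * ?t\<^sup>2 = (576 / 10000) * (real n * (gp i)\<^sup>2)" by (simp add: power2_eq_square)
  then show "400 * real (y\<^sup>2) \<le> real n * ?t\<^sup>2" using size_gp[OF e] by linarith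
  fix S assume "\<not> rejects L s M E e y S"
  moreover have "threshold e y \<le> 2 * (1 / 2 ^ (ell i + 2))"
    using thr_bounds(2) pow2_div_le[OF e] by simp
  moreover have "2 * (1 / 2 ^ (ell i + 2)) = (1 / 2) * (1 / 2 ^ ell i :: real)" by (simp add: power_add)
  ultimately show "mu i + ?t \<le> test_mean L E e y S"
    using gam_bounds(1) easy(6) by (simp only: rejects_def)
qed (use facts easy in auto)

lemma y2_ge_1: "1 \<le> real (y\<^sup>2)"
  using facts(5) by (metis One_nat_def Suc_leI of_nat_1 of_nat_le_iff zero_less_power)

lemma rej_same:
  assumes "rejects L s M E e y S" "L \<le> y\<^sup>2 \<and> E < e \<longrightarrow> e \<le> e0 + 8"
  shows "V L (f - n) (after L K T S) 0 0 \<le> B0 + real (f - n) / 2 ^ L"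
proof -
  let ?E = "if L \<le> y\<^sup>2 \<and> E < e then e else E"
  have "Phi s g ?E (Suc i) (qf (Suc i)) \<le> B0"
    using assms gp_nonneg[OF facts(1)] by (intro Phi_mono_E) auto
  moreover have "?E \<le> s" using facts by auto
  ultimately show ?thesis using next_val[of ?E] assms by (simp add: after_Test)
qed

text \<open>From level \<open>ell i + 2\<close> on, a block passes with probability at most 1/16 and
  its successor is at most 8 times as large, so \<open>2 * n\<close> is an upper solution:
  \<open>n + 2 * 8 * n / 16 = 2 * n\<close>. Below that level, sizes at least double and the last
  one dominates. Reaching full confidence is a rare event.\<close>

lemma step_old:
  assumes old: "ell i \<le> E + 1"
  shows "V L f T 0 0 \<le> psi T + real f / 2 ^ L"
proof -
  have yL: "y\<^sup>2 < L" using facts(12) i nh old by auto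
  then have nf: "\<not> final s e y" by (simp add: final_def)
  have B0: "0 \<le> B0" by (simp add: Phi_nonneg qf_nonneg)
  let ?e = "adv_e s E e y" and ?y = "adv_y s E e y"
  show ?thesis
  proof (cases "ell i + 2 \<le> e")
    case e: True
    let ?X = "\<lambda>S. \<not> rejects L s M E e y S"
    let ?Y = "\<lambda>S. \<not> rejects L s M E e y S \<and> L \<le> ?y\<^sup>2"
    let ?w = "gp i * (16 * real n)"
    have W: "?Y S \<or> V L (f - n) (after L K T S) 0 0 \<le> B0 + ?w * of_bool (?X S) + real (f - n) / 2 ^ L" for S
    proof (cases "rejects L s M E e y S")
      case True
      then show ?thesis using rej_same[OF True] yL by simp
    next
      case rej: False
      show ?thesis
      proof (cases "L \<le> ?y\<^sup>2")
        case False
        have "ell i + 2 \<le> ?e" using e by (simp add: adv_e_def)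
        then have "psi (Test s c M E i ?e ?y) = B0 + gp i * (2 * real (test_size E ?e ?y))"
          using i nh old by simp
        also have "\<dots> \<le> B0 + ?w"
          using adv_size(2)[of E s e y] easy by (intro add_left_mono mult_left_mono) auto
        finally have psi': "psi (Test s c M E i ?e ?y) \<le> B0 + ?w" .
        have "0 \<le> B0 + ?w" using B0 easy(3) by simp
        then show ?thesis using adv_val[OF nf _ psi'] False rej nf unfolding after_Test by simp
      qed (use rej in blast)
    qed
    have X: "PB i (2 ^ L) n ?X \<le> 1 / 16"
    proof -
      have "exp (- (400 * real (y\<^sup>2))) \<le> exp (- 400)" using y2_ge_1 by simp
      also have "\<dots> \<le> (1::real) / 16" using exp_ge_add_one_self[of "400::real"] by (simp add: exp_minus field_simps)
      finally show ?thesis using pass_prob[OF e] by linarith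
    qed
    have Y: "PB i (2 ^ L) n ?Y \<le> 1 / 4 ^ L"
    proof (cases "L \<le> ?y\<^sup>2")
      case True
      then have "L \<le> 4 * y\<^sup>2" using yL by (auto simp: adv_y_def power_mult_distrib split: if_splits)
      then have "real L \<le> 4 * real (y\<^sup>2)" by (metis of_nat_le_iff of_nat_mult of_nat_numeral)
      then have "exp (- (400 * real (y\<^sup>2))) \<le> 1 / 4 ^ L" by (intro exp_delta2) linarith
      then show ?thesis using pass_prob[OF e] True by simp
    next
      case False
      then have "?Y = (\<lambda>_. False)" by auto
      then show ?thesis using PB_empty facts by simp
    qed
    show ?thesis
    proof (rule step_T[OF W B0 _ X Y])
      show "real n * gp i + B0 + ?w * (1 / 16) \<le> psi T" using i nh old e by simp
    qed (use easy in simp)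
  next
    case e: False
    then have e': "e < s" "e < E + 3" using easy(1) old by auto
    then have y1: "y = 1" using facts(8) by auto
    have adv: "?e = Suc e" "?y = 1" using e' y1 by (auto simp: adv_e_def adv_y_def)
    let ?N = "real (test_size E (ell i + 2) 1)"
    let ?a = "B0 + gp i * (3 * ?N - 2 * real n)"
    have nn: "2 * real n \<le> real (test_size E (Suc e) 1)"
      using test_size_Suc_ge[of E e 1] y1 by simp
    have "test_size E (Suc e) 1 \<le> test_size E (ell i + 2) 1" using e by (intro test_size_mono) auto
    then have nN: "real (test_size E (Suc e) 1) \<le> ?N" by simp
    have "0 \<le> gp i * (3 * ?N - 2 * real n)" using nn nN easy by (intro mult_nonneg_nonneg) linarith+
    then have a: "B0 \<le> ?a" by simp
    have psi': "psi (Test s c M E i ?e ?y) \<le> ?a"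
    proof (cases "ell i + 2 \<le> Suc e")
      case True
      then have "Suc e = ell i + 2" using e by simp
      then have "psi (Test s c M E i ?e ?y) = B0 + gp i * (2 * ?N)" unfolding adv using i nh old by simp
      also have "\<dots> \<le> ?a" using nn nN easy by (intro add_left_mono mult_left_mono) linarith+
      finally show ?thesis .
    next
      case False
      then have "psi (Test s c M E i ?e ?y) = B0 + gp i * (3 * ?N - real (test_size E (Suc e) 1))"
        unfolding adv using i nh old by simp
      also have "\<dots> \<le> ?a" using nn easy by (intro add_left_mono mult_left_mono) auto
      finally show ?thesis .
    qed
    have W: "False \<or> V L (f - n) (after L K T S) 0 0 \<le> ?a + 0 * of_bool False + real (f - n) / 2 ^ L" for S
    proof (cases "rejects L s M E e y S")
      case True
      then show ?thesis using rej_same[OF True] yL a by simp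
    next
      case False
      then show ?thesis using adv_val[OF nf _ psi' order_trans[OF B0 a]] nf L_ge adv unfolding after_Test by simp
    qed
    show ?thesis
    proof (rule step_T[OF W _ order_refl])
      show "0 \<le> ?a" using a B0 by linarith
      show "real n * gp i + ?a + 0 * 0 \<le> psi T" using i nh old e y1 by (simp add: algebra_simps)
    qed (simp_all add: PB_empty facts)
  qed
qed

end

end

context test_step
begin

section \<open>Early rejectable arms for which \<open>E\<close> is still too low\<close>

context
  assumes i: "gp i \<noteq> 0" and nh: "\<not> hard i s g" and new: "E + 1 < ell i"
begin

lemmas easy' = easy[OF i nh]

abbreviation "C \<equiv> 1000000 * real L / gp i"
abbreviation "R \<equiv> 512 * 4 ^ (ell i + 2) * (4 * real L)"
abbreviation "z \<equiv> margin s M E i y"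

lemma phase: "E + 3 < s" "e \<le> E + 3 \<or> L \<le> y\<^sup>2" "e < E + 3 \<longrightarrow> y = 1" "E \<le> e \<longrightarrow> conf E e = 1"
  using facts(8) easy'(1) new by (auto simp: conf_eq_1 min_def split: if_splits)

lemma B0_ge: "C \<le> B0"
proof -
  have "Phi s g (ell i) (Suc i) (qf (Suc i)) + C \<le> B0"
    using new ell_le_e0[OF easy'(4)] easy' by (intro Phi_credit) auto
  moreover have "0 \<le> Phi s g (ell i) (Suc i) (qf (Suc i))" by (simp add: Phi_nonneg qf_nonneg)
  ultimately show ?thesis by linarith
qed

lemma C_pos: "0 < C" using easy'(3) L_ge by simp

text \<open>\<open>3 * 512 * 16 * 4 * 4 = 393216\<close>, since
  \<open>gp i\<^sup>2 * 4 ^ ell i \<le> 4\<close>. So half of the credit \<open>C\<close> pays for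
  every block of a test up to full confidence.\<close>

lemma R_le: "gp i * (3 * R) \<le> C / 2" "0 \<le> R"
proof -
  have "98304 * real L * (gp i * gp i * 4 ^ ell i) \<le> 98304 * real L * 4"
    using gp_sq_le[OF easy'(4)] by (intro mult_left_mono) auto
  then have "98304 * real L * (gp i * gp i * 4 ^ ell i) \<le> 500000 * real L" by simp
  then show "gp i * (3 * R) \<le> C / 2" using easy'(3) by (simp add: field_simps power_add)
qed simp

lemma n_le_R: "E + 3 \<le> e \<Longrightarrow> e \<le> ell i + 2 \<Longrightarrow> real n \<le> R"
proof -
  assume e: "E + 3 \<le> e" "e \<le> ell i + 2"
  then have "n = 512 * 4 ^ e * y\<^sup>2" using phase(4) by (simp add: test_size_def)
  also have "\<dots> \<le> 512 * 4 ^ (ell i + 2) * (4 * L)"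
    using facts(6) e(2) by (intro mult_le_mono power_increasing) auto
  finally have "real n \<le> real (512 * 4 ^ (ell i + 2) * (4 * L))" by (rule of_nat_mono)
  then show ?thesis by simp
qed

text \<open>The other half of \<open>C\<close> covers the risk that the safe arm is rejected before
  the credit is earned: for margin at least 1/2 the exponential is tiny.\<close>

lemma safe_le:
  assumes "1 / 2 \<le> z'" "0 \<le> n'"
  shows "B0 - C + gp i * (3 * R - n') + 2 * exp (- 256 * z') * C \<le> B0" "B0 - C + gp i * (3 * R - n') \<le> B0"
proof -
  have "exp (- 256 * z') \<le> exp (- 128)" using assms by simp
  also have "\<dots> \<le> (1::real) / 4" using exp_ge_add_one_self[of "128::real"] by (simp add: exp_minus field_simps)
  finally have "2 * exp (- 256 * z') * C \<le> 1 / 2 * C" using C_pos by (intro mult_right_mono) auto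
  moreover have "gp i * (3 * R - n') \<le> gp i * (3 * R)" using assms easy'(3) by (intro mult_left_mono) auto
  moreover have "x \<le> 1 / 2 * k \<Longrightarrow> w \<le> r \<Longrightarrow> r \<le> k / 2 \<Longrightarrow> B0 - k + w + x \<le> B0"
      "w \<le> r \<Longrightarrow> r \<le> k / 2 \<Longrightarrow> 0 < k \<Longrightarrow> B0 - k + w \<le> B0" for x k w r :: real
    by linarith+
  ultimately show "B0 - C + gp i * (3 * R - n') + 2 * exp (- 256 * z') * C \<le> B0"
      "B0 - C + gp i * (3 * R - n') \<le> B0"
    using R_le(1) C_pos by blast+
qed

lemma B0_nonneg: "0 \<le> B0" by (simp add: Phi_nonneg qf_nonneg)

lemma psi_new:
  "psi (Test s c M E i e' y') = (if e' < E + 3 then B0 + gp i * (3 * real (test_size E (E + 3) 1) - real (test_size E e' y'))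
      else if e' = E + 3 \<and> margin s M E i y' < 1 / 2 then B0 + gp i * (2 * real (test_size E e' y'))
      else B0 - C + gp i * (3 * R - real (test_size E e' y'))
        + (if e' = E + 3 then 2 * exp (- 256 * margin s M E i y') * C else 0))"
  using i nh new by (simp add: Let_def)

lemma e0_ok: "e \<le> ell i + 2 \<Longrightarrow> e \<le> e0 + 8"
  using ell_le_e0[OF easy'(4)] by linarith

lemma not_final: "\<not> final s e y" if "e \<le> ell i + 2"
  using that easy'(1) by (simp add: final_def)

text \<open>Up to level \<open>E + 3\<close> the blocks form a geometric series, and
  \<open>2 * ?N\<close> is left over at its end for the undecided case there; in the safe case the
  potential falls to \<open>B0\<close> at once.\<close>

lemma step_new1:
  assumes e: "e < E + 3"
  shows "V L f T 0 0 \<le> psi T + real f / 2 ^ L"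
proof -
  have y1: "y = 1" using phase(3) e by simp
  have nf: "\<not> final s e y" using not_final e new by simp
  let ?e = "adv_e s E e y" and ?y = "adv_y s E e y"
  have adv: "?e = Suc e" "?y = 1" using e y1 phase(1) by (auto simp: adv_e_def adv_y_def)
  let ?N = "real (test_size E (E + 3) 1)"
  let ?a = "B0 + gp i * (3 * ?N - 2 * real n)"
  have nn: "2 * real n \<le> real (test_size E (Suc e) 1)"
    using test_size_Suc_ge[of E e 1] y1 by simp
  have "test_size E (Suc e) 1 \<le> test_size E (E + 3) 1" using e by (intro test_size_mono) auto
  then have nN: "real (test_size E (Suc e) 1) \<le> ?N" by simp
  have a: "B0 + gp i * (2 * ?N) \<le> ?a"
    using nn nN easy'(3) by (intro add_left_mono mult_left_mono) linarith+
  have a0: "B0 \<le> ?a" using a easy'(3) by (smt (verit) mult_nonneg_nonneg of_nat_0_le_iff)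
  have psi': "psi (Test s c M E i ?e ?y) \<le> ?a"
  proof -
    consider "Suc e < E + 3" | "Suc e = E + 3" "margin s M E i 1 < 1 / 2" | "Suc e = E + 3" "1 / 2 \<le> margin s M E i 1"
      using e by linarith
    then show ?thesis
    proof cases
      case 1
      then have "psi (Test s c M E i ?e ?y) = B0 + gp i * (3 * ?N - real (test_size E (Suc e) 1))"
        unfolding psi_new adv by simp
      also have "\<dots> \<le> ?a" using nn easy'(3) by (intro add_left_mono mult_left_mono) auto
      finally show ?thesis .
    next
      case 2
      then have "psi (Test s c M E i ?e ?y) = B0 + gp i * (2 * ?N)"
        unfolding psi_new adv \<open>Suc e = E + 3\<close> by simp
      then show ?thesis using a by simp
    next
      case 3
      then have "psi (Test s c M E i ?e ?y) = B0 - C + gp i * (3 * R - ?N) + 2 * exp (- 256 * margin s M E i 1) * C"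
        unfolding psi_new adv \<open>Suc e = E + 3\<close> by simp
      also have "\<dots> \<le> B0" by (intro safe_le 3) simp
      finally show ?thesis using a0 by simp
    qed
  qed
  have W: "False \<or> V L (f - n) (after L K T S) 0 0 \<le> ?a + 0 * of_bool False + real (f - n) / 2 ^ L" for S
  proof (cases "rejects L s M E e y S")
    case True
    then show ?thesis using rej_same[OF i nh True] e0_ok e new a0 by simp
  next
    case False
    then show ?thesis using adv_val[OF nf _ psi' order_trans[OF B0_nonneg a0]] nf L_ge adv unfolding after_Test by simp
  qed
  show ?thesis
  proof (rule step_T[OF W _ order_refl])
    show "0 \<le> ?a" using a0 B0_nonneg by linarith
    show "real n * gp i + ?a + 0 * 0 \<le> psi T" unfolding psi_new using e by (simp add: algebra_simps)
  qed (simp_all add: PB_empty facts)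
qed

lemma margin_eq: "e = E + 3 \<Longrightarrow> m - mu i - threshold e y = - (z / real y) / 2 ^ e"
  using facts(5) by (simp add: margin_def threshold_def field_simps)

text \<open>The summand 1 comes from the term \<open>1 / y\<close> of the threshold. It moves every
  margin from -1/4 upwards to at least 1/2 in one doubling.\<close>

lemma margin_double: "margin s M E i (2 * y) = 2 * z + 1"
  by (simp add: margin_def algebra_simps)

lemma scaled_sq: "e = E + 3 \<Longrightarrow> real n * ((t / real y) / 2 ^ e)\<^sup>2 = 512 * t\<^sup>2"
  unfolding size_sq using phase(4) facts(5) by (simp add: power_divide)

lemma scaled_res: "1 / 4 \<le> t \<Longrightarrow> 4 \<le> 2 ^ L * ((t / real y) / 2 ^ e)"
proof (rule resolution[OF rounds(1) facts(6,5)])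
  assume t: "1 / 4 \<le> t"
  have "1 / (64 * real y * 2 ^ s) = (1 / 64 / real y) * (1 / 2 ^ s)" by simp
  also have "\<dots> \<le> (t / real y) * (1 / 2 ^ e)"
    using t facts(5) eps_le by (intro mult_mono divide_right_mono) auto
  finally show "1 / (64 * real y * 2 ^ s) \<le> (t / real y) / 2 ^ e" by simp
qed

text \<open>If \<open>z < - 1 / 4\<close>, the arm passes with probability at most 1/8 and the next
  block is 4 times as large: \<open>n + 2 * 4 * n / 8 = 2 * n\<close>. Otherwise the next state is
  safe, or already beyond level \<open>E + 3\<close>, and has potential at most
  \<open>B0\<close>.\<close>

lemma step_new2:
  assumes e: "e = E + 3" and unsafe: "z < 1 / 2"
  shows "V L f T 0 0 \<le> psi T + real f / 2 ^ L"
proof -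
  have eell: "e \<le> ell i + 1" using e new by simp
  have nf: "\<not> final s e y" using not_final eell by simp
  let ?e = "adv_e s E e y" and ?y = "adv_y s E e y"
  let ?X = "\<lambda>S. \<not> rejects L s M E e y S \<and> z < - 1 / 4"
  let ?w = "gp i * (8 * real n)"
  have nb: "\<not> (e < s \<and> e < E + 3)" using e by simp
  have psi': "psi (Test s c M E i ?e ?y) \<le> B0 + ?w * of_bool (z < - 1 / 4)"
  proof (cases "L \<le> y\<^sup>2")
    case True
    then have adv: "?e = Suc e" "?y = y" by (auto simp: adv_e_def adv_y_def)
    have "psi (Test s c M E i ?e ?y) = B0 - C + gp i * (3 * R - real (test_size E (Suc e) y))"
      unfolding psi_new adv using e by simp
    also have "\<dots> \<le> B0" by (intro safe_le(2)[of 1]) auto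
    also have "\<dots> \<le> B0 + ?w * of_bool (z < - 1 / 4)" using easy'(3) by simp
    finally show ?thesis .
  next
    case False
    then have adv: "?e = e" "?y = 2 * y" using nb by (auto simp: adv_e_def adv_y_def)
    show ?thesis
    proof (cases "1 / 2 \<le> margin s M E i (2 * y)")
      case True
      then have "psi (Test s c M E i ?e ?y) = B0 - C + gp i * (3 * R - real (test_size E e (2 * y)))
          + 2 * exp (- 256 * margin s M E i (2 * y)) * C"
        unfolding psi_new adv using e by simp
      also have "\<dots> \<le> B0" by (intro safe_le True) simp
      also have "\<dots> \<le> B0 + ?w * of_bool (z < - 1 / 4)" using easy'(3) by simp
      finally show ?thesis .
    next
      case False
      then have "z < - 1 / 4" unfolding margin_double by simp
      moreover have "psi (Test s c M E i ?e ?y) = B0 + gp i * (2 * real (test_size E e (2 * y)))"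
        unfolding psi_new adv using e False by simp
      ultimately show ?thesis by (simp add: test_size_double)
    qed
  qed
  have W: "False \<or> V L (f - n) (after L K T S) 0 0 \<le> B0 + ?w * of_bool (?X S) + real (f - n) / 2 ^ L" for S
  proof (cases "rejects L s M E e y S")
    case True
    then show ?thesis using rej_same[OF i nh True] e0_ok eell by simp
  next
    case False
    have "?e \<le> ell i + 2" using eell by (auto simp: adv_e_def)
    moreover have "0 \<le> B0 + ?w * of_bool (z < - 1 / 4)" using B0_nonneg easy'(3) by simp
    ultimately have "V L (f - n) (Test s c M E i ?e ?y) 0 0 \<le> B0 + ?w * of_bool (z < - 1 / 4) + real (f - n) / 2 ^ L"
      using psi' new by (intro adv_val[OF nf]) auto
    then show ?thesis using nf False unfolding after_Test by simp
  qed
  have X: "PB i (2 ^ L) n ?X \<le> 1 / 8"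
  proof (cases "z < - 1 / 4")
    case True
    let ?t = "((1 / 4) / real y) / 2 ^ e :: real"
    have "PB i (2 ^ L) n ?X \<le> exp (- 32)"
    proof (rule test_upper)
      show "4 \<le> 2 ^ L * ?t" by (rule scaled_res) simp
      show "32 \<le> real n * ?t\<^sup>2" unfolding scaled_sq[OF e] by (simp add: power2_eq_square)
      fix S assume "?X S"
      then have "m - threshold e y \<le> test_mean L E e y S" by (simp add: rejects_def)
      moreover have "?t \<le> - (z / real y) / 2 ^ e"
        using True facts(5) unfolding minus_divide_left by (intro divide_right_mono) auto
      ultimately show "mu i + ?t \<le> test_mean L E e y S" using margin_eq[OF e] by linarith
    qed (use facts in auto)
    also have "\<dots> \<le> (1::real) / 8" using exp_ge_add_one_self[of "32::real"] by (simp add: exp_minus field_simps)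
    finally show ?thesis .
  next
    case False
    then have "?X = (\<lambda>_. False)" by auto
    then show ?thesis using PB_empty facts by simp
  qed
  show ?thesis
  proof (rule step_T[OF W B0_nonneg _ X])
    show "real n * gp i + B0 + ?w * (1 / 8) \<le> psi T" unfolding psi_new using e unsafe by simp
  qed (use easy'(3) in \<open>simp_all add: PB_empty facts\<close>)
qed

text \<open>A rejection here forfeits \<open>C\<close>, with probability at most
  \<open>exp (- 512 * z\<^sup>2) \<le> exp (- 256 * z)\<close> as \<open>z \<ge> 1/2\<close>. Of the
  two copies of that bound in \<open>psi\<close>, one pays for this block and one for the doubled
  margin.\<close>

lemma step_new3:
  assumes e: "e = E + 3" and safe: "1 / 2 \<le> z"
  shows "V L f T 0 0 \<le> psi T + real f / 2 ^ L"
proof -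
  have eell: "e \<le> ell i + 1" using e new by simp
  have nf: "\<not> final s e y" using not_final eell by simp
  let ?e = "adv_e s E e y" and ?y = "adv_y s E e y"
  have nb: "\<not> (e < s \<and> e < E + 3)" using e by simp
  let ?u = "if L \<le> y\<^sup>2 then 0 else 2 * exp (- 256 * (2 * z + 1)) * C"
  let ?a = "B0 - C + gp i * (3 * R - 2 * real n) + ?u"
  have n0: "0 \<le> gp i * (3 * R - 2 * real n)"
  proof -
    have "real n \<le> R" using e eell by (intro n_le_R) auto
    then have "0 \<le> 3 * R - 2 * real n" using R_le(2) by linarith
    then show ?thesis using easy'(3) by (intro mult_nonneg_nonneg) auto
  qed
  have "0 \<le> 2 * exp (- 256 * (2 * z + 1)) * C" using C_pos by (intro mult_nonneg_nonneg) auto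
  then have u0: "0 \<le> ?u" by (simp only: order_refl simp_thms split: if_split)
  have a: "B0 \<le> ?a + C" using n0 u0 by linarith
  have a': "0 \<le> ?a" using B0_ge n0 u0 by linarith
  have "gp i * (3 * R - real (test_size E ?e ?y)) \<le> gp i * (3 * R - 2 * real n)"
    using adv_size(1)[of E e y s] easy'(3) by (intro mult_left_mono) auto
  then have psi': "psi (Test s c M E i ?e ?y) \<le> ?a"
    unfolding psi_new using nb e safe by (auto simp: adv_e_def adv_y_def margin_double)
  have W: "False \<or> V L (f - n) (after L K T S) 0 0 \<le> ?a + C * of_bool (rejects L s M E e y S) + real (f - n) / 2 ^ L" for S
  proof (cases "rejects L s M E e y S")
    case True
    then show ?thesis using rej_same[OF i nh True] e0_ok eell a by simp
  next
    case False
    have "?e \<le> ell i + 2" using eell by (auto simp: adv_e_def)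
    then have "V L (f - n) (Test s c M E i ?e ?y) 0 0 \<le> ?a + real (f - n) / 2 ^ L"
      using psi' new a' by (intro adv_val[OF nf]) auto
    then show ?thesis using nf False unfolding after_Test by simp
  qed
  have X: "PB i (2 ^ L) n (\<lambda>S. rejects L s M E e y S) \<le> exp (- (512 * z\<^sup>2))"
  proof (rule test_lower)
    let ?t = "(z / real y) / 2 ^ e"
    show "4 \<le> 2 ^ L * ?t" using safe by (intro scaled_res) simp
    show "512 * z\<^sup>2 \<le> real n * ?t\<^sup>2" unfolding scaled_sq[OF e] by simp
    show "0 < ?t" using safe facts(5) by simp
    fix S assume "rejects L s M E e y S"
    then have "test_mean L E e y S < m - threshold e y" by (simp add: rejects_def)
    then show "test_mean L E e y S \<le> mu i - ?t" using margin_eq[OF e] by linarith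
  qed (use facts in auto)
  show ?thesis
  proof (rule step_T[OF W _ _ X])
    show "0 \<le> ?a" using B0_ge n0 u0 by linarith
    show "real n * gp i + ?a + C * exp (- (512 * z\<^sup>2)) \<le> psi T"
    proof -
      have "256 * z \<le> 512 * z\<^sup>2" using safe mult_right_mono[of "1/2" z z] by (simp add: power2_eq_square)
      then have e1: "exp (- (512 * z\<^sup>2)) \<le> exp (- 256 * z)" by simp
      have "exp (- 256 * (2 * z + 1)) = exp (- 256 * z) * exp (- 256 * (z + 1))"
        by (simp flip: exp_add)
      moreover have "exp (- 256 * (z + 1)) \<le> 1 / 2"
      proof -
        have "exp (- 256 * (z + 1)) \<le> exp (- 1)" using safe by simp
        also have "\<dots> \<le> 1 / 2" using exp_ge_add_one_self[of "1::real"] by (simp add: exp_minus field_simps)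
        finally show ?thesis .
      qed
      ultimately have e2: "2 * exp (- 256 * (2 * z + 1)) \<le> exp (- 256 * z)"
        using mult_left_mono[of "exp (- 256 * (z + 1))" "1/2" "exp (- 256 * z)"] by simp
      have "?u \<le> exp (- 256 * z) * C"
      proof (cases "L \<le> y\<^sup>2")
        case True
        have "0 \<le> exp (- 256 * z) * C" using C_pos by (intro mult_nonneg_nonneg) auto
        then show ?thesis using True by (simp only: if_True)
      next
        case False
        then show ?thesis using mult_right_mono[OF e2, of C] C_pos by (simp only: if_False less_imp_le)
      qed
      moreover have "C * exp (- (512 * z\<^sup>2)) \<le> exp (- 256 * z) * C"
        unfolding mult.commute[of C] using C_pos by (intro mult_right_mono e1) auto
      moreover have "psi T = B0 - C + gp i * (3 * R - real n) + 2 * (exp (- 256 * z) * C)"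
        unfolding psi_new using e safe by simp
      moreover have "gp i * (3 * R - real n) = real n * gp i + gp i * (3 * R - 2 * real n)"
        by (simp add: algebra_simps)
      ultimately show ?thesis by linarith
    qed
  qed (use C_pos in \<open>simp_all add: PB_empty facts\<close>)
qed

text \<open>At full confidence both a rejection below level \<open>ell i - 1\<close> and a pass at
  level \<open>ell i + 2\<close> are rare events. Any other rejection sets \<open>E\<close> to at
  least \<open>ell i - 1\<close> and thus earns the credit already deducted from the
  potential.\<close>

lemma step_new4:
  assumes e: "E + 3 < e"
  shows "V L f T 0 0 \<le> psi T + real f / 2 ^ L"
proof -
  have yL: "L \<le> y\<^sup>2" using phase(2) e by auto
  have eell: "e \<le> ell i + 2" using facts(12) i nh yL by auto
  have nf: "\<not> final s e y" using not_final eell by simp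
  have adv: "adv_e s E e y = Suc e" "adv_y s E e y = y" using yL by (auto simp: adv_e_def adv_y_def)
  let ?Y = "\<lambda>S. Suc e < ell i \<and> rejects L s M E e y S \<or> e = ell i + 2 \<and> \<not> rejects L s M E e y S"
  let ?a = "B0 - C + gp i * (3 * R - 2 * real n)"
  have n0: "0 \<le> gp i * (3 * R - 2 * real n)"
  proof -
    have "real n \<le> R" using e eell by (intro n_le_R) auto
    then have "0 \<le> 3 * R - 2 * real n" using R_le(2) by linarith
    then show ?thesis using easy'(3) by (intro mult_nonneg_nonneg) auto
  qed
  have "gp i * (3 * R - real (test_size E (Suc e) y)) \<le> gp i * (3 * R - 2 * real n)"
    using test_size_Suc_ge[of E e y] easy'(3) by (intro mult_left_mono) auto
  then have psi': "psi (Test s c M E i (Suc e) y) \<le> ?a" unfolding psi_new using e by simp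
  have W: "?Y S \<or> V L (f - n) (after L K T S) 0 0 \<le> ?a + 0 * of_bool False + real (f - n) / 2 ^ L" for S
  proof (cases "rejects L s M E e y S")
    case True
    show ?thesis
    proof (cases "Suc e < ell i")
      case False
      have "Phi s g e (Suc i) (qf (Suc i)) + C \<le> B0"
        using e e0_ok[OF eell] easy' new False by (intro Phi_credit) auto
      then have "Phi s g e (Suc i) (qf (Suc i)) \<le> ?a" using n0 by linarith
      then show ?thesis using next_val[OF facts(4)] True yL e by (simp add: after_Test)
    qed (use True in blast)
  next
    case rej: False
    show ?thesis
    proof (cases "e = ell i + 2")
      case False
      then have "Suc e \<le> ell i + 2" using eell by simp
      then have "V L (f - n) (Test s c M E i (Suc e) y) 0 0 \<le> ?a + real (f - n) / 2 ^ L"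
        using psi' new B0_ge n0 adv_val[OF nf, unfolded adv, of ?a] by auto
      then show ?thesis using nf rej unfolding after_Test adv by simp
    qed (use rej in blast)
  qed
  \<comment> \<open>Here \<open>L \<ge> 64\<close> matters: it brings the threshold to at least 15/8
    units, one full unit above the largest difference of means, which is at most 7/8.\<close>
  have y8: "8 \<le> real y"
  proof -
    have "8\<^sup>2 \<le> y\<^sup>2" using yL L_ge by simp
    then have "8 \<le> y" by (rule power2_le_imp_le) simp
    then show ?thesis by simp
  qed
  have yL': "real L \<le> real (y\<^sup>2)" using yL by (rule of_nat_mono)
  have Y: "PB i (2 ^ L) n ?Y \<le> 1 / 4 ^ L"
  proof -
    consider "Suc e < ell i" | "e = ell i + 2" | "\<not> Suc e < ell i" "e \<noteq> ell i + 2" by linarith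
    then show ?thesis
    proof cases
      case 1
      have "PB i (2 ^ L) n ?Y \<le> exp (- (512 * real (y\<^sup>2)))"
      proof (rule test_lower)
        have "1 / (64 * 2 ^ s) \<le> (1 / 2 ^ s :: real)" by (simp add: field_simps)
        then show "4 \<le> 2 ^ L * (1 / 2 ^ e :: real)" using eps_le by (intro res1) linarith
        show "512 * real (y\<^sup>2) \<le> real n * (1 / 2 ^ e)\<^sup>2" unfolding size_sq using phase(4) e by simp
        fix S assume "?Y S"
        then have "test_mean L E e y S < m - threshold e y" using 1 by (auto simp: rejects_def)
        moreover have "threshold e y \<ge> (15 / 8) * (1 / 2 ^ e)"
        proof -
          have "1 / real y \<le> 1 / 8" using y8 by (simp add: field_simps)
          then have "(15 / 8) / 2 ^ e \<le> (2 - 1 / real y) / 2 ^ e" by (intro divide_right_mono) auto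
          then show ?thesis by (simp add: threshold_def)
        qed
        moreover have "m - mu i \<le> (7 / 8) * (1 / 2 ^ e)"
        proof -
          have "gp i \<le> 2 * (1 / 2 ^ ell i)" using ell_gt[OF easy'(4)] by simp
          also have "\<dots> \<le> 2 * (1 / 2 ^ (e + 2))" using 1 by (intro mult_left_mono pow2_div_le) auto
          also have "\<dots> = (1 / 2) * (1 / 2 ^ e)" by (simp add: power_add)
          finally have "gp i \<le> (1 / 2) * (1 / 2 ^ e)" .
          moreover have "(0::real) < 1 / 2 ^ e" by simp
          ultimately show ?thesis using gam_bounds(2)[OF i nh] by linarith
        qed
        ultimately show "test_mean L E e y S \<le> mu i - 1 / 2 ^ e" by linarith
      qed (use facts in auto)
      also have "\<dots> \<le> 1 / 4 ^ L" using yL' by (intro exp_delta2) linarith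
      finally show ?thesis .
    next
      case 2
      have "PB i (2 ^ L) n ?Y \<le> PB i (2 ^ L) n (\<lambda>S. \<not> rejects L s M E e y S)"
        using 2 by (intro PB_mono facts) auto
      also have "\<dots> \<le> exp (- (400 * real (y\<^sup>2)))" using 2 by (intro pass_prob[OF i nh]) simp
      also have "\<dots> \<le> 1 / 4 ^ L" using yL' by (intro exp_delta2) linarith
      finally show ?thesis .
    next
      case 3
      then have "?Y = (\<lambda>_. False)" by auto
      then show ?thesis using PB_empty facts by simp
    qed
  qed
  show ?thesis
  proof (rule step_T[OF W _ order_refl _ Y])
    show "0 \<le> ?a" using B0_ge n0 by linarith
    show "real n * gp i + ?a + 0 * 0 \<le> psi T" unfolding psi_new using e by (simp add: algebra_simps)
  qed (simp add: PB_empty facts)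
qed

end

lemma step_Test: "V L f T 0 0 \<le> psi T + real f / 2 ^ L"
proof (cases "gp i = 0")
  case True
  then show ?thesis using step_optimal step_hot by blast
next
  case i: False
  show ?thesis
  proof (cases "hard i s g")
    case True
    then show ?thesis by (rule step_hard[OF i])
  next
    case h: False
    show ?thesis
    proof (cases "ell i \<le> E + 1")
      case True
      then show ?thesis by (rule step_old[OF i h])
    next
      case False
      then have n: "E + 1 < ell i" by simp
      consider "e < E + 3" | "e = E + 3" "margin s M E i y < 1 / 2" | "e = E + 3" "1 / 2 \<le> margin s M E i y" | "E + 3 < e"
        by linarith
      then show ?thesis
        using step_new1[OF i h n] step_new2[OF i h n] step_new3[OF i h n] step_new4[OF i h n] by cases auto
    qed
  qed
qed

end

context epoch
begin

text \<open>\<open>max 0\<close> spares a proof that \<open>psi\<close> is nonnegative on all good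
  blocks.\<close>

theorem V_le_psi: "good f b \<Longrightarrow> V L f b 0 0 \<le> max 0 (psi b) + real f / 2 ^ L"
proof (induction f arbitrary: b rule: less_induct)
  case (less f)
  show ?case
  proof (cases "f = 0")
    case True
    then show ?thesis by simp
  next
    case False
    then interpret epoch_step K mu p L istar f using less.IH by unfold_locales auto
    show ?thesis
    proof (cases b)
      case (Ref s c E i)
      then show ?thesis using step_Ref[of s c E i] less.prems by simp
    next
      case (Test s c M E i e y)
      then interpret test_step K mu p L istar f s c M E i e y using less.prems by unfold_locales auto
      show ?thesis using step_Test Test by simp
    qed
  qed
qed

end

section \<open>Regret of the chain\<close>

type_synonym chain_state = "nat \<times> nat \<times> block \<times> nat \<times> nat"

abbreviation start :: block where "start \<equiv> Ref 0 0 0 0"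

fun chain_arm :: "chain_state \<Rightarrow> nat" where "chain_arm (L, t, b, n, S) = block_arm b"
fun chain_res :: "chain_state \<Rightarrow> nat" where "chain_res (L, t, b, n, S) = 2 ^ L"

fun chain_next :: "nat \<Rightarrow> chain_state \<Rightarrow> nat \<Rightarrow> chain_state" where
  "chain_next K (L, t, b, n, S) r =
     (if Suc t < 2 ^ L then
        (if Suc n < block_size L b then (L, Suc t, b, Suc n, S + r)
         else (L, Suc t, after L K b (S + r), 0, 0))
      else (2 * L, 0, start, 0, 0))"

definition rate :: "real \<Rightarrow> real \<Rightarrow> real \<Rightarrow> real" where
  "rate \<gamma> x d = lg (1 / x) powr \<gamma> + ln (x / d) / (\<gamma> * lg (ln (x / d)))"

text \<open>Equivalent to \<open>lg j \<le> sqrt j\<close>, obtained from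
  \<open>ln x \<le> x - 1\<close> at \<open>x = sqrt j / 2\<close>.\<close>

lemma sqrt_le_div_lg: "1 \<le> j \<Longrightarrow> sqrt j \<le> j / lg j"
proof -
  assume j: "1 \<le> j"
  have "ln (sqrt j / 2) \<le> sqrt j / 2 - 1" using j by (intro ln_le_minus_one) auto
  moreover have "ln (sqrt j / 2) = ln (sqrt j) - ln 2" using j by (simp add: ln_div)
  moreover have "ln 2 \<le> (1::real)" using ln_le_minus_one[of "2::real"] by simp
  moreover have "ln j = 2 * ln (sqrt j)" using j by (simp add: ln_sqrt)
  ultimately have "ln j \<le> sqrt j" by linarith
  then have "lg j \<le> sqrt j" using j by (simp add: lg_def)
  then have "sqrt j * lg j \<le> sqrt j * sqrt j" using j by (intro mult_left_mono) auto
  then show ?thesis using j by (simp add: lg_def field_simps)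
qed

lemma ln_2_ge: "1 / 2 \<le> ln (2::real)"
proof -
  have "exp (1 / 2) \<le> (2::real)"
  proof -
    have "exp (1 / 2 :: real) ^ 2 = exp 1" by (simp flip: exp_of_nat_mult)
    also have "\<dots> \<le> 2\<^sup>2" using exp_le by simp
    finally show ?thesis by (rule power2_le_imp_le) simp
  qed
  then show ?thesis by (subst ln_ge_iff) auto
qed

lemma pow2_ln: "2 ^ n \<le> x \<Longrightarrow> real n \<le> 2 * ln x" for x :: real
proof -
  assume x: "2 ^ n \<le> x"
  have "0 < x" using less_le_trans[OF zero_less_power[of "2::real" n] x] by simp
  have "real n * ln 2 = ln (2 ^ n)" by (simp add: ln_realpow)
  also have "\<dots> \<le> ln x" using x \<open>0 < x\<close> by (subst ln_le_cancel_iff) auto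
  finally have "real n * ln 2 \<le> ln x" .
  moreover have "real n * (1 / 2) \<le> real n * ln 2" by (intro mult_left_mono ln_2_ge) auto
  ultimately show ?thesis by linarith
qed

section \<open>From the potential to the rate of one epoch\<close>

context epoch
begin

lemma epoch_bound:
  assumes f: "f \<le> 2 ^ L"
  shows "V L f start 0 0 \<le> 2 * 10 ^ 10 * real L * (\<Sum>k\<in>SO. kap k / gp k)"
proof -
  let ?M = "\<Sum>k\<in>SO. kap k / gp k"
  have one: "1 \<le> kap k / gp k" if "k \<in> SO" for k
    using SO_D[OF that] gp_le_1[of k] kap_ge_1[of k] by (simp add: field_simps)
  have le_M: "kap k / gp k \<le> ?M" if "k \<in> SO" for k
  proof (rule member_le_sum[OF that])
    show "0 \<le> kap x / gp x" if "x \<in> SO - {k}" for x using one[of x] that by auto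
  qed simp
  obtain k0 where "k0 \<in> SO" using suboptimal by (auto simp: SO_def)
  then have M1: "1 \<le> ?M" using one le_M by force
  have good: "good f start" using f K_pos by simp
  have ph: "phi k 0 (gp 0) 0 0 (qf 0) \<le> 11 * 10 ^ 9 * real L * (kap k / gp k)" if k: "k \<in> SO" for k
  proof -
    have g: "0 < gp k" "gp k \<le> 1" using SO_D[OF k] gp_le_1 by auto
    have gg: "gp k \<le> 1 / gp k" using g mult_mono[of "gp k" 1 "gp k" 1] by (simp add: field_simps)
    have "nx k 0 (gp 0) (qf 0) \<le> 20 * 4 ^ (ell k + 9)" by (simp add: nx_def)
    \<comment> \<open>\<open>5242880 = 20 * 4 ^ 9\<close>, the geometric budget for all rounds below
      level \<open>ell k + 8\<close>.\<close>
    then have nx: "nx k 0 (gp 0) (qf 0) \<le> 5242880 * 4 ^ ell k" by (simp add: power_add)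
    have "gp k * (5242880 * 4 ^ ell k) \<le> 20971520 / gp k"
      using gp_sq_le[OF k] g by (simp add: field_simps)
    moreover have "gp k * nx k 0 (gp 0) (qf 0) \<le> gp k * (5242880 * 4 ^ ell k)"
      using nx g by (intro mult_left_mono) auto
    moreover have "gp k * (if 0 \<le> k \<and> hard k 0 (gp 0) then 9 * 4 ^ 0 else 0) \<le> 9 / gp k"
      using gg g by (auto simp: field_simps)
    ultimately have "gp k * ((if 0 \<le> k \<and> hard k 0 (gp 0) then 9 * 4 ^ 0 else 0) + nx k 0 (gp 0) (qf 0)) \<le> 9 / gp k + 20971520 / gp k"
      by (simp only: distrib_left)
    also have "\<dots> = 20971529 / gp k" by (simp add: add_divide_distrib[symmetric])
    finally have "512 * real L * (gp k * ((if 0 \<le> k \<and> hard k 0 (gp 0) then 9 * 4 ^ 0 else 0) + nx k 0 (gp 0) (qf 0)))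
      \<le> 512 * real L * (20971529 / gp k)" by (intro mult_left_mono) auto
    then have 1: "512 * real L * gp k * ((if 0 \<le> k \<and> hard k 0 (gp 0) then 9 * 4 ^ 0 else 0) + nx k 0 (gp 0) (qf 0))
      \<le> 10737422848 * real L * (1 / gp k)" by (simp add: mult.assoc)
    have "real (L + 1 - 0 - (if k < 0 then 1 else 0)) * (kap k + ovr 0 (gp 0) 0)
         + (if 0 < gp 0 then 2 * real (L + 1) * (if e0 + 8 \<le> 0 then qf 0 else 1) else 0)
      \<le> real (L + 1) * kap k + 2 * real (L + 1)"
      by (simp add: ovr_def)
    also have "\<dots> \<le> 6 * real L * kap k"
    proof -
      have "real (L + 1) \<le> 2 * real L" using L_ge by simp
      then have "real (L + 1) * (kap k + 2) \<le> (2 * real L) * (3 * kap k)"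
        using kap_ge_1[of k] by (intro mult_mono) auto
      then show ?thesis by (simp add: algebra_simps)
    qed
    finally have "200000 / gp k * (real (L + 1 - 0 - (if k < 0 then 1 else 0)) * (kap k + ovr 0 (gp 0) 0)
         + (if 0 < gp 0 then 2 * real (L + 1) * (if e0 + 8 \<le> 0 then qf 0 else 1) else 0))
       \<le> 200000 / gp k * (6 * real L * kap k)" using g by (intro mult_left_mono) auto
    then have 2: "200000 / gp k * (real (L + 1 - 0 - (if k < 0 then 1 else 0)) * (kap k + ovr 0 (gp 0) 0)
         + (if 0 < gp 0 then 2 * real (L + 1) * (if e0 + 8 \<le> 0 then qf 0 else 1) else 0))
       \<le> 1200000 * real L * (kap k / gp k)" by simp
    have 3: "(if 0 + 1 < ell k then 1000000 * real L / gp k else 0) \<le> 1000000 * real L * (1 / gp k)"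
      using g by simp
    have "real L * (1 / gp k) \<le> real L * (kap k / gp k)"
      using kap_ge_1[of k] g by (intro mult_left_mono divide_right_mono) auto
    moreover have "0 \<le> real L * (kap k / gp k)" using g kap_ge_1[of k] by simp
    moreover have "a \<le> b \<Longrightarrow> 0 \<le> b \<Longrightarrow> 10738422848 * a + 1200000 * b \<le> 11 * 10 ^ 9 * b" for a b :: real by simp
    ultimately have "10738422848 * (real L * (1 / gp k)) + 1200000 * (real L * (kap k / gp k))
      \<le> 11 * 10 ^ 9 * (real L * (kap k / gp k))" by blast
    then have "10738422848 * real L * (1 / gp k) + 1200000 * real L * (kap k / gp k) \<le> 11 * 10 ^ 9 * real L * (kap k / gp k)"
      by (simp only: mult.assoc)
    with 1 2 3 show ?thesis unfolding phi_def by linarith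
  qed
  define X where "X = real L * ?M"
  have "Phi 0 (gp 0) 0 0 (qf 0) \<le> 11 * 10 ^ 9 * real L * ?M"
    unfolding Phi_def sum_distrib_left by (intro sum_mono ph)
  then have 1: "Phi 0 (gp 0) 0 0 (qf 0) \<le> 11 * 10 ^ 9 * X" by (simp add: X_def)
  have "512 * real L * gp 0 \<le> 512 * real L * ?M"
    using gp_le_1[OF K_pos] M1 by (intro mult_left_mono) auto
  then have 2: "512 * real L * gp 0 \<le> 512 * X" by (simp add: X_def)
  have 3: "1 \<le> X" using L_ge M1 mult_mono[of 1 "real L" 1 ?M] by (simp add: X_def)
  have 4: "real f / 2 ^ L \<le> 1"
  proof -
    have "real f \<le> real (2 ^ L)" using f by (rule of_nat_mono)
    then show ?thesis by simp
  qed
  have "psi start = Phi 0 (gp 0) 0 0 (qf 0) + 512 * real L * gp 0" by simp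
  then have "max 0 (psi start) \<le> 11000000512 * X" using 1 2 3 by simp
  then have "V L f start 0 0 \<le> 20000000000 * X"
    using V_le_psi[OF good] 3 4 by linarith
  then show ?thesis by (simp add: X_def)
qed

lemma kap_le_rate:
  assumes k: "k \<in> SO" and \<gamma>: "0 < \<gamma>"
  shows "kap k \<le> 7 * rate \<gamma> (gp k) (Min (gp ` SO))"
proof -
  let ?d = "Min (gp ` SO)"
  let ?j = "ln (gp k / ?d)"
  have gk: "0 < gp k" using k by (rule SO_D)
  have "?d \<in> gp ` SO" using k by (intro Min_in) auto
  then have d0: "0 < ?d" using SO_D(2) by auto
  have dk: "?d \<le> gp k" using k by (intro Min_le) auto
  have j0: "0 \<le> ?j" using d0 dk by simp
  have l1: "1 \<le> lg x" for x by (simp add: lg_def)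
  have p1: "1 \<le> lg (1 / gp k) powr \<gamma>" using l1 \<gamma> by (intro ge_one_powr_ge_zero) auto
  have r0: "0 \<le> ?j / (\<gamma> * lg ?j)" using j0 \<gamma> l1[of ?j] by (intro divide_nonneg_nonneg mult_nonneg_nonneg) auto
  show ?thesis
  proof (cases "1 \<le> \<gamma>")
    case True
    let ?m = "min (ell k + 2) (e0 + 6 - ell k)"
    have "?m \<ge> 1" using ell_le_e0[OF k] by simp
    then have "sqrt (real ?m) \<le> real ?m" using mult_left_mono[of 1 "real ?m" "real ?m"]
      by (intro real_le_lsqrt) (auto simp: power2_eq_square)
    also have "\<dots> \<le> real (ell k) + 2" by simp
    finally have "kap k \<le> 3 + real (ell k)" by (simp add: kap_def)
    moreover have "real (ell k) \<le> 2 * ln (2 / gp k)"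
      using ell_gt[OF k] gk by (intro pow2_ln) (simp add: field_simps)
    moreover have "ln (2 / gp k) = ln 2 + ln (1 / gp k)" using gk by (simp add: ln_div)
    moreover have "ln 2 \<le> (1::real)" using ln_le_minus_one[of "2::real"] by simp
    moreover have "ln (1 / gp k) \<le> lg (1 / gp k)" by (simp add: lg_def)
    ultimately have "kap k \<le> 5 + 2 * lg (1 / gp k)" by linarith
    moreover have "lg (1 / gp k) \<le> lg (1 / gp k) powr \<gamma>"
      using powr_mono[OF True, of "lg (1 / gp k)"] l1[of "1 / gp k"] by simp
    ultimately have a: "kap k \<le> 5 + 2 * (lg (1 / gp k) powr \<gamma>)" by linarith
    moreover have "x \<le> 5 + 2 * w \<Longrightarrow> 1 \<le> w \<Longrightarrow> 0 \<le> u \<Longrightarrow> x \<le> 7 * (w + u)" for x w u :: real by simp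
    ultimately show ?thesis unfolding rate_def using p1 r0 by blast
  next
    case False
    \<comment> \<open>Now the other argument of the minimum in \<open>kap\<close> is used: the
      number of levels between arm \<open>k\<close> and the hardest arm is logarithmic in the ratio
      of their gaps.\<close>
    have "real (e0 - ell k) \<le> 2 * ln (2 * (gp k / ?d))"
    proof (rule pow2_ln)
      have "e0 \<in> ell ` SO" unfolding e0_def using k by (intro Max_in) auto
      then obtain k0 where k0: "k0 \<in> SO" "e0 = ell k0" by auto
      have "?d \<le> gp k0" using k0 by (intro Min_le) auto
      also have "\<dots> \<le> 2 / 2 ^ e0" using ell_gt[OF k0(1)] k0(2) by simp
      finally have "2 ^ e0 * ?d \<le> 2" by (simp add: field_simps)
      moreover have "(2::real) ^ e0 = 2 ^ (e0 - ell k) * 2 ^ ell k"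
        using ell_le_e0[OF k] by (simp flip: power_add)
      ultimately have "2 ^ (e0 - ell k) * ?d * 2 ^ ell k \<le> 2" by (simp add: ac_simps)
      moreover have "1 \<le> gp k * 2 ^ ell k" using ell_le[OF k] by (simp add: field_simps)
      ultimately have "2 ^ (e0 - ell k) * ?d * 2 ^ ell k \<le> 2 * gp k * 2 ^ ell k" by linarith
      then have "2 ^ (e0 - ell k) * ?d \<le> 2 * gp k" by simp
      then show "2 ^ (e0 - ell k) \<le> 2 * (gp k / ?d)" using d0 by (simp add: field_simps)
    qed
    also have "ln (2 * (gp k / ?d)) = ln 2 + ?j" using gk d0 by (intro ln_mult_pos) auto
    finally have "real (e0 - ell k) \<le> 2 + 2 * ?j"
      using ln_le_minus_one[of "2::real"] by simp
    moreover have "real (min (ell k + 2) (e0 + 6 - ell k)) \<le> real (e0 - ell k) + 6"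
    proof -
      have "min (ell k + 2) (e0 + 6 - ell k) \<le> e0 - ell k + 6" using ell_le_e0[OF k] by linarith
      then show ?thesis by linarith
    qed
    ultimately have "real (min (ell k + 2) (e0 + 6 - ell k)) \<le> 8 + 2 * ?j" by linarith
    then have kap: "kap k \<le> 1 + sqrt (8 + 2 * ?j)" by (simp add: kap_def)
    show ?thesis
    proof (cases "1 \<le> ?j")
      case True
      have "sqrt (8 + 2 * ?j) \<le> sqrt (16 * ?j)" using True by (intro real_sqrt_le_mono) simp
      also have "\<dots> = 4 * sqrt ?j" by (simp add: real_sqrt_mult)
      also have "\<dots> \<le> 4 * (?j / lg ?j)" using sqrt_le_div_lg[OF True] by simp
      finally have 1: "sqrt (8 + 2 * ?j) \<le> 4 * (?j / lg ?j)" .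
      have 2: "?j / lg ?j \<le> ?j / (\<gamma> * lg ?j)"
        using False \<gamma> l1[of ?j] True by (intro divide_left_mono mult_pos_pos) (auto simp: mult_le_cancel_right1)
      have "x \<le> 1 + a \<Longrightarrow> a \<le> 4 * v \<Longrightarrow> v \<le> u \<Longrightarrow> 1 \<le> w \<Longrightarrow> 0 \<le> u \<Longrightarrow> x \<le> 7 * (w + u)" for x a u v w :: real
        by simp
      from this[OF kap 1 2 p1 r0] show ?thesis unfolding rate_def .
    next
      case j1: False
      have "sqrt (8 + 2 * ?j) \<le> sqrt 16" using j1 by (intro real_sqrt_le_mono) simp
      then have 1: "kap k \<le> 5" using kap by simp
      have "x \<le> 5 \<Longrightarrow> 1 \<le> w \<Longrightarrow> 0 \<le> u \<Longrightarrow> x \<le> 7 * (w + u)" for x u w :: real by simp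
      from this[OF 1 p1 r0] show ?thesis unfolding rate_def .
    qed
  qed
qed

end

section \<open>Summation over the epochs\<close>

context arm_model
begin

fun rg :: "nat \<Rightarrow> chain_state \<Rightarrow> real" where
  "rg 0 \<sigma> = 0"
| "rg (Suc T) \<sigma> = gp (chain_arm \<sigma>) + (\<Sum>r\<le>chain_res \<sigma>. p (chain_arm \<sigma>) (chain_res \<sigma>) r * rg T (chain_next K \<sigma> r))"

text \<open>Everything is forgotten at the end of an epoch, so the later regret is the same for all
  outcomes and can be pulled out of the expectation.\<close>

lemma rg_le_V:
  assumes L: "64 \<le> L"
  shows "valid L K b \<Longrightarrow> t < 2 ^ L \<Longrightarrow> rg T (L, t, b, n, S)
    \<le> V L (min T (2 ^ L - t)) b n S + rg (T - (2 ^ L - t)) (2 * L, 0, start, 0, 0)"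
proof (induction T arbitrary: t b n S)
  case (Suc T)
  let ?a = "block_arm b" and ?R = "rg (Suc T - (2 ^ L - t)) (2 * L, 0, start, 0, 0)"
  have a: "?a < K" using Suc.prems(1) by (rule valid_arm)
  have sumR: "(\<Sum>r\<le>2 ^ L. p ?a (2 ^ L) r * ?R) = ?R"
    using p_sum[OF a] by (simp flip: sum_distrib_right)
  show ?case
  proof (cases "Suc t < 2 ^ L")
    case True
    have eqs: "min (Suc T) (2 ^ L - t) = Suc (min T (2 ^ L - Suc t))" "Suc T - (2 ^ L - t) = T - (2 ^ L - Suc t)"
      using True by auto
    let ?v = "\<lambda>r. if Suc n < block_size L b then V L (min T (2 ^ L - Suc t)) b (Suc n) (S + r)
          else V L (min T (2 ^ L - Suc t)) (after L K b (S + r)) 0 0"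
    have "rg (Suc T) (L, t, b, n, S)
      = gp ?a + (\<Sum>r\<le>2 ^ L. p ?a (2 ^ L) r * rg T (chain_next K (L, t, b, n, S) r))" by simp
    also have "\<dots> \<le> gp ?a + (\<Sum>r\<le>2 ^ L. p ?a (2 ^ L) r * (?v r + ?R))"
    proof (intro add_left_mono sum_mono mult_left_mono p_nonneg a)
      fix r
      show "rg T (chain_next K (L, t, b, n, S) r) \<le> ?v r + ?R"
        unfolding eqs(2) using True Suc.IH[OF Suc.prems(1) True, of "Suc n" "S + r"]
          Suc.IH[OF valid_after[OF Suc.prems(1) L] True, of "S + r" 0 0] by simp
    qed
    also have "\<dots> = V L (min (Suc T) (2 ^ L - t)) b n S + ?R"
      unfolding eqs(1) V.simps ring_distribs sum.distrib sumR by simp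
    finally show ?thesis .
  next
    case False
    then have t: "2 ^ L - t = 1" using Suc.prems(2) by simp
    have "min (Suc T) (2 ^ L - t) = Suc 0" "Suc T - (2 ^ L - t) = T" using t by auto
    then show ?thesis using False sumR by (simp cong: if_cong)
  qed
qed simp

lemma V_optimal: "\<forall>k<K. gp k = 0 \<Longrightarrow> valid L K b \<Longrightarrow> 64 \<le> L \<Longrightarrow> V L f b n S = 0"
proof (induction f arbitrary: b n S)
  case (Suc f)
  have "V L f b' n' S' = 0" if "valid L K b'" for b' n' S'
    by (rule Suc.IH[OF Suc.prems(1) that Suc.prems(3)])
  then have "V L f b n' S' = 0" "V L f (after L K b S') n' S'' = 0" for n' S' S''
    using Suc.prems(2) valid_after[OF Suc.prems(2,3)] by auto
  then show ?case using valid_arm[OF Suc.prems(2)] Suc.prems(1) by (simp cong: if_cong)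
qed simp

text \<open>The maximum is shaped for the induction: adding \<open>L\<close> to the bound for
  \<open>2 * L\<close> gives \<open>max (3 * L) (4 * log 2 T - L)\<close>, and a second epoch is
  entered only if \<open>L \<le> log 2 T\<close>, where the second argument is the larger
  one.\<close>

lemma rg_start:
  assumes V: "\<And>L f. 64 \<le> L \<Longrightarrow> f \<le> 2 ^ L \<Longrightarrow> V L f start 0 0 \<le> x * real L" and x: "0 \<le> x"
  shows "64 \<le> L \<Longrightarrow> 0 < T \<Longrightarrow> rg T (L, 0, start, 0, 0) \<le> x * max (real L) (4 * log 2 (real T) - real L)"
proof (induction T arbitrary: L rule: less_induct)
  case (less T)
  have v: "valid L K start" using K_pos by simp
  have step: "rg T (L, 0, start, 0, 0) \<le> x * real L + rg (T - 2 ^ L) (2 * L, 0, start, 0, 0)"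
    using rg_le_V[OF less.prems(1) v, of 0 T 0 0] V[OF less.prems(1), of "min T (2 ^ L)"] by simp
  show ?case
  proof (cases "T \<le> 2 ^ L")
    case True
    then have "rg T (L, 0, start, 0, 0) \<le> x * real L" using step by simp
    also have "\<dots> \<le> x * max (real L) (4 * log 2 (real T) - real L)" using x by (intro mult_left_mono) auto
    finally show ?thesis .
  next
    case False
    let ?T = "T - 2 ^ L"
    have "rg ?T (2 * L, 0, start, 0, 0) \<le> x * max (real (2 * L)) (4 * log 2 (real ?T) - real (2 * L))"
      using False less.prems by (intro less.IH) auto
    also have "\<dots> \<le> x * max (real (2 * L)) (4 * log 2 (real T) - real (2 * L))"
      using False x by (intro mult_left_mono max.mono) auto
    finally have "rg T (L, 0, start, 0, 0) \<le> x * real L + x * max (real (2 * L)) (4 * log 2 (real T) - real (2 * L))"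
      using step by simp
    also have "\<dots> = x * max (3 * real L) (4 * log 2 (real T) - real L)"
      by (simp add: ring_distribs(1)[symmetric] max_add_distrib_right)
    also have "\<dots> \<le> x * max (real L) (4 * log 2 (real T) - real L)"
    proof -
      have "(2::nat) ^ L \<le> T" using False by simp
      then have "(2::real) ^ L \<le> real T" by (metis of_nat_le_iff of_nat_numeral of_nat_power)
      then have "real L \<le> log 2 (real T)" using less.prems(2) by (simp add: le_log_iff powr_realpow)
      then show ?thesis using x by (intro mult_left_mono) auto
    qed
    finally show ?thesis .
  qed
qed

theorem rg_bound:
  assumes \<gamma>: "0 < \<gamma>" and T: "0 < T"
  shows "rg T (64, 0, start, 0, 0) \<le> 10 ^ 14 * (\<Sum>k | k < K \<and> 0 < gp k. 1 / gp k *
     rate \<gamma> (gp k) (Min (gp ` {k. k < K \<and> 0 < gp k})) * lg (real T))"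
proof (cases "\<exists>k<K. 0 < gp k")
  case False
  then have "\<forall>k<K. gp k = 0" using gp_nonneg by force
  then have "V L f start 0 0 \<le> 0 * real L" if "64 \<le> L" for L f
    using V_optimal[of L start f 0 0] K_pos that by simp
  then have "rg T (64, 0, start, 0, 0) \<le> 0 * max (real 64) (4 * log 2 (real T) - real 64)"
    using T by (intro rg_start) auto
  moreover have "(\<Sum>k | k < K \<and> 0 < gp k. F k) = 0" for F :: "nat \<Rightarrow> real"
    using False by (intro sum.neutral) auto
  ultimately show ?thesis by (simp only: mult_zero_left mult_zero_right)
next
  case True
  let ?SO = "{k. k < K \<and> 0 < gp k}"
  let ?r = "\<lambda>k. rate \<gamma> (gp k) (Min (gp ` ?SO))"
  obtain i where i: "i < K" "gp i = 0" using ex_optimal by auto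
  define M where "M = (\<Sum>k\<in>?SO. 1 / gp k * ?r k)"
  have ep: "epoch K mu p L i" if "64 \<le> L" for L
    using i that True by unfold_locales auto
  have kr: "0 \<le> ?r k" if "k \<in> ?SO" for k
  proof -
    interpret epoch K mu p 64 i by (rule ep) simp
    show ?thesis using kap_le_rate[of k \<gamma>] kap_ge_1[of k] \<gamma> that by (simp add: SO_def)
  qed
  have M0: "0 \<le> M" unfolding M_def using kr by (intro sum_nonneg mult_nonneg_nonneg) auto
  have V: "V L f start 0 0 \<le> (14 * 10 ^ 10 * M) * real L" if "64 \<le> L" "f \<le> 2 ^ L" for L f
  proof -
    interpret epoch K mu p L i by (rule ep) fact
    have "(\<Sum>k\<in>SO. kap k / gp k) \<le> (\<Sum>k\<in>SO. 7 * (1 / gp k * ?r k))"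
    proof (rule sum_mono)
      fix k assume k: "k \<in> SO"
      have "kap k / gp k \<le> (7 * ?r k) / gp k"
        using kap_le_rate[OF k \<gamma>] SO_D(2)[OF k] by (intro divide_right_mono) (auto simp: SO_def)
      then show "kap k / gp k \<le> 7 * (1 / gp k * ?r k)" by simp
    qed
    also have "\<dots> = 7 * M" by (simp add: M_def SO_def sum_distrib_left)
    finally have "2 * 10 ^ 10 * real L * (\<Sum>k\<in>SO. kap k / gp k) \<le> 2 * 10 ^ 10 * real L * (7 * M)"
      by (intro mult_left_mono) auto
    then show ?thesis using epoch_bound[OF that(2)] by simp
  qed
  have "rg T (64, 0, start, 0, 0) \<le> (14 * 10 ^ 10 * M) * max (real 64) (4 * log 2 (real T) - real 64)"
    using V M0 T by (intro rg_start) auto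
  also have "max (real 64) (4 * log 2 (real T) - real 64) \<le> 64 * lg (real T)"
  proof -
    have "log 2 (real T) \<le> 2 * ln (real T)"
    proof -
      have "ln (real T) * (1 / 2) \<le> ln (real T) * ln 2" using ln_2_ge T by (intro mult_left_mono) auto
      then show ?thesis by (simp add: log_def field_simps)
    qed
    then show ?thesis by (simp add: lg_def)
  qed
  \<comment> \<open>The constants multiply to \<open>64 * 14 * 10 ^ 10 < 10 ^ 14\<close>; the 64 is
    the exponent of the first epoch, paid even for tiny horizons.\<close>
  finally have "rg T (64, 0, start, 0, 0) \<le> (14 * 10 ^ 10 * M) * (64 * lg (real T))"
    using M0 by (simp add: mult_left_mono)
  also have "\<dots> \<le> 10 ^ 14 * (M * lg (real T))" using M0 by (simp add: lg_def mult_left_mono)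
  also have "M * lg (real T) = (\<Sum>k\<in>?SO. 1 / gp k * ?r k * lg (real T))"
    by (simp add: M_def sum_distrib_right)
  finally show ?thesis by simp
qed

end

section \<open>From the reward table to the chain\<close>

instance block :: countable
  by countable_datatype

definition obs :: "nat \<Rightarrow> real \<Rightarrow> nat" where
  "obs d y = nat \<lfloor>y * real d\<rfloor>"

fun chain :: "nat \<Rightarrow> (nat \<Rightarrow> real \<Rightarrow> nat) \<Rightarrow> (nat \<times> nat \<Rightarrow> real) \<Rightarrow> nat \<Rightarrow> chain_state" where
  "chain K ob x 0 = (64, 0, start, 0, 0)"
| "chain K ob x (Suc t) = chain_next K (chain K ob x t)
     (ob (chain_res (chain K ob x t)) (x (chain_arm (chain K ob x t), t)))"

fun chain_ok :: "nat \<Rightarrow> chain_state \<Rightarrow> bool" where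
  "chain_ok K (L, t, b, n, S) \<longleftrightarrow> 64 \<le> L \<and> valid L K b"

lemma chain_ok_next: "0 < K \<Longrightarrow> chain_ok K \<sigma> \<Longrightarrow> chain_ok K (chain_next K \<sigma> r)"
  by (cases \<sigma>) (auto intro: valid_after)

lemma chain_ok: "0 < K \<Longrightarrow> chain_ok K (chain K ob x t)"
  by (induction t) (auto simp del: chain_next.simps intro: chain_ok_next)

lemma chain_arm_less: "0 < K \<Longrightarrow> chain_arm (chain K ob x t) < K"
  using chain_ok[of K ob x t] by (cases "chain K ob x t") (auto intro: valid_arm)

text \<open>The state at time \<open>t\<close> reads only rewards before \<open>t\<close>; this is
  the source of its independence from the reward drawn at \<open>t\<close>.\<close>

lemma chain_cong:
  "0 < K \<Longrightarrow> (\<And>i s. i < K \<Longrightarrow> s < t \<Longrightarrow> x (i, s) = x' (i, s)) \<Longrightarrow> chain K ob x t = chain K ob x' t"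
proof (induction t)
  case (Suc t)
  then have "chain K ob x t = chain K ob x' t" by simp
  then show ?case using Suc.prems chain_arm_less[of K ob x' t] by simp
qed simp

lemma obs_measurable: "obs d \<in> borel \<rightarrow>\<^sub>M count_space UNIV"
  unfolding obs_def by measurable

text \<open>Outside \<open>I\<close> the entry is the constant \<open>undefined\<close>. This case
  is needed because measurability of the chain is shown by ranging over all states, including those
  with arms that do not exist.\<close>

lemma component_measurable:
  assumes "\<And>i. i \<in> I \<Longrightarrow> sets (N i) = sets borel"
  shows "(\<lambda>x. x j :: real) \<in> PiM I N \<rightarrow>\<^sub>M borel"
proof (cases "j \<in> I")
  case True
  then have "(\<lambda>x. x j) \<in> PiM I N \<rightarrow>\<^sub>M N j" by (rule measurable_component_singleton)
  then show ?thesis using assms[OF True] by (simp cong: measurable_cong_sets)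
next
  case False
  have "x j = undefined" if "x \<in> space (PiM I N)" for x
    using PiE_arb[OF that[unfolded space_PiM] False] .
  then have "(\<lambda>x. x j) \<in> PiM I N \<rightarrow>\<^sub>M borel \<longleftrightarrow> (\<lambda>x. undefined :: real) \<in> PiM I N \<rightarrow>\<^sub>M borel"
    by (rule measurable_cong)
  then show ?thesis by simp
qed

lemma chain_measurable:
  assumes N: "\<And>i. i \<in> I \<Longrightarrow> sets (N i) = sets borel"
    and ob: "\<And>d. ob d \<in> borel \<rightarrow>\<^sub>M count_space UNIV"
  shows "(\<lambda>x. chain K ob x t) \<in> PiM I N \<rightarrow>\<^sub>M count_space UNIV"
proof (induction t)
  case (Suc t)
  have "(\<lambda>x. chain_next K \<sigma> (ob (chain_res \<sigma>) (x (chain_arm \<sigma>, t)))) \<in> PiM I N \<rightarrow>\<^sub>M count_space UNIV" for \<sigma>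
    by (rule measurable_compose[OF measurable_compose[OF component_measurable[OF N] ob]]) auto
  from measurable_compose_countable[OF this Suc.IH] show ?case by simp
qed simp

locale bandit =
  fixes K :: nat and D :: "nat \<Rightarrow> real measure"
  assumes K_pos: "0 < K" and rd: "i < K \<Longrightarrow> reward_distribution (D i)"
begin

text \<open>On rewards in \<open>{0..1}\<close>, \<open>clip\<close> agrees with \<open>obs\<close>, but it keeps the chain finite on all tables.\<close>

definition clip :: "nat \<Rightarrow> real \<Rightarrow> nat" where "clip d y = min (obs d y) d"

definition pw :: "nat \<Rightarrow> nat \<Rightarrow> nat \<Rightarrow> real" where
  "pw a d r = measure (D a) {y. clip d y = r}"

lemma prob_D: "i < K \<Longrightarrow> prob_space (D i)"
  and sets_D: "i < K \<Longrightarrow> sets (D i) = sets borel"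
  and AE_D: "i < K \<Longrightarrow> AE y in D i. y \<in> {0..1}"
  using rd by (auto simp: reward_distribution_def)

lemma space_D: "i < K \<Longrightarrow> space (D i) = UNIV"
  using sets_eq_imp_space_eq[OF sets_D, of i] by simp

lemma clip_measurable: "clip d \<in> borel \<rightarrow>\<^sub>M count_space UNIV"
  unfolding clip_def by (rule measurable_compose[OF obs_measurable]) auto

lemma clip_sets: "{y. clip d y = r} \<in> sets borel"
  using measurable_sets[OF clip_measurable, of "{r}" d] by (simp add: vimage_def)

lemma integral_clip:
  assumes i: "i < K"
  shows "(\<integral>y. g (clip d y) \<partial>D i) = (\<Sum>r\<le>d. pw i d r * g r)" "integrable (D i) (\<lambda>y. g (clip d y) :: real)"
proof -
  interpret prob_space "D i" using i by (rule prob_D)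
  have S: "{y. clip d y = r} \<in> events" for r using clip_sets sets_D[OF i] by simp
  have eq: "g (clip d y) = (\<Sum>r\<le>d. indicator {y. clip d y = r} y * g r)" for y
  proof -
    have "(\<Sum>r\<le>d. indicator {y. clip d y = r} y * g r) = (\<Sum>r\<in>{clip d y}. g r)"
      by (rule sum.mono_neutral_cong_right) (auto simp: clip_def indicator_def)
    then show ?thesis by simp
  qed
  have int: "integrable (D i) (\<lambda>y. indicator {y. clip d y = r} y * g r)" for r
    using S by (intro integrable_mult_left) (simp add: integrable_indicator_iff emeasure_eq_measure)
  show "integrable (D i) (\<lambda>y. g (clip d y))" unfolding eq by (intro Bochner_Integration.integrable_sum int)
  show "(\<integral>y. g (clip d y) \<partial>D i) = (\<Sum>r\<le>d. pw i d r * g r)"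
    unfolding eq by (subst Bochner_Integration.integral_sum) (use int S in \<open>auto simp: pw_def space_D[OF i]\<close>)
qed

lemma clip_close:
  assumes "y \<in> {0..1}" "0 < d"
  shows "real (clip d y) / real d \<le> y" "y - 1 / real d \<le> real (clip d y) / real d"
proof -
  have y: "0 \<le> y * real d" "y * real d \<le> real d" using assms by (auto simp: mult_le_cancel_right1)
  have "obs d y \<le> d" using y unfolding obs_def by linarith
  then have c: "clip d y = obs d y" by (simp add: clip_def)
  have "real (obs d y) \<le> y * real d" "y * real d - 1 \<le> real (obs d y)"
    using y unfolding obs_def by linarith+
  then show "real (clip d y) / real d \<le> y" "y - 1 / real d \<le> real (clip d y) / real d"
    unfolding c using assms divide_right_mono[of "y * real d - 1" "real (obs d y)" "real d"]
    by (simp_all add: divide_le_eq diff_divide_distrib)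
qed

lemma arm_mean_bounds: "i < K \<Longrightarrow> 0 \<le> arm_mean (D i)" "i < K \<Longrightarrow> arm_mean (D i) \<le> 1"
  and integrable_id: "i < K \<Longrightarrow> integrable (D i) (\<lambda>y. y)"
proof -
  assume i: "i < K"
  interpret prob_space "D i" using i by (rule prob_D)
  have m: "(\<lambda>y. y) \<in> borel_measurable (D i)" using sets_D[OF i] by (simp cong: measurable_cong_sets)
  show int: "integrable (D i) (\<lambda>y. y)"
    by (rule integrable_const_bound[of _ 1]) (rule eventually_mono[OF AE_D[OF i]], use m in auto)
  show "0 \<le> arm_mean (D i)" unfolding arm_mean_def
    by (rule integral_nonneg_AE) (rule eventually_mono[OF AE_D[OF i]], auto)
  show "arm_mean (D i) \<le> 1" unfolding arm_mean_def
    using integral_mono_AE[OF int integrable_const[of 1] eventually_mono[OF AE_D[OF i]]] prob_space by auto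
qed

text \<open>Hoeffding's lemma needs a positive parameter, so the sign \<open>s\<close> handles both
  tails. It applies to the rounded reward around its own mean, which is within \<open>1 / d\<close>
  of the true one; this yields the summand \<open>l / d\<close>.\<close>

lemma mgf_pos:
  assumes i: "i < K" and d: "0 < d" and l: "0 < l" and s: "s = 1 \<or> s = - 1"
  shows "(\<Sum>r\<le>d. pw i d r * exp (l * (s * (real r / real d - arm_mean (D i))))) \<le> exp (l\<^sup>2 / 8 + l / real d)"
proof -
  interpret prob_space "D i" using i by (rule prob_D)
  let ?f = "\<lambda>y. s * (real (clip d y) / real d)"
  let ?\<mu> = "arm_mean (D i)"
  have mf: "random_variable borel ?f"
    using integral_clip(2)[OF i, of "\<lambda>r. s * (real r / real d)" d] by (rule borel_measurable_integrable)
  have b: "?f y \<in> {min s 0..max s 0}" for y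
    using s d by (auto simp: clip_def divide_le_eq_1)
  interpret h: interval_bounded_random_variable "D i" ?f "min s 0" "max s 0"
    by unfold_locales (use mf b in auto)
  have E: "\<bar>expectation ?f - s * ?\<mu>\<bar> \<le> 1 / real d"
  proof -
    have intc: "integrable (D i) (\<lambda>y. real (clip d y) / real d)" by (rule integral_clip(2)[OF i])
    have "expectation (\<lambda>y. real (clip d y) / real d) \<le> ?\<mu>" unfolding arm_mean_def
      by (rule integral_mono_AE[OF intc integrable_id[OF i]])
        (rule eventually_mono[OF AE_D[OF i]], rule clip_close(1)[OF _ d])
    moreover have "?\<mu> - 1 / real d \<le> expectation (\<lambda>y. real (clip d y) / real d)"
    proof -
      have "?\<mu> - 1 / real d = expectation (\<lambda>y. y - 1 / real d)"
        unfolding arm_mean_def using integrable_id[OF i] prob_space by simp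
      also have "\<dots> \<le> expectation (\<lambda>y. real (clip d y) / real d)"
        using integrable_id[OF i]
        by (intro integral_mono_AE[OF _ intc] eventually_mono[OF AE_D[OF i]] clip_close(2)[OF _ d]) auto
      finally show ?thesis .
    qed
    ultimately show ?thesis using s by auto
  qed
  have "(\<Sum>r\<le>d. pw i d r * exp (l * (s * (real r / real d - ?\<mu>))))
      = exp (l * (expectation ?f - s * ?\<mu>)) * (\<Sum>r\<le>d. pw i d r * exp (l * (s * (real r / real d) - expectation ?f)))"
    by (simp add: sum_distrib_left algebra_simps flip: exp_add)
  also have "(\<Sum>r\<le>d. pw i d r * exp (l * (s * (real r / real d) - expectation ?f)))
      = expectation (\<lambda>y. exp (l * (?f y - expectation ?f)))"
    by (rule integral_clip(1)[OF i, symmetric])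
  also have "\<dots> \<le> exp (l\<^sup>2 / 8)"
  proof -
    have "ennreal (expectation (\<lambda>y. exp (l * (?f y - expectation ?f))))
      = (\<integral>\<^sup>+ y. ennreal (exp (l * (?f y - expectation ?f))) \<partial>D i)"
      by (rule nn_integral_eq_integral[symmetric])
        (use integral_clip(2)[OF i, of "\<lambda>r. exp (l * (s * (real r / real d) - expectation ?f))" d] in auto)
    also have "\<dots> \<le> ennreal (exp (l\<^sup>2 * (max s 0 - min s 0)\<^sup>2 / 8))"
      using h.Hoeffdings_lemma_nn_integral[OF l] by simp
    also have "(max s 0 - min s 0)\<^sup>2 = 1" using s by auto
    finally show ?thesis by (simp add: ennreal_le_iff)
  qed
  finally have "(\<Sum>r\<le>d. pw i d r * exp (l * (s * (real r / real d - ?\<mu>))))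
    \<le> exp (l * (expectation ?f - s * ?\<mu>)) * exp (l\<^sup>2 / 8)" by (simp add: mult_left_mono)
  also have "\<dots> \<le> exp (l * (1 / real d)) * exp (l\<^sup>2 / 8)"
    using abs_le_D1[OF E] l by (simp only: exp_le_cancel_iff mult_right_mono exp_ge_zero mult_left_mono less_imp_le)
  also have "\<dots> = exp (l\<^sup>2 / 8 + l / real d)" by (simp add: exp_add)
  finally show ?thesis .
qed

sublocale arm_model K "\<lambda>i. arm_mean (D i)" pw
proof
  fix a d r l
  assume a: "a < K"
  interpret prob_space "D a" using a by (rule prob_D)
  show "0 \<le> arm_mean (D a)" "arm_mean (D a) \<le> 1" using a by (rule arm_mean_bounds)+
  show "0 \<le> pw a d r" by (simp add: pw_def)
  show "(\<Sum>r\<le>d. pw a d r) = 1" using integral_clip(1)[OF a, of "\<lambda>_. 1" d] prob_space by simp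
  assume d: "0 < d"
  show "(\<Sum>r\<le>d. pw a d r * exp (l * (real r / real d - arm_mean (D a)))) \<le> exp (l\<^sup>2 / 8 + \<bar>l\<bar> / real d)"
  proof -
    consider "0 < l" | "l < 0" | "l = 0" by linarith
    then show ?thesis
    proof cases
      case 1
      then show ?thesis using mgf_pos[OF a d, of l 1] by simp
    next
      case 2
      then show ?thesis using mgf_pos[OF a d, of "- l" "- 1"] by (simp add: right_diff_distrib)
    next
      case 3
      then show ?thesis using integral_clip(1)[OF a, of "\<lambda>_. 1" d] prob_space by simp
    qed
  qed
qed (rule K_pos)

end

section \<open>The law of the chain under a random reward table\<close>

context bandit
begin

abbreviation "index \<equiv> {..<K} \<times> (UNIV :: nat set)"
abbreviation "arm_dist \<equiv> (\<lambda>(i, t :: nat). D i)"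
abbreviation "table \<equiv> PiM index arm_dist"
abbreviation "state \<equiv> chain K clip"

lemma prob_arm_dist: "j \<in> index \<Longrightarrow> prob_space (arm_dist j)"
  and sets_arm_dist: "j \<in> index \<Longrightarrow> sets (arm_dist j) = sets borel"
  using prob_D sets_D by auto

sublocale table: prob_space table
  by (rule prob_space_PiM[OF prob_arm_dist])

lemma state_measurable [measurable]: "(\<lambda>x. state x t) \<in> table \<rightarrow>\<^sub>M count_space UNIV"
  by (rule chain_measurable[OF sets_arm_dist clip_measurable])

lemma entry_measurable [measurable]: "(\<lambda>x. x j) \<in> table \<rightarrow>\<^sub>M borel"
  by (rule component_measurable[OF sets_arm_dist])

lemma indep_entries: "table.indep_vars arm_dist (\<lambda>j x. x j) index"
proof -
  have "distr table (PiM index arm_dist) (\<lambda>x. \<lambda>j\<in>index. x j) = distr table table (\<lambda>x. x)"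
    by (rule distr_cong) (auto simp: space_PiM extensional_restrict PiE_def)
  also have "\<dots> = PiM index arm_dist" by simp
  also have "\<dots> = PiM index (\<lambda>j. distr table (arm_dist j) (\<lambda>x. x j))"
    by (intro PiM_cong refl distr_PiM_component[symmetric] prob_arm_dist)
  finally show ?thesis
    using K_pos by (subst table.indep_vars_iff_distr_eq_PiM') (auto intro!: measurable_component_singleton)
qed

definition law :: "nat \<Rightarrow> chain_state \<Rightarrow> real" where
  "law t \<sigma> = (\<integral>x. of_bool (state x t = \<sigma>) \<partial>table)"

lemma integral_entry:
  fixes h :: "real \<Rightarrow> real"
  assumes "a < K" and h: "h \<in> borel_measurable borel" "integrable (D a) h"
  shows "(\<integral>x. h (x (a, t)) \<partial>table) = (\<integral>y. h y \<partial>D a)" "integrable table (\<lambda>x. h (x (a, t)))"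
proof -
  have j: "(a, t) \<in> index" using assms by simp
  have d: "distr table (D a) (\<lambda>x. x (a, t)) = D a"
    using distr_PiM_component[of index arm_dist, OF prob_arm_dist j] by simp
  have m: "(\<lambda>x. x (a, t)) \<in> table \<rightarrow>\<^sub>M D a"
    using measurable_component_singleton[OF j, of arm_dist] by simp
  have hm: "h \<in> borel_measurable (D a)" using h(1) sets_D[OF assms(1)] by (simp cong: measurable_cong_sets)
  show "(\<integral>x. h (x (a, t)) \<partial>table) = (\<integral>y. h y \<partial>D a)"
    using integral_distr[OF m hm] d by simp
  show "integrable table (\<lambda>x. h (x (a, t)))"
    using integrable_distr_eq[OF m hm] d h(2) by simp
qed

text \<open>The two factors are functions of the disjoint index sets
  \<open>{..<K} \<times> {..<t}\<close> and \<open>{(a, t)}\<close> of independent entries.\<close>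

lemma joint:
  fixes h :: "real \<Rightarrow> real"
  assumes a: "a < K" and h: "h \<in> borel_measurable borel" "integrable (D a) h"
  shows "(\<integral>x. of_bool (state x t = \<sigma>) * h (x (a, t)) \<partial>table) = law t \<sigma> * (\<integral>y. h y \<partial>D a)"
    and "integrable table (\<lambda>x. of_bool (state x t = \<sigma>) * h (x (a, t)) :: real)"
proof -
  let ?J = "{..<K} \<times> {..<t}" and ?j = "{(a, t)}"
  have iv: "table.indep_var (PiM ?J arm_dist) (\<lambda>x. restrict x ?J) (PiM ?j arm_dist) (\<lambda>x. restrict x ?j)"
    by (rule table.indep_var_restrict[OF indep_entries]) (use a in auto)
  have sJ: "\<And>j. j \<in> ?J \<Longrightarrow> sets (arm_dist j) = sets borel" using sets_D by auto
  have sj: "\<And>j. j \<in> ?j \<Longrightarrow> sets (arm_dist j) = sets borel" using sets_D a by auto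
  have m1: "(\<lambda>x. of_bool (state x t = \<sigma>) :: real) \<in> borel_measurable (PiM ?J arm_dist)"
    by (rule measurable_compose[OF chain_measurable[OF sJ clip_measurable]]) auto
  have m2: "(\<lambda>x. h (x (a, t))) \<in> borel_measurable (PiM ?j arm_dist)"
    by (rule measurable_compose[OF component_measurable[OF sj] h(1)])
  have "table.indep_var borel ((\<lambda>x. of_bool (state x t = \<sigma>) :: real) \<circ> (\<lambda>x. restrict x ?J))
      borel ((\<lambda>x. h (x (a, t))) \<circ> (\<lambda>x. restrict x ?j))"
    by (rule table.indep_var_compose[OF iv m1 m2])
  moreover have "state (restrict x ?J) t = state x t" for x
    by (rule chain_cong[OF K_pos]) auto
  ultimately have iv: "table.indep_var borel (\<lambda>x. of_bool (state x t = \<sigma>) :: real) borel (\<lambda>x. h (x (a, t)))"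
    by (simp add: comp_def)
  have i1: "integrable table (\<lambda>x. of_bool (state x t = \<sigma>) :: real)"
    by (rule table.integrable_const_bound[of _ 1]) auto
  show "(\<integral>x. of_bool (state x t = \<sigma>) * h (x (a, t)) \<partial>table) = law t \<sigma> * (\<integral>y. h y \<partial>D a)"
    using table.indep_var_lebesgue_integral[OF iv i1 integral_entry(2)[OF assms]] integral_entry(1)[OF assms]
    by (simp add: law_def)
  show "integrable table (\<lambda>x. of_bool (state x t = \<sigma>) * h (x (a, t)) :: real)"
    by (rule table.indep_var_integrable[OF iv i1 integral_entry(2)[OF assms]])
qed

text \<open>Finite thanks to \<open>clip\<close>, so that expectations over the state become finite
  sums without any integrability question.\<close>

fun reachable :: "nat \<Rightarrow> chain_state set" where
  "reachable 0 = {(64, 0, start, 0, 0)}"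
| "reachable (Suc t) = (\<Union>\<sigma>\<in>reachable t. chain_next K \<sigma> ` {..chain_res \<sigma>})"

lemma finite_reachable [simp]: "finite (reachable t)"
  by (induction t) auto

lemma state_reachable: "state x t \<in> reachable t"
proof (induction t)
  case (Suc t)
  have "clip d y \<in> {..d}" for d y by (simp add: clip_def)
  then show ?case unfolding chain.simps reachable.simps by (intro UN_I[OF Suc] imageI)
qed simp

lemma reachable_arm: "\<sigma> \<in> reachable t \<Longrightarrow> chain_arm \<sigma> < K"
proof -
  have "\<sigma> \<in> reachable t \<Longrightarrow> chain_ok K \<sigma>"
  proof (induction t arbitrary: \<sigma>)
    case (Suc t)
    then obtain \<tau> r where "\<tau> \<in> reachable t" "\<sigma> = chain_next K \<tau> r" by auto
    then show ?case using chain_ok_next[OF K_pos Suc.IH] by simp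
  qed (simp add: K_pos)
  then show "\<sigma> \<in> reachable t \<Longrightarrow> chain_arm \<sigma> < K" by (cases \<sigma>) (auto intro: valid_arm)
qed

lemma integral_step:
  assumes G: "\<And>\<sigma>. \<sigma> \<in> reachable t \<Longrightarrow> G \<sigma> \<in> borel_measurable borel"
      "\<And>\<sigma>. \<sigma> \<in> reachable t \<Longrightarrow> integrable (D (chain_arm \<sigma>)) (G \<sigma>)"
  shows "(\<integral>x. G (state x t) (x (chain_arm (state x t), t)) \<partial>table)
      = (\<Sum>\<sigma>\<in>reachable t. law t \<sigma> * (\<integral>y. G \<sigma> y \<partial>D (chain_arm \<sigma>)))"
    and "integrable table (\<lambda>x. G (state x t) (x (chain_arm (state x t), t)) :: real)"
proof -
  have eq: "G (state x t) (x (chain_arm (state x t), t))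
    = (\<Sum>\<sigma>\<in>reachable t. of_bool (state x t = \<sigma>) * G \<sigma> (x (chain_arm \<sigma>, t)))" for x
  proof -
    have "(\<Sum>\<sigma>\<in>reachable t. of_bool (state x t = \<sigma>) * G \<sigma> (x (chain_arm \<sigma>, t)))
      = (\<Sum>\<sigma>\<in>{state x t}. G \<sigma> (x (chain_arm \<sigma>, t)))"
      by (rule sum.mono_neutral_cong_right) (auto simp: state_reachable)
    then show ?thesis by simp
  qed
  have int: "integrable table (\<lambda>x. of_bool (state x t = \<sigma>) * G \<sigma> (x (chain_arm \<sigma>, t)))" if "\<sigma> \<in> reachable t" for \<sigma>
    using joint(2)[OF reachable_arm[OF that] G[OF that]] .
  show "integrable table (\<lambda>x. G (state x t) (x (chain_arm (state x t), t)))"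
    unfolding eq by (intro Bochner_Integration.integrable_sum int)
  show "(\<integral>x. G (state x t) (x (chain_arm (state x t), t)) \<partial>table)
      = (\<Sum>\<sigma>\<in>reachable t. law t \<sigma> * (\<integral>y. G \<sigma> y \<partial>D (chain_arm \<sigma>)))"
    unfolding eq using joint(1)[OF reachable_arm G]
    by (subst Bochner_Integration.integral_sum) (auto intro!: int sum.cong)
qed

lemma integral_state:
  "(\<integral>x. F (state x t) \<partial>table) = (\<Sum>\<sigma>\<in>reachable t. law t \<sigma> * F \<sigma>)" "integrable table (\<lambda>x. F (state x t) :: real)"
proof -
  have c: "integrable (D (chain_arm \<sigma>)) (\<lambda>_. F \<sigma>)" "(\<integral>y. F \<sigma> \<partial>D (chain_arm \<sigma>)) = F \<sigma>"
    if "\<sigma> \<in> reachable t" for \<sigma>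
  proof -
    interpret prob_space "D (chain_arm \<sigma>)" using reachable_arm[OF that] by (rule prob_D)
    show "integrable (D (chain_arm \<sigma>)) (\<lambda>_. F \<sigma>)" "(\<integral>y. F \<sigma> \<partial>D (chain_arm \<sigma>)) = F \<sigma>"
      using prob_space by auto
  qed
  have m: "(\<lambda>_. F \<sigma>) \<in> borel_measurable borel" for \<sigma> by simp
  have "(\<integral>x. F (state x t) \<partial>table) = (\<Sum>\<sigma>\<in>reachable t. law t \<sigma> * (\<integral>y. F \<sigma> \<partial>D (chain_arm \<sigma>)))"
    by (rule integral_step(1)[of t "\<lambda>\<sigma> _. F \<sigma>", OF m c(1)])
  also have "\<dots> = (\<Sum>\<sigma>\<in>reachable t. law t \<sigma> * F \<sigma>)"
    by (intro sum.cong refl arg_cong2[where f = "(*)"] c(2))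
  finally show "(\<integral>x. F (state x t) \<partial>table) = (\<Sum>\<sigma>\<in>reachable t. law t \<sigma> * F \<sigma>)" .
  show "integrable table (\<lambda>x. F (state x t))"
    by (rule integral_step(2)[of t "\<lambda>\<sigma> _. F \<sigma>", OF m c(1)])
qed

text \<open>The Markov property, in the form that matches one unfolding of
  \<open>rg\<close>.\<close>

lemma integral_Suc:
  "(\<integral>x. F (state x (Suc t)) \<partial>table) = (\<integral>x. (\<Sum>r\<le>chain_res (state x t).
     pw (chain_arm (state x t)) (chain_res (state x t)) r * F (chain_next K (state x t) r)) \<partial>table)"
proof -
  have m: "(\<lambda>y. F (chain_next K \<sigma> (clip (chain_res \<sigma>) y))) \<in> borel_measurable borel" for \<sigma>
    by (rule measurable_compose[OF clip_measurable]) auto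
  have "(\<integral>x. F (state x (Suc t)) \<partial>table)
    = (\<Sum>\<sigma>\<in>reachable t. law t \<sigma> * (\<integral>y. F (chain_next K \<sigma> (clip (chain_res \<sigma>) y)) \<partial>D (chain_arm \<sigma>)))"
    using integral_step(1)[of t "\<lambda>\<sigma> y. F (chain_next K \<sigma> (clip (chain_res \<sigma>) y))", OF m]
      integral_clip(2)[OF reachable_arm, of _ t "\<lambda>r. F (chain_next K _ r)"] by simp
  also have "\<dots> = (\<Sum>\<sigma>\<in>reachable t. law t \<sigma> * (\<Sum>r\<le>chain_res \<sigma>.
     pw (chain_arm \<sigma>) (chain_res \<sigma>) r * F (chain_next K \<sigma> r)))"
    by (intro sum.cong refl arg_cong2[where f = "(*)"] integral_clip(1)[where g = "\<lambda>r. F (chain_next K _ r)"] reachable_arm)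
  also have "\<dots> = (\<integral>x. (\<Sum>r\<le>chain_res (state x t).
     pw (chain_arm (state x t)) (chain_res (state x t)) r * F (chain_next K (state x t) r)) \<partial>table)"
    by (rule integral_state(1)[symmetric])
  finally show ?thesis .
qed

lemma sum_gp_eq_rg:
  "(\<Sum>t<T. \<integral>x. gp (chain_arm (state x (t0 + t))) \<partial>table) = (\<integral>x. rg T (state x t0) \<partial>table)"
proof (induction T arbitrary: t0)
  case (Suc T)
  have "(\<Sum>t<Suc T. \<integral>x. gp (chain_arm (state x (t0 + t))) \<partial>table)
    = (\<integral>x. gp (chain_arm (state x t0)) \<partial>table) + (\<Sum>t<T. \<integral>x. gp (chain_arm (state x (Suc t0 + t))) \<partial>table)"
    by (simp add: sum.lessThan_Suc_shift del: sum.lessThan_Suc)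
  also have "\<dots> = (\<integral>x. gp (chain_arm (state x t0)) \<partial>table) + (\<integral>x. rg T (state x (Suc t0)) \<partial>table)"
    unfolding Suc.IH ..
  also have "\<dots> = (\<integral>x. rg (Suc T) (state x t0) \<partial>table)"
    unfolding integral_Suc rg.simps
    by (rule Bochner_Integration.integral_add[symmetric]; rule integral_state)
  finally show ?case .
qed simp

lemma AE_table: "AE x in table. \<forall>i<K. \<forall>t. x (i, t) \<in> {0..1}"
proof -
  have "AE x in table. x (i, t) \<in> {0..1}" if "i < K" for i t
  proof -
    have "AE y in arm_dist (i, t). y \<in> {0..1}" unfolding prod.case by (rule AE_D[OF that])
    moreover have "(i, t) \<in> index" using that by simp
    ultimately show ?thesis
      by (intro AE_PiM_component[where I = index and M = arm_dist and i = "(i, t)" and P = "\<lambda>y. y \<in> {0..1}"] prob_arm_dist)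
  qed
  then have "AE x in table. i < K \<longrightarrow> x (i, t) \<in> {0..1}" for i t by (cases "i < K") simp_all
  then have "AE x in table. \<forall>i t. i < K \<longrightarrow> x (i, t) \<in> {0..1}" by (simp only: AE_all_countable) blast
  then show ?thesis by (rule eventually_mono) blast
qed

lemma clip_eq_obs: "y \<in> {0..1} \<Longrightarrow> clip d y = obs d y"
proof -
  assume "y \<in> {0..1}"
  then have "y * real d \<le> real d" using mult_right_mono[of y 1 "real d"] by simp
  then have "obs d y \<le> d" unfolding obs_def by linarith
  then show ?thesis by (simp add: clip_def)
qed

lemma state_eq_obs: "\<forall>i<K. \<forall>t. x (i, t) \<in> {0..1} \<Longrightarrow> chain K obs x t = state x t"
  using chain_arm_less[OF K_pos, of clip x] clip_eq_obs by (induction t) auto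

text \<open>The program draws no random bits, so the second factor of the space integrates
  out.\<close>

lemma integral_fst:
  fixes f :: "(nat \<times> nat \<Rightarrow> real) \<Rightarrow> real"
  assumes f: "f \<in> borel_measurable table"
  shows "(\<integral>(x, u). f x \<partial>bandit_space K D) = (\<integral>x. f x \<partial>table)"
proof -
  let ?U = "\<Pi>\<^sub>M n\<in>(UNIV :: nat set). measure_pmf (bernoulli_pmf (1 / 2))"
  have "prob_space ?U" by (intro prob_space_PiM measure_pmf.prob_space_axioms)
  then have "distr (table \<Otimes>\<^sub>M ?U) table fst = table" by (rule prob_space.distr_pair_fst)
  then have "(\<integral>x. f x \<partial>table) = (\<integral>z. f (fst z) \<partial>(table \<Otimes>\<^sub>M ?U))"
    using integral_distr[OF measurable_fst f, of ?U] by simp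
  then show ?thesis by (simp add: bandit_space_def case_prod_unfold)
qed

text \<open>The played total does not depend on \<open>i\<close>, so the maximum is attained at a
  best arm. The real chain uses \<open>obs\<close>, the analysed one \<open>clip\<close>; they agree
  almost everywhere.\<close>

theorem pseudo_regret_eq_rg:
  assumes ch: "\<And>x u t. chosen_arm P K x u t = chain_arm (chain K obs x t)"
  shows "pseudo_regret P K D T = rg T (64, 0, start, 0, 0)"
proof -
  let ?\<mu> = "\<lambda>i. arm_mean (D i)"
  have m: "(\<lambda>x. x (chain_arm (chain K obs x t), t)) \<in> borel_measurable table" for t
    by (rule measurable_compose_countable[OF entry_measurable
          chain_measurable[OF sets_arm_dist obs_measurable], of "\<lambda>\<sigma>. (chain_arm \<sigma>, t)", simplified])
  have chain_int: "(\<integral>x. x (chain_arm (chain K obs x t), t) \<partial>table) = (\<integral>x. ?\<mu> (chain_arm (state x t)) \<partial>table)"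
    "integrable table (\<lambda>x. x (chain_arm (chain K obs x t), t))" for t
  proof -
    have ae: "AE x in table. x (chain_arm (chain K obs x t), t) = x (chain_arm (state x t), t)"
      using AE_table by eventually_elim (simp add: state_eq_obs)
    have m': "(\<lambda>x. x (chain_arm (state x t), t)) \<in> borel_measurable table"
      by (rule measurable_compose_countable[OF entry_measurable state_measurable, of "\<lambda>\<sigma>. (chain_arm \<sigma>, t)"])
    have "(\<integral>x. x (chain_arm (chain K obs x t), t) \<partial>table) = (\<integral>x. x (chain_arm (state x t), t) \<partial>table)"
      by (rule integral_cong_AE[OF m m' ae])
    also have "\<dots> = (\<Sum>\<sigma>\<in>reachable t. law t \<sigma> * ?\<mu> (chain_arm \<sigma>))"
      unfolding arm_mean_def by (rule integral_step(1)[of t "\<lambda>_ y. y"]) (auto intro: integrable_id reachable_arm)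
    also have "\<dots> = (\<integral>x. ?\<mu> (chain_arm (state x t)) \<partial>table)" by (rule integral_state(1)[symmetric])
    finally show "(\<integral>x. x (chain_arm (chain K obs x t), t) \<partial>table) = (\<integral>x. ?\<mu> (chain_arm (state x t)) \<partial>table)" .
    have "integrable table (\<lambda>x. x (chain_arm (state x t), t))"
      by (rule integral_step(2)[of t "\<lambda>_ y. y"]) (auto intro: integrable_id reachable_arm)
    then show "integrable table (\<lambda>x. x (chain_arm (chain K obs x t), t))"
      using integrable_cong_AE[OF m m' ae] by simp
  qed
  have fixed: "(\<integral>(x, u). (\<Sum>t<T. x (i, t)) \<partial>bandit_space K D) = real T * ?\<mu> i" if i: "i < K" for i
  proof -
    have e: "(\<integral>x. x (i, t) \<partial>table) = ?\<mu> i" "integrable table (\<lambda>x. x (i, t))" for t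
      unfolding arm_mean_def using integral_entry[OF i measurable_ident_sets[OF refl] integrable_id[OF i]] by auto
    have "(\<integral>(x, u). (\<Sum>t<T. x (i, t)) \<partial>bandit_space K D) = (\<integral>x. (\<Sum>t<T. x (i, t)) \<partial>table)"
      by (intro integral_fst borel_measurable_sum entry_measurable)
    also have "\<dots> = (\<Sum>t<T. \<integral>x. x (i, t) \<partial>table)"
      by (intro Bochner_Integration.integral_sum e)
    finally show ?thesis unfolding e by simp
  qed
  define c where "c = (\<Sum>t<T. \<integral>x. ?\<mu> (chain_arm (state x t)) \<partial>table)"
  have played: "(\<integral>(x, u). (\<Sum>t<T. x (chosen_arm P K x u t, t)) \<partial>bandit_space K D) = c"
  proof -
    have "(\<integral>(x, u). (\<Sum>t<T. x (chosen_arm P K x u t, t)) \<partial>bandit_space K D)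
      = (\<integral>x. (\<Sum>t<T. x (chain_arm (chain K obs x t), t)) \<partial>table)"
      unfolding ch by (rule integral_fst) (intro borel_measurable_sum m)
    also have "\<dots> = c"
      unfolding c_def chain_int(1)[symmetric] by (intro Bochner_Integration.integral_sum chain_int(2))
    finally show ?thesis .
  qed
  have "pseudo_regret P K D T = (MAX i\<in>{..<K}. real T * ?\<mu> i - c)"
    unfolding pseudo_regret_def played
    by (intro arg_cong[where f = Max] image_cong refl) (simp add: fixed)
  also have "\<dots> = real T * best - c"
  proof (rule Max_eqI)
    have "best \<in> ?\<mu> ` {..<K}" unfolding best_def using K_pos by (intro Max_in) auto
    then show "real T * best - c \<in> (\<lambda>i. real T * ?\<mu> i - c) ` {..<K}" by auto
    fix v assume "v \<in> (\<lambda>i. real T * ?\<mu> i - c) ` {..<K}"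
    then obtain i where "i < K" "v = real T * ?\<mu> i - c" by auto
    moreover have "?\<mu> i \<le> best" using \<open>i < K\<close> gp_nonneg[of i] by (simp add: gp_def)
    ultimately show "v \<le> real T * best - c" by (simp add: mult_left_mono)
  qed simp
  also have "\<dots> = (\<Sum>t<T. \<integral>x. gp (chain_arm (state x t)) \<partial>table)"
  proof -
    have "(\<integral>x. gp (chain_arm (state x t)) \<partial>table) = best - (\<integral>x. ?\<mu> (chain_arm (state x t)) \<partial>table)" for t
      unfolding gp_def using integral_state(2)[of "\<lambda>\<sigma>. ?\<mu> (chain_arm \<sigma>)" t] table.prob_space by simp
    then show ?thesis by (simp add: c_def sum_subtractf)
  qed
  also have "\<dots> = rg T (64, 0, start, 0, 0)"
    using sum_gp_eq_rg[of 0 T] table.prob_space by simp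
  finally show ?thesis .
qed

end

section \<open>The program\<close>

text \<open>
  \<open>JumpLess (Imm 0) (Imm 1) l\<close> is an unconditional jump. The entry points are 2 (new epoch),
  8 (reference block), 19 (first block of a test), 23 (next block of a test), 37 (pull), 49 (next arm),
  54 (end of a test block), 88 (rejection), 95 (next \<open>e\<close>) and 110 (next \<open>y\<close>). The scratch registers
  are cleared before 37, so that there the memory is determined by the state of the chain. No square root
  is computed: \<open>conf E e\<close> changes by at most 1 in each update, which is done at 100.
\<close>

definition prog :: program where
  "prog = [
   Add 1 (Imm 18446744073709551616) (Imm 0),
   Add 2 (Imm 64) (Imm 0),
   Add 3 (Imm 0) (Imm 0),
   Add 4 (Imm 1) (Imm 0),
   Add 18 (Imm 0) (Imm 0),
   Add 5 (Imm 0) (Imm 0),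
   Add 6 (Imm 0) (Imm 0),
   Add 7 (Imm 0) (Imm 0),
   Add 16 (Reg 5) (Imm 0),
   Add 17 (Imm 0) (Imm 0),
   Mul 13 (Reg 4) (Reg 4),
   Mul 13 (Reg 13) (Reg 2),
   Mul 13 (Reg 13) (Imm 512),
   Add 8 (Imm 0) (Imm 0),
   Add 9 (Imm 0) (Imm 0),
   Add 10 (Imm 0) (Imm 0),
   Add 11 (Imm 0) (Imm 0),
   Add 12 (Imm 0) (Imm 0),
   JumpLess (Imm 0) (Imm 1) 30,
   Add 9 (Imm 1) (Imm 0),
   Add 10 (Imm 0) (Imm 0),
   Add 11 (Imm 1) (Imm 0),
   Add 12 (Imm 1) (Imm 0),
   Add 16 (Reg 7) (Imm 0),
   Add 17 (Imm 1) (Imm 0),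
   Mul 13 (Reg 9) (Reg 9),
   Mul 13 (Reg 13) (Reg 12),
   Mul 20 (Reg 11) (Reg 11),
   Mul 13 (Reg 13) (Reg 20),
   Mul 13 (Reg 13) (Imm 512),
   Add 14 (Imm 0) (Imm 0),
   Add 15 (Imm 0) (Imm 0),
   Add 20 (Imm 0) (Imm 0),
   Add 21 (Imm 0) (Imm 0),
   Add 22 (Imm 0) (Imm 0),
   Add 23 (Imm 0) (Imm 0),
   Add 24 (Imm 0) (Imm 0),
   Pull 19 (Reg 16) (Reg 1),
   Add 15 (Reg 15) (Reg 19),
   Add 19 (Imm 0) (Imm 0),
   Add 14 (Reg 14) (Imm 1),
   Add 3 (Reg 3) (Imm 1),
   JumpLess (Reg 3) (Reg 1) 46,
   Add 2 (Reg 2) (Reg 2),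
   Mul 1 (Reg 1) (Reg 1),
   JumpLess (Imm 0) (Imm 1) 2,
   JumpLess (Reg 14) (Reg 13) 37,
   JumpLess (Imm 0) (Reg 17) 54,
   Add 8 (Reg 15) (Imm 0),
   JumpLess (Reg 7) (Reg 0) 19,
   Add 4 (Reg 4) (Reg 4),
   Add 18 (Reg 18) (Imm 1),
   Add 7 (Imm 0) (Imm 0),
   JumpLess (Imm 0) (Imm 1) 8,
   Mul 20 (Reg 4) (Reg 4),
   Mul 20 (Reg 20) (Reg 2),
   Mul 20 (Reg 20) (Imm 512),
   Mul 21 (Reg 15) (Reg 20),
   Mul 21 (Reg 21) (Reg 11),
   Div 22 (Reg 1) (Reg 9),
   Add 23 (Reg 11) (Reg 11),
   Sub 23 (Reg 23) (Imm 1),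
   Mul 22 (Reg 22) (Reg 23),
   Mul 22 (Reg 22) (Reg 13),
   Mul 22 (Reg 22) (Reg 20),
   Add 21 (Reg 21) (Reg 22),
   Mul 22 (Reg 8) (Reg 13),
   Mul 22 (Reg 22) (Reg 11),
   JumpLess (Reg 21) (Reg 22) 88,
   JumpLess (Reg 10) (Reg 18) 71,
   JumpLess (Imm 0) (Imm 1) 73,
   Add 24 (Reg 6) (Imm 3),
   JumpLess (Reg 10) (Reg 24) 95,
   Mul 21 (Reg 11) (Reg 11),
   JumpLess (Reg 21) (Reg 2) 110,
   JumpLess (Reg 10) (Reg 18) 95,
   Mul 21 (Reg 15) (Reg 20),
   Div 22 (Reg 1) (Reg 4),
   Mul 22 (Reg 22) (Reg 13),
   Mul 22 (Reg 22) (Reg 20),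
   Mul 23 (Reg 8) (Reg 13),
   Add 22 (Reg 22) (Reg 23),
   JumpLess (Reg 22) (Reg 21) 85,
   Add 7 (Reg 7) (Imm 1),
   JumpLess (Imm 0) (Imm 1) 49,
   Add 5 (Reg 7) (Imm 0),
   Add 7 (Reg 7) (Imm 1),
   JumpLess (Imm 0) (Imm 1) 8,
   Add 7 (Reg 7) (Imm 1),
   Mul 21 (Reg 11) (Reg 11),
   JumpLess (Reg 21) (Reg 2) 49,
   JumpLess (Reg 6) (Reg 10) 93,
   JumpLess (Imm 0) (Imm 1) 49,
   Add 6 (Reg 10) (Imm 0),
   JumpLess (Imm 0) (Imm 1) 49,
   Add 10 (Reg 10) (Imm 1),
   Add 9 (Reg 9) (Reg 9),
   Sub 20 (Reg 6) (Reg 10),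
   JumpLess (Reg 20) (Reg 10) 100,
   Add 20 (Reg 10) (Imm 0),
   Mul 21 (Reg 12) (Reg 12),
   JumpLess (Reg 20) (Reg 21) 104,
   Add 12 (Reg 12) (Imm 1),
   JumpLess (Imm 0) (Imm 1) 23,
   Sub 21 (Reg 12) (Imm 1),
   Mul 22 (Reg 21) (Reg 21),
   JumpLess (Reg 20) (Reg 22) 108,
   JumpLess (Imm 0) (Imm 1) 23,
   Sub 12 (Reg 12) (Imm 1),
   JumpLess (Imm 0) (Imm 1) 23,
   Add 11 (Reg 11) (Reg 11),
   JumpLess (Imm 0) (Imm 1) 23
   ]"

lemma prog_nth:
  "prog ! 0 = Add 1 (Imm 18446744073709551616) (Imm 0)"
  "prog ! 1 = Add 2 (Imm 64) (Imm 0)"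
  "prog ! 2 = Add 3 (Imm 0) (Imm 0)"
  "prog ! 3 = Add 4 (Imm 1) (Imm 0)"
  "prog ! 4 = Add 18 (Imm 0) (Imm 0)"
  "prog ! 5 = Add 5 (Imm 0) (Imm 0)"
  "prog ! 6 = Add 6 (Imm 0) (Imm 0)"
  "prog ! 7 = Add 7 (Imm 0) (Imm 0)"
  "prog ! 8 = Add 16 (Reg 5) (Imm 0)"
  "prog ! 9 = Add 17 (Imm 0) (Imm 0)"
  "prog ! 10 = Mul 13 (Reg 4) (Reg 4)"
  "prog ! 11 = Mul 13 (Reg 13) (Reg 2)"
  "prog ! 12 = Mul 13 (Reg 13) (Imm 512)"
  "prog ! 13 = Add 8 (Imm 0) (Imm 0)"
  "prog ! 14 = Add 9 (Imm 0) (Imm 0)"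
  "prog ! 15 = Add 10 (Imm 0) (Imm 0)"
  "prog ! 16 = Add 11 (Imm 0) (Imm 0)"
  "prog ! 17 = Add 12 (Imm 0) (Imm 0)"
  "prog ! 18 = JumpLess (Imm 0) (Imm 1) 30"
  "prog ! 19 = Add 9 (Imm 1) (Imm 0)"
  "prog ! 20 = Add 10 (Imm 0) (Imm 0)"
  "prog ! 21 = Add 11 (Imm 1) (Imm 0)"
  "prog ! 22 = Add 12 (Imm 1) (Imm 0)"
  "prog ! 23 = Add 16 (Reg 7) (Imm 0)"
  "prog ! 24 = Add 17 (Imm 1) (Imm 0)"
  "prog ! 25 = Mul 13 (Reg 9) (Reg 9)"
  "prog ! 26 = Mul 13 (Reg 13) (Reg 12)"
  "prog ! 27 = Mul 20 (Reg 11) (Reg 11)"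
  "prog ! 28 = Mul 13 (Reg 13) (Reg 20)"
  "prog ! 29 = Mul 13 (Reg 13) (Imm 512)"
  "prog ! 30 = Add 14 (Imm 0) (Imm 0)"
  "prog ! 31 = Add 15 (Imm 0) (Imm 0)"
  "prog ! 32 = Add 20 (Imm 0) (Imm 0)"
  "prog ! 33 = Add 21 (Imm 0) (Imm 0)"
  "prog ! 34 = Add 22 (Imm 0) (Imm 0)"
  "prog ! 35 = Add 23 (Imm 0) (Imm 0)"
  "prog ! 36 = Add 24 (Imm 0) (Imm 0)"
  "prog ! 37 = Pull 19 (Reg 16) (Reg 1)"
  "prog ! 38 = Add 15 (Reg 15) (Reg 19)"
  "prog ! 39 = Add 19 (Imm 0) (Imm 0)"
  "prog ! 40 = Add 14 (Reg 14) (Imm 1)"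
  "prog ! 41 = Add 3 (Reg 3) (Imm 1)"
  "prog ! 42 = JumpLess (Reg 3) (Reg 1) 46"
  "prog ! 43 = Add 2 (Reg 2) (Reg 2)"
  "prog ! 44 = Mul 1 (Reg 1) (Reg 1)"
  "prog ! 45 = JumpLess (Imm 0) (Imm 1) 2"
  "prog ! 46 = JumpLess (Reg 14) (Reg 13) 37"
  "prog ! 47 = JumpLess (Imm 0) (Reg 17) 54"
  "prog ! 48 = Add 8 (Reg 15) (Imm 0)"
  "prog ! 49 = JumpLess (Reg 7) (Reg 0) 19"
  "prog ! 50 = Add 4 (Reg 4) (Reg 4)"
  "prog ! 51 = Add 18 (Reg 18) (Imm 1)"
  "prog ! 52 = Add 7 (Imm 0) (Imm 0)"
  "prog ! 53 = JumpLess (Imm 0) (Imm 1) 8"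
  "prog ! 54 = Mul 20 (Reg 4) (Reg 4)"
  "prog ! 55 = Mul 20 (Reg 20) (Reg 2)"
  "prog ! 56 = Mul 20 (Reg 20) (Imm 512)"
  "prog ! 57 = Mul 21 (Reg 15) (Reg 20)"
  "prog ! 58 = Mul 21 (Reg 21) (Reg 11)"
  "prog ! 59 = Div 22 (Reg 1) (Reg 9)"
  "prog ! 60 = Add 23 (Reg 11) (Reg 11)"
  "prog ! 61 = Sub 23 (Reg 23) (Imm 1)"
  "prog ! 62 = Mul 22 (Reg 22) (Reg 23)"
  "prog ! 63 = Mul 22 (Reg 22) (Reg 13)"
  "prog ! 64 = Mul 22 (Reg 22) (Reg 20)"
  "prog ! 65 = Add 21 (Reg 21) (Reg 22)"
  "prog ! 66 = Mul 22 (Reg 8) (Reg 13)"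
  "prog ! 67 = Mul 22 (Reg 22) (Reg 11)"
  "prog ! 68 = JumpLess (Reg 21) (Reg 22) 88"
  "prog ! 69 = JumpLess (Reg 10) (Reg 18) 71"
  "prog ! 70 = JumpLess (Imm 0) (Imm 1) 73"
  "prog ! 71 = Add 24 (Reg 6) (Imm 3)"
  "prog ! 72 = JumpLess (Reg 10) (Reg 24) 95"
  "prog ! 73 = Mul 21 (Reg 11) (Reg 11)"
  "prog ! 74 = JumpLess (Reg 21) (Reg 2) 110"
  "prog ! 75 = JumpLess (Reg 10) (Reg 18) 95"
  "prog ! 76 = Mul 21 (Reg 15) (Reg 20)"
  "prog ! 77 = Div 22 (Reg 1) (Reg 4)"
  "prog ! 78 = Mul 22 (Reg 22) (Reg 13)"
  "prog ! 79 = Mul 22 (Reg 22) (Reg 20)"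
  "prog ! 80 = Mul 23 (Reg 8) (Reg 13)"
  "prog ! 81 = Add 22 (Reg 22) (Reg 23)"
  "prog ! 82 = JumpLess (Reg 22) (Reg 21) 85"
  "prog ! 83 = Add 7 (Reg 7) (Imm 1)"
  "prog ! 84 = JumpLess (Imm 0) (Imm 1) 49"
  "prog ! 85 = Add 5 (Reg 7) (Imm 0)"
  "prog ! 86 = Add 7 (Reg 7) (Imm 1)"
  "prog ! 87 = JumpLess (Imm 0) (Imm 1) 8"
  "prog ! 88 = Add 7 (Reg 7) (Imm 1)"
  "prog ! 89 = Mul 21 (Reg 11) (Reg 11)"
  "prog ! 90 = JumpLess (Reg 21) (Reg 2) 49"
  "prog ! 91 = JumpLess (Reg 6) (Reg 10) 93"
  "prog ! 92 = JumpLess (Imm 0) (Imm 1) 49"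
  "prog ! 93 = Add 6 (Reg 10) (Imm 0)"
  "prog ! 94 = JumpLess (Imm 0) (Imm 1) 49"
  "prog ! 95 = Add 10 (Reg 10) (Imm 1)"
  "prog ! 96 = Add 9 (Reg 9) (Reg 9)"
  "prog ! 97 = Sub 20 (Reg 6) (Reg 10)"
  "prog ! 98 = JumpLess (Reg 20) (Reg 10) 100"
  "prog ! 99 = Add 20 (Reg 10) (Imm 0)"
  "prog ! 100 = Mul 21 (Reg 12) (Reg 12)"
  "prog ! 101 = JumpLess (Reg 20) (Reg 21) 104"
  "prog ! 102 = Add 12 (Reg 12) (Imm 1)"
  "prog ! 103 = JumpLess (Imm 0) (Imm 1) 23"
  "prog ! 104 = Sub 21 (Reg 12) (Imm 1)"
  "prog ! 105 = Mul 22 (Reg 21) (Reg 21)"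
  "prog ! 106 = JumpLess (Reg 20) (Reg 22) 108"
  "prog ! 107 = JumpLess (Imm 0) (Imm 1) 23"
  "prog ! 108 = Sub 12 (Reg 12) (Imm 1)"
  "prog ! 109 = JumpLess (Imm 0) (Imm 1) 23"
  "prog ! 110 = Add 11 (Reg 11) (Reg 11)"
  "prog ! 111 = JumpLess (Imm 0) (Imm 1) 23"
  by (simp_all add: prog_def)

lemma length_prog: "length prog = 112"
  by (simp add: prog_def)

abbreviation cfg :: "nat \<Rightarrow> (nat \<Rightarrow> nat) \<Rightarrow> nat \<Rightarrow> nat list \<Rightarrow> config" where
  "cfg q m f a \<equiv> \<lparr>pc = q, mem = m, flips = f, arms = a\<rparr>"

lemma step_cfg: "q < 112 \<Longrightarrow> step prog x u (cfg q m f a) = exec x u (prog ! q) (cfg q m f a)"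
  by (simp add: step_def length_prog)

lemma funpow_numeral_step: "(F ^^ numeral k) c = (F ^^ pred_numeral k) (F c)"
  by (simp add: numeral_eq_Suc funpow_swap1)

lemmas run_simps = funpow_numeral_step step_cfg prog_nth store_def

section \<open>Simulation of the chain by the program\<close>

definition base :: "nat \<Rightarrow> nat \<Rightarrow> nat \<Rightarrow> nat \<Rightarrow> nat \<Rightarrow> nat \<Rightarrow> nat \<Rightarrow> (nat \<Rightarrow> nat) \<Rightarrow> bool" where
  "base K L t s c E i m \<longleftrightarrow> m 0 = K \<and> m 1 = 2 ^ L \<and> m 2 = L \<and> m 3 = t \<and> m 4 = 2 ^ s \<and> m 18 = s \<and>
     m 5 = c \<and> m 6 = E \<and> m 7 = i \<and> m 19 = 0 \<and> (\<forall>r>24. m r = 0)"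

definition tmp0 :: "(nat \<Rightarrow> nat) \<Rightarrow> bool" where
  "tmp0 m \<longleftrightarrow> m 20 = 0 \<and> m 21 = 0 \<and> m 22 = 0 \<and> m 23 = 0 \<and> m 24 = 0"

fun matches :: "nat \<Rightarrow> chain_state \<Rightarrow> (nat \<Rightarrow> nat) \<Rightarrow> bool" where
  "matches K (L, t, Ref s c E i, n, S) m \<longleftrightarrow> base K L t s c E i m \<and> tmp0 m \<and>
     m 17 = 0 \<and> m 16 = c \<and> m 13 = ref_size L s \<and> m 14 = n \<and> m 15 = S \<and>
     m 8 = 0 \<and> m 9 = 0 \<and> m 10 = 0 \<and> m 11 = 0 \<and> m 12 = 0"
| "matches K (L, t, Test s c M E i e y, n, S) m \<longleftrightarrow> base K L t s c E i m \<and> tmp0 m \<and>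
     m 17 = 1 \<and> m 16 = i \<and> m 13 = test_size E e y \<and> m 14 = n \<and> m 15 = S \<and>
     m 8 = M \<and> m 9 = 2 ^ e \<and> m 10 = e \<and> m 11 = y \<and> m 12 = conf E e"

text \<open>That \<open>arms\<close> is unchanged means that no pull happens on the way. The step
  bound \<open>n\<close> is kept for the space bound; its values in the lemmas below are
  generous.\<close>

definition reach :: "(nat \<times> nat \<Rightarrow> real) \<Rightarrow> (nat \<Rightarrow> bool) \<Rightarrow> nat \<Rightarrow> config \<Rightarrow> nat \<Rightarrow> chain_state \<Rightarrow> bool" where
  "reach x u n c K \<sigma> \<longleftrightarrow> (\<exists>k\<le>n. \<exists>m. (step prog x u ^^ k) c = cfg 37 m (flips c) (arms c) \<and> matches K \<sigma> m)"

lemma reach_here: "matches K \<sigma> m \<Longrightarrow> reach x u n (cfg 37 m f a) K \<sigma>"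
  unfolding reach_def by (intro exI[of _ 0]) auto

lemma reach_steps:
  assumes "(step prog x u ^^ k) (cfg q m f a) = cfg q' m' f a" "reach x u n (cfg q' m' f a) K \<sigma>" "k + n \<le> n'"
  shows "reach x u n' (cfg q m f a) K \<sigma>"
proof -
  obtain j m'' where j: "j \<le> n" "(step prog x u ^^ j) (cfg q' m' f a) = cfg 37 m'' f a" "matches K \<sigma> m''"
    using assms(2) by (auto simp: reach_def)
  have "(step prog x u ^^ (j + k)) (cfg q m f a) = cfg 37 m'' f a"
    using j(2) assms(1) by (simp add: funpow_add)
  then show ?thesis unfolding reach_def using j(1,3) assms(3) by (intro exI[of _ "j + k"]) auto
qed

lemma at_REF:
  assumes "base K L t s c E i m"
  shows "reach x u 20 (cfg 8 m f a) K (L, t, Ref s c E i, 0, 0)"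
proof (rule reach_steps[OF _ reach_here])
  show "(step prog x u ^^ 18) (cfg 8 m f a) = cfg 37 (m(16 := m 5, 17 := 0, 13 := m 4 * m 4 * m 2 * 512,
      8 := 0, 9 := 0, 10 := 0, 11 := 0, 12 := 0, 14 := 0, 15 := 0, 20 := 0, 21 := 0, 22 := 0, 23 := 0, 24 := 0)) f a"
    by (simp add: run_simps)
qed (use assms in \<open>auto simp: base_def tmp0_def ref_size_def power2_eq_square simp flip: power_mult_distrib\<close>)

definition test_regs :: "nat \<Rightarrow> nat \<Rightarrow> nat \<Rightarrow> nat \<Rightarrow> (nat \<Rightarrow> nat) \<Rightarrow> bool" where
  "test_regs M E e y m \<longleftrightarrow> m 8 = M \<and> m 9 = 2 ^ e \<and> m 10 = e \<and> m 11 = y \<and> m 12 = conf E e"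

lemma at_BLOCK:
  assumes "base K L t s c E i m" "test_regs M E e y m"
  shows "reach x u 20 (cfg 23 m f a) K (L, t, Test s c M E i e y, 0, 0)"
proof (rule reach_steps[OF _ reach_here])
  show "(step prog x u ^^ 14) (cfg 23 m f a) = cfg 37 (m(16 := m 7, 17 := 1,
      13 := m 9 * m 9 * m 12 * (m 11 * m 11) * 512,
      14 := 0, 15 := 0, 20 := 0, 21 := 0, 22 := 0, 23 := 0, 24 := 0)) f a"
    by (simp add: run_simps)
qed (use assms in \<open>auto simp: base_def tmp0_def test_regs_def test_size_def power2_eq_square simp flip: power_mult_distrib\<close>)

lemma at_TEST:
  assumes "base K L t s c E i m" "m 8 = M"
  shows "reach x u 30 (cfg 19 m f a) K (L, t, Test s c M E i 0 1, 0, 0)"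
proof (rule reach_steps[OF _ at_BLOCK])
  show "(step prog x u ^^ 4) (cfg 19 m f a) = cfg 23 (m(9 := 1, 10 := 0, 11 := 1, 12 := 1)) f a"
    by (simp add: run_simps)
qed (use assms in \<open>auto simp: base_def test_regs_def\<close>)

lemma at_NEXT:
  assumes b: "base K L t s c E i m" and M: "m 8 = M"
  shows "reach x u 40 (cfg 49 m f a) K (L, t, next_arm K s c M E i, 0, 0)"
proof (cases "i < K")
  case True
  have "(step prog x u ^^ 1) (cfg 49 m f a) = cfg 19 m f a"
    using True b by (simp add: run_simps base_def)
  from reach_steps[OF this at_TEST[OF b M]] True show ?thesis by (simp add: next_arm_def)
next
  case False
  have 1: "(step prog x u ^^ 5) (cfg 49 m f a) = cfg 8 (m(4 := m 4 + m 4, 18 := m 18 + 1, 7 := 0)) f a"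
    using False b by (simp add: run_simps base_def)
  have "base K L t (Suc s) c E 0 (m(4 := m 4 + m 4, 18 := m 18 + 1, 7 := 0))"
    using b by (auto simp: base_def)
  from reach_steps[OF 1 at_REF[OF this]] False show ?thesis by (simp add: next_arm_def)
qed

lemma at_EPOCH:
  assumes "m 0 = K" "m 1 = 2 ^ L" "m 2 = L" "m 19 = 0" "\<forall>r>24. m r = 0"
  shows "reach x u 30 (cfg 2 m f a) K (L, 0, start, 0, 0)"
proof (rule reach_steps[OF _ at_REF])
  show "(step prog x u ^^ 6) (cfg 2 m f a)
      = cfg 8 (m(3 := 0, 4 := 1, 18 := 0, 5 := 0, 6 := 0, 7 := 0)) f a"
    by (simp add: run_simps)
qed (use assms in \<open>auto simp: base_def\<close>)

lemma conf_eqI: "0 < h \<Longrightarrow> (h - 1)\<^sup>2 \<le> min e (E - e) \<Longrightarrow> min e (E - e) < h\<^sup>2 \<Longrightarrow> conf E e = h"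
  by (cases h) (auto simp: conf_def intro: floor_sqrt_unique)

lemma conf_bounds: "(conf E e - 1)\<^sup>2 \<le> min e (E - e)" "min e (E - e) < (conf E e)\<^sup>2"
  using Suc_floor_sqrt_power2_gt[of "min e (E - e)"] floor_sqrt_power2_le[of "min e (E - e)"]
  by (auto simp: conf_def)

text \<open>Register 20 holds the new minimum and register 12 the old \<open>conf\<close>. As the
  new value differs by at most 1, comparing the minimum with the squares of \<open>h\<close> and
  \<open>h - 1\<close> determines it.\<close>

lemma at_KEEP:
  assumes b: "base K L t s c E i m" and r: "m 8 = M" "m 9 = 2 ^ Suc e" "m 10 = Suc e" "m 11 = y" "m 12 = conf E e"
    and k: "m 20 = min (Suc e) (E - Suc e)"
  shows "reach x u 30 (cfg 100 m f a) K (L, t, Test s c M E i (Suc e) y, 0, 0)"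
proof -
  let ?h = "conf E e"
  have step: "min (Suc e) (E - Suc e) \<le> Suc (min e (E - e))" "min e (E - e) \<le> Suc (min (Suc e) (E - Suc e))"
    by auto
  have keep: "reach x u 30 (cfg 100 m f a) K (L, t, Test s c M E i (Suc e) y, 0, 0)"
    if "test_regs M E (Suc e) y m'" "base K L t s c E i m'" "(step prog x u ^^ k) (cfg 100 m f a) = cfg 23 m' f a" "k \<le> 10" for m' k
    by (rule reach_steps[OF that(3) at_BLOCK[OF that(2,1)]]) (use that(4) in simp)
  consider "?h * ?h \<le> m 20" | "m 20 < ?h * ?h" "m 20 < (?h - 1) * (?h - 1)" | "m 20 < ?h * ?h" "(?h - 1) * (?h - 1) \<le> m 20"
    by linarith
  then show ?thesis
  proof cases
    case 1
    have "conf E (Suc e) = Suc ?h"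
      using 1 k step(1) conf_bounds(2)[of e E] by (intro conf_eqI) (auto simp: power2_eq_square)
    then have "test_regs M E (Suc e) y (m(21 := ?h * ?h, 12 := ?h + 1))" using r by (simp add: test_regs_def)
    moreover have "base K L t s c E i (m(21 := ?h * ?h, 12 := ?h + 1))" using b by (simp add: base_def)
    moreover have "(step prog x u ^^ 4) (cfg 100 m f a) = cfg 23 (m(21 := ?h * ?h, 12 := ?h + 1)) f a"
      using 1 r by (simp add: run_simps)
    ultimately show ?thesis by (rule keep) simp
  next
    case 2
    obtain j where j: "?h = Suc (Suc j)" using 2(2) by (cases ?h; cases "?h - 1") auto
    have "conf E (Suc e) = ?h - 1"
      using 2 k step(2) conf_bounds(1)[of E e] by (intro conf_eqI) (auto simp: power2_eq_square j)
    then have "test_regs M E (Suc e) y (m(21 := ?h - 1, 22 := (?h - 1) * (?h - 1), 12 := ?h - 1))"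
      using r by (simp add: test_regs_def)
    moreover have "base K L t s c E i (m(21 := ?h - 1, 22 := (?h - 1) * (?h - 1), 12 := ?h - 1))"
      using b by (simp add: base_def)
    moreover have "(step prog x u ^^ 7) (cfg 100 m f a)
        = cfg 23 (m(21 := ?h - 1, 22 := (?h - 1) * (?h - 1), 12 := ?h - 1)) f a"
      using 2 r by (simp add: run_simps)
    ultimately show ?thesis by (rule keep) simp
  next
    case 3
    have "conf E (Suc e) = ?h" using 3 k by (intro conf_eqI) (auto simp: power2_eq_square)
    then have "test_regs M E (Suc e) y (m(21 := ?h - 1, 22 := (?h - 1) * (?h - 1)))"
      using r by (simp add: test_regs_def)
    moreover have "base K L t s c E i (m(21 := ?h - 1, 22 := (?h - 1) * (?h - 1)))"
      using b by (simp add: base_def)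
    moreover have "(step prog x u ^^ 6) (cfg 100 m f a)
        = cfg 23 (m(21 := ?h - 1, 22 := (?h - 1) * (?h - 1))) f a"
      using 3 r by (simp add: run_simps)
    ultimately show ?thesis by (rule keep) simp
  qed
qed

lemma at_INC:
  assumes b: "base K L t s c E i m" and r: "test_regs M E e y m"
  shows "reach x u 40 (cfg 95 m f a) K (L, t, Test s c M E i (Suc e) y, 0, 0)"
proof (cases "E - Suc e < Suc e")
  case True
  have "(step prog x u ^^ 4) (cfg 95 m f a)
      = cfg 100 (m(10 := Suc e, 9 := 2 ^ e + 2 ^ e, 20 := E - Suc e)) f a"
    using True b r by (simp add: run_simps base_def test_regs_def)
  then show ?thesis
    by (rule reach_steps[OF _ at_KEEP]) (use True b r in \<open>auto simp: base_def test_regs_def\<close>)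
next
  case False
  have "(step prog x u ^^ 5) (cfg 95 m f a)
      = cfg 100 (m(10 := Suc e, 9 := 2 ^ e + 2 ^ e, 20 := Suc e)) f a"
    using False b r by (simp add: run_simps base_def test_regs_def)
  then show ?thesis
    by (rule reach_steps[OF _ at_KEEP]) (use False b r in \<open>auto simp: base_def test_regs_def\<close>)
qed

lemma at_DBL:
  assumes b: "base K L t s c E i m" and r: "test_regs M E e y m"
  shows "reach x u 40 (cfg 110 m f a) K (L, t, Test s c M E i e (2 * y), 0, 0)"
proof (rule reach_steps[OF _ at_BLOCK])
  show "(step prog x u ^^ 2) (cfg 110 m f a) = cfg 23 (m(11 := m 11 + m 11)) f a"
    by (simp add: run_simps)
qed (use assms in \<open>auto simp: base_def test_regs_def\<close>)

lemma at_REJ: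
  assumes b: "base K L t s c E i m" and r: "m 8 = M" "m 10 = e" "m 11 = y"
  shows "reach x u 50 (cfg 88 m f a) K (L, t, next_arm K s c M (if L \<le> y\<^sup>2 \<and> E < e then e else E) (Suc i), 0, 0)"
proof -
  let ?m = "m(7 := Suc i, 21 := y * y)"
  have b': "base K L t s c E (Suc i) ?m" using b by (simp add: base_def)
  consider "y\<^sup>2 < L" | "L \<le> y\<^sup>2" "E < e" | "L \<le> y\<^sup>2" "\<not> E < e" by linarith
  then show ?thesis
  proof cases
    case 1
    then have "(step prog x u ^^ 3) (cfg 88 m f a) = cfg 49 ?m f a"
      using b r by (simp add: run_simps base_def power2_eq_square)
    from reach_steps[OF this at_NEXT[OF b']] 1 r show ?thesis by simp
  next
    case 2
    then have s6: "(step prog x u ^^ 6) (cfg 88 m f a) = cfg 49 (?m(6 := e)) f a"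
      using b r by (simp add: run_simps base_def power2_eq_square)
    have "base K L t s c e (Suc i) (?m(6 := e))" using b by (simp add: base_def)
    from reach_steps[OF s6 at_NEXT[OF this]] 2 r show ?thesis by simp
  next
    case 3
    then have "(step prog x u ^^ 5) (cfg 88 m f a) = cfg 49 ?m f a"
      using b r by (simp add: run_simps base_def power2_eq_square)
    from reach_steps[OF this at_NEXT[OF b']] 3 r show ?thesis by simp
  qed
qed

text \<open>As \<open>e \<le> s \<le> L\<close>, the divisions of \<open>2 ^ L\<close> are exact, and the comparisons of means become integer ones.\<close>

lemma rejects_iff:
  assumes "e \<le> L" "0 < y" "0 < L"
  shows "rejects L s M E e y S \<longleftrightarrow>
    S * ref_size L s * y + 2 ^ L div 2 ^ e * (2 * y - 1) * test_size E e y * ref_size L s < M * test_size E e y * y"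
proof -
  let ?n = "test_size E e y" and ?N = "ref_size L s"
  have pos: "0 < real ?n" "0 < real ?N" using assms by (auto simp: test_size_def ref_size_def)
  have d: "2 ^ L = 2 ^ (L - e) * (2::nat) ^ e" using assms(1) by (simp flip: power_add)
  have q: "2 ^ L div 2 ^ e = (2::nat) ^ (L - e)" unfolding d by simp
  have dr: "(2::real) ^ L = 2 ^ (L - e) * 2 ^ e" using assms(1) by (simp flip: power_add)
  have y1: "real (2 * y - 1) = 2 * real y - 1" using assms(2) by (simp add: of_nat_diff)
  define F where "F = real ?n * real ?N * 2 ^ L * real y"
  have F: "0 < F" using pos assms by (simp add: F_def)
  have "rejects L s M E e y S \<longleftrightarrow> F * test_mean L E e y S < F * (ref_mean L s M - threshold e y)"
    using F by (simp add: rejects_def)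
  also have "F * test_mean L E e y S = real (S * ?N * y)"
    using pos by (simp add: F_def test_mean_def)
  also have "F * (ref_mean L s M - threshold e y)
      = real (M * ?n * y) - real (2 ^ L div 2 ^ e * (2 * y - 1) * ?n * ?N)"
    using pos assms(2) unfolding q of_nat_mult y1
    by (simp add: F_def ref_mean_def threshold_def dr right_diff_distrib) (simp add: field_simps)
  finally have "rejects L s M E e y S \<longleftrightarrow>
    real (S * ?N * y) + real (2 ^ L div 2 ^ e * (2 * y - 1) * ?n * ?N) < real (M * ?n * y)" by linarith
  also have "\<dots> \<longleftrightarrow> S * ?N * y + 2 ^ L div 2 ^ e * (2 * y - 1) * ?n * ?N < M * ?n * y"
    by (simp only: of_nat_add[symmetric] of_nat_less_iff)
  finally show ?thesis .
qed

lemma accepts_iff: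
  assumes "s \<le> L" "0 < y" "0 < L"
  shows "accepts L s M E e y S \<longleftrightarrow>
    2 ^ L div 2 ^ s * test_size E e y * ref_size L s + M * test_size E e y < S * ref_size L s"
proof -
  let ?n = "test_size E e y" and ?N = "ref_size L s"
  have pos: "0 < real ?n" "0 < real ?N" using assms by (auto simp: test_size_def ref_size_def)
  have d: "2 ^ L = 2 ^ (L - s) * (2::nat) ^ s" using assms(1) by (simp flip: power_add)
  have q: "2 ^ L div 2 ^ s = (2::nat) ^ (L - s)" unfolding d by simp
  have dr: "(2::real) ^ L = 2 ^ (L - s) * 2 ^ s" using assms(1) by (simp flip: power_add)
  define F where "F = real ?n * real ?N * 2 ^ L"
  have F: "0 < F" using pos by (simp add: F_def)
  have "accepts L s M E e y S \<longleftrightarrow> F * (ref_mean L s M + 1 / 2 ^ s) < F * test_mean L E e y S"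
    using F by (simp add: accepts_def)
  also have "F * test_mean L E e y S = real (S * ?N)"
    using pos by (simp add: F_def test_mean_def)
  also have "F * (ref_mean L s M + 1 / 2 ^ s) = real (2 ^ L div 2 ^ s * ?n * ?N + M * ?n)"
    using pos unfolding q of_nat_mult of_nat_add
    by (simp add: F_def ref_mean_def dr distrib_left)
  finally show ?thesis by (simp only: of_nat_less_iff)
qed

lemma at_TEND:
  assumes b: "base K L t s c E i m" and r: "test_regs M E e y m" and n: "m 13 = test_size E e y" "m 15 = S"
    and L: "e \<le> L" "s \<le> L" "0 < y" "0 < L"
  shows "reach x u 90 (cfg 54 m f a) K (L, t, after L K (Test s c M E i e y) S, 0, 0)"
proof -
  let ?n = "test_size E e y" and ?N = "ref_size L s"
  let ?l = "S * ?N * y + 2 ^ L div 2 ^ e * (2 * y - 1) * ?n * ?N" and ?r = "M * ?n * y"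
  let ?m = "m(20 := ?N, 21 := ?l, 22 := ?r, 23 := 2 * y - 1)"
  have N: "2 ^ s * 2 ^ s * L * 512 = ?N"
    by (simp add: ref_size_def power2_eq_square flip: power_mult_distrib)
  have 1: "(step prog x u ^^ 14) (cfg 54 m f a) = cfg 68 ?m f a"
    using b r n by (simp add: run_simps base_def test_regs_def N mult_2[symmetric] mult.assoc[symmetric] add.assoc fun_upd_twist)
  have b': "base K L t s c E i ?m" and r': "test_regs M E e y ?m" using b r by (auto simp: base_def test_regs_def)
  have "reach x u 70 (cfg 68 ?m f a) K (L, t, after L K (Test s c M E i e y) S, 0, 0)"
  proof (cases "?l < ?r")
    case True
    have s1: "(step prog x u ^^ 1) (cfg 68 ?m f a) = cfg 88 ?m f a" using True by (simp add: run_simps)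
    have "rejects L s M E e y S" unfolding rejects_iff[OF L(1,3,4)] by (rule True)
    then have "after L K (Test s c M E i e y) S = next_arm K s c M (if L \<le> y\<^sup>2 \<and> E < e then e else E) (Suc i)"
      by (simp only: after.simps(2) if_True)
    moreover have "reach x u 50 (cfg 88 ?m f a) K (L, t, next_arm K s c M (if L \<le> y\<^sup>2 \<and> E < e then e else E) (Suc i), 0, 0)"
      by (rule at_REJ[OF b']) (use r' in \<open>simp_all add: test_regs_def\<close>)
    ultimately show ?thesis using reach_steps[OF s1] by (simp only:)
  next
    case rej: False
    then have nr: "\<not> rejects L s M E e y S" unfolding rejects_iff[OF L(1,3,4)] .
    have full: "reach x u 60 (cfg 73 m' f a) K (L, t, after L K (Test s c M E i e y) S, 0, 0)"
      if ne: "\<not> (e < s \<and> e < E + 3)" and b2: "base K L t s c E i m'" and r2: "test_regs M E e y m'"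
        and n2: "m' 13 = ?n" "m' 15 = S" "m' 20 = ?N" for m'
    proof -
      consider "y\<^sup>2 < L" | "L \<le> y\<^sup>2" "e < s" | "L \<le> y\<^sup>2" "\<not> e < s" by linarith
      then show ?thesis
      proof cases
        case 1
        have s2: "(step prog x u ^^ 2) (cfg 73 m' f a) = cfg 110 (m'(21 := y * y)) f a"
          using 1 b2 r2 by (simp add: run_simps base_def test_regs_def power2_eq_square)
        have "reach x u 40 (cfg 110 (m'(21 := y * y)) f a) K (L, t, Test s c M E i e (2 * y), 0, 0)"
          by (rule at_DBL) (use b2 r2 in \<open>auto simp: base_def test_regs_def\<close>)
        from reach_steps[OF s2 this] show ?thesis using 1 ne nr by (auto simp: after.simps(2))
      next
        case 2
        have s3: "(step prog x u ^^ 3) (cfg 73 m' f a) = cfg 95 (m'(21 := y * y)) f a"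
          using 2 b2 r2 by (simp add: run_simps base_def test_regs_def power2_eq_square)
        have "reach x u 40 (cfg 95 (m'(21 := y * y)) f a) K (L, t, Test s c M E i (Suc e) y, 0, 0)"
          by (rule at_INC) (use b2 r2 in \<open>auto simp: base_def test_regs_def\<close>)
        from reach_steps[OF s3 this] show ?thesis using 2 ne nr by (auto simp: after.simps(2))
      next
        case 3
        let ?d = "2 ^ L div 2 ^ s * ?n * ?N + M * ?n"
        let ?m2 = "m'(21 := S * ?N, 22 := ?d, 23 := M * ?n)"
        have s9: "(step prog x u ^^ 9) (cfg 73 m' f a) = cfg 82 ?m2 f a"
          using 3 b2 r2 n2 by (simp add: run_simps base_def test_regs_def power2_eq_square fun_upd_twist)
        show ?thesis
        proof (cases "?d < S * ?N")
          case True
          then have acc: "accepts L s M E e y S" unfolding accepts_iff[OF L(2,3,4)] .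
          have s4: "(step prog x u ^^ 4) (cfg 82 ?m2 f a) = cfg 8 (?m2(5 := i, 7 := Suc i)) f a"
            using True b2 by (simp add: run_simps base_def)
          have "base K L t s i E (Suc i) (?m2(5 := i, 7 := Suc i))" using b2 by (simp add: base_def)
          from reach_steps[OF s9 reach_steps[OF s4 at_REF[OF this] order_refl]] show ?thesis
            using 3 ne nr acc by (auto simp: after.simps(2))
        next
          case False
          then have acc: "\<not> accepts L s M E e y S" unfolding accepts_iff[OF L(2,3,4)] .
          have s3: "(step prog x u ^^ 3) (cfg 82 ?m2 f a) = cfg 49 (?m2(7 := Suc i)) f a"
            using False b2 by (simp add: run_simps base_def)
          have "base K L t s c E (Suc i) (?m2(7 := Suc i))" using b2 by (simp add: base_def)
          from reach_steps[OF s9 reach_steps[OF s3 at_NEXT[OF this, of M] order_refl]] r2 show ?thesis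
            using 3 ne nr acc by (auto simp: after.simps(2) test_regs_def)
        qed
      qed
    qed
    consider "e < s" "e < E + 3" | "e < s" "\<not> e < E + 3" | "\<not> e < s" by linarith
    then show ?thesis
    proof cases
      case 1
      have s4: "(step prog x u ^^ 4) (cfg 68 ?m f a) = cfg 95 (?m(24 := E + 3)) f a"
        using rej 1 b r by (simp add: run_simps base_def test_regs_def)
      have "reach x u 40 (cfg 95 (?m(24 := E + 3)) f a) K (L, t, Test s c M E i (Suc e) y, 0, 0)"
        by (rule at_INC) (use b r in \<open>auto simp: base_def test_regs_def\<close>)
      from reach_steps[OF s4 this] show ?thesis using 1 nr by (simp add: after.simps(2))
    next
      case 2
      have s4: "(step prog x u ^^ 4) (cfg 68 ?m f a) = cfg 73 (?m(24 := E + 3)) f a"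
        using rej 2 b r by (simp add: run_simps base_def test_regs_def)
      show ?thesis
        by (rule reach_steps[OF s4 full]) (use 2 b r n in \<open>auto simp: base_def test_regs_def\<close>)
    next
      case 3
      have s3: "(step prog x u ^^ 3) (cfg 68 ?m f a) = cfg 73 ?m f a"
        using rej 3 b r by (simp add: run_simps base_def test_regs_def)
      show ?thesis
        by (rule reach_steps[OF s3 full]) (use 3 b r n in \<open>auto simp: base_def test_regs_def\<close>)
    qed
  qed
  from reach_steps[OF 1 this] show ?thesis by simp
qed

text \<open>The program-side counterpart of the fuel condition. It yields
  \<open>2 * s \<le> L\<close>, which makes the divisions of \<open>2 ^ L\<close> exact and keeps
  the registers small.\<close>

fun time_ok :: "chain_state \<Rightarrow> bool" where
  "time_ok (L, t, Ref s c E i, n, S) \<longleftrightarrow> t < 2 ^ L \<and> (if i = 0 then 4 ^ s + n \<le> t + 1 else 4 ^ Suc s \<le> t + 1)"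
| "time_ok (L, t, Test s c M E i e y, n, S) \<longleftrightarrow> t < 2 ^ L \<and> 4 ^ Suc s \<le> t + 1"

fun size_ok :: "chain_state \<Rightarrow> bool" where
  "size_ok (L, t, Ref s c E i, n, S) \<longleftrightarrow> n < ref_size L s \<and> S \<le> n * 2 ^ L"
| "size_ok (L, t, Test s c M E i e y, n, S) \<longleftrightarrow> n < test_size E e y \<and> S \<le> n * 2 ^ L \<and> M \<le> ref_size L s * 2 ^ L"

lemma time_ok_next_arm:
  "t < 2 ^ L \<Longrightarrow> 4 ^ Suc s \<le> t + 1 \<Longrightarrow> time_ok (L, t, next_arm K s c M E i, 0, 0)"
  by (simp add: next_arm_def)

lemma time_ok_next:
  assumes "chain_ok K \<sigma>" "time_ok \<sigma>"
  shows "time_ok (chain_next K \<sigma> r)"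
proof -
  obtain L t b n S where \<sigma>: "\<sigma> = (L, t, b, n, S)" by (cases \<sigma>)
  have L: "64 \<le> L" using assms \<sigma> by simp
  show ?thesis
  proof (cases b)
    case (Ref s c E i)
    have "4 ^ Suc s \<le> Suc t + 1" if "\<not> Suc n < ref_size L s"
    proof (cases "i = 0")
      case True
      have "3 * 4 ^ s \<le> ref_size L s" using L by (simp add: ref_size_def)
      then show ?thesis using that assms(2) True by (simp add: \<sigma> Ref)
    next
      case False
      then show ?thesis using assms(2) by (simp add: \<sigma> Ref)
    qed
    then show ?thesis using assms(2) by (auto simp: \<sigma> Ref intro!: time_ok_next_arm split: if_splits)
  next
    case (Test s c M E i e y)
    then show ?thesis using assms(2) by (auto simp: \<sigma> after.simps(2) intro!: time_ok_next_arm)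
  qed
qed

lemma size_ok_next_arm:
  "0 < L \<Longrightarrow> M \<le> ref_size L s * 2 ^ L \<Longrightarrow> size_ok (L, t, next_arm K s c M E i, 0, 0)"
  by (simp add: next_arm_def ref_size_def test_size_def)

lemma size_ok_next:
  assumes ok: "chain_ok K \<sigma>" "size_ok \<sigma>" and r: "r \<le> chain_res \<sigma>"
  shows "size_ok (chain_next K \<sigma> r)"
proof -
  obtain L t b n S where \<sigma>: "\<sigma> = (L, t, b, n, S)" by (cases \<sigma>)
  have L: "64 \<le> L" using ok \<sigma> by simp
  show ?thesis
  proof (cases b)
    case (Ref s c E i)
    then have S: "S + r \<le> Suc n * 2 ^ L" and n: "n < ref_size L s" using ok r by (auto simp: \<sigma>)
    have "Suc n * 2 ^ L \<le> ref_size L s * 2 ^ L" using n by (intro mult_le_mono1) simp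
    then have "S + r \<le> ref_size L s * 2 ^ L" using S by linarith
    then show ?thesis using ok S L by (auto simp: \<sigma> Ref ref_size_def intro!: size_ok_next_arm)
  next
    case (Test s c M E i e y)
    then have "S + r \<le> Suc n * 2 ^ L" "n < test_size E e y" "M \<le> ref_size L s * 2 ^ L" "0 < y"
      using ok r by (auto simp: \<sigma>)
    then show ?thesis using L
      by (auto simp: \<sigma> Test after.simps(2) ref_size_def test_size_def intro!: size_ok_next_arm)
  qed
qed

lemma time_ok_chain: "0 < K \<Longrightarrow> time_ok (chain K ob x t)"
  by (induction t) (auto simp del: chain_next.simps intro: time_ok_next chain_ok)

lemma four_pow_le:
  assumes "4 ^ s \<le> (2::nat) ^ L" shows "2 * s \<le> L"
proof -
  have "(2::nat) ^ (2 * s) \<le> 2 ^ L" using assms by (simp add: power_mult)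
  then show ?thesis by simp
qed

lemma at_PULL:
  assumes mt: "matches K (L, t, b, n, S) m" and ok: "chain_ok K (L, t, b, n, S)" "time_ok (L, t, b, n, S)"
  shows "reach x u 130 (step prog x u (cfg 37 m f a)) K
      (chain_next K (L, t, b, n, S) (obs (2 ^ L) (x (block_arm b, length a))))"
    and "arms (step prog x u (cfg 37 m f a)) = a @ [block_arm b]"
proof -
  let ?r = "obs (2 ^ L) (x (block_arm b, length a))"
  have pull: "m 16 = block_arm b" "m 1 = 2 ^ L" "m 13 = block_size L b" "m 14 = n" "m 15 = S" "m 3 = t" "m 2 = L"
    "m 0 = K" "\<forall>r>24. m r = 0"
    using mt by (cases b; auto simp: base_def)+
  have 0: "step prog x u (cfg 37 m f a) = cfg 38 (m(19 := ?r)) f (a @ [block_arm b])"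
    using pull by (simp add: run_simps obs_def)
  then show "arms (step prog x u (cfg 37 m f a)) = a @ [block_arm b]" by simp
  let ?m = "m(15 := S + ?r, 19 := 0, 14 := Suc n, 3 := Suc t)" and ?a = "a @ [block_arm b]"
  have 4: "(step prog x u ^^ 4) (cfg 38 (m(19 := ?r)) f ?a) = cfg 42 ?m f ?a"
    using pull by (simp add: run_simps fun_upd_twist)
  have "reach x u 120 (cfg 42 ?m f ?a) K (chain_next K (L, t, b, n, S) ?r)"
  proof (cases "Suc t < 2 ^ L")
    case t: True
    then have 1: "(step prog x u ^^ 1) (cfg 42 ?m f ?a) = cfg 46 ?m f ?a"
      using pull by (simp add: run_simps)
    have "reach x u 110 (cfg 46 ?m f ?a) K (chain_next K (L, t, b, n, S) ?r)"
    proof (cases "Suc n < block_size L b")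
      case True
      then have 1: "(step prog x u ^^ 1) (cfg 46 ?m f ?a) = cfg 37 ?m f ?a"
        using pull by (simp add: run_simps)
      have "matches K (L, Suc t, b, Suc n, S + ?r) ?m"
        using mt by (cases b) (auto simp: base_def tmp0_def)
      from reach_steps[OF 1 reach_here[OF this, where n = 0]] show ?thesis using True t by simp
    next
      case n: False
      show ?thesis
      proof (cases b)
        case (Ref s c E i)
        have 3: "(step prog x u ^^ 3) (cfg 46 ?m f ?a) = cfg 49 (?m(8 := S + ?r)) f ?a"
          using n pull mt by (simp add: run_simps Ref)
        have "base K L (Suc t) s c E i (?m(8 := S + ?r))" using mt by (auto simp: Ref base_def)
        from at_NEXT[OF this] have "reach x u 40 (cfg 49 (?m(8 := S + ?r)) f ?a) K
            (L, Suc t, next_arm K s c (S + ?r) E i, 0, 0)" by simp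
        from reach_steps[OF 3 this] show ?thesis using n t Ref by simp
      next
        case (Test s c M E i e y)
        have 2: "(step prog x u ^^ 2) (cfg 46 ?m f ?a) = cfg 54 ?m f ?a"
          using n pull mt by (simp add: run_simps Test)
        have e: "e \<le> s" "0 < y" "0 < L" using ok by (auto simp: Test)
        have "4 ^ Suc s \<le> (2::nat) ^ L" using ok(2) by (simp add: Test)
        then have s: "s \<le> L" using four_pow_le[of "Suc s" L] by simp
        have "reach x u 90 (cfg 54 ?m f ?a) K (L, Suc t, after L K (Test s c M E i e y) (S + ?r), 0, 0)"
        proof (rule at_TEND)
          show "base K L (Suc t) s c E i ?m" "test_regs M E e y ?m" "?m 13 = test_size E e y"
            using mt by (auto simp: Test base_def test_regs_def)
        qed (use e s in simp_all)
        from reach_steps[OF 2 this] show ?thesis using n t Test by simp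
      qed
    qed
    from reach_steps[OF 1 this] show ?thesis by simp
  next
    case False
    then have 4: "(step prog x u ^^ 4) (cfg 42 ?m f ?a)
        = cfg 2 (?m(2 := L + L, 1 := 2 ^ L * 2 ^ L)) f ?a"
      using pull by (simp add: run_simps)
    have "reach x u 30 (cfg 2 (?m(2 := L + L, 1 := 2 ^ L * 2 ^ L)) f ?a) K (2 * L, 0, start, 0, 0)"
      by (rule at_EPOCH) (use pull in \<open>auto simp: mult_2 power_add\<close>)
    from reach_steps[OF 4 this] False show ?thesis by simp
  qed
  from reach_steps[OF 4 this] show "reach x u 130 (step prog x u (cfg 37 m f a)) K (chain_next K (L, t, b, n, S) ?r)"
    unfolding 0 by simp
qed

section \<open>Whole runs of the program\<close>

definition played :: "nat \<Rightarrow> (nat \<times> nat \<Rightarrow> real) \<Rightarrow> nat \<Rightarrow> nat list" where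
  "played K x T = map (\<lambda>t. chain_arm (chain K obs x t)) [0..<T]"

definition head :: "nat \<Rightarrow> (nat \<times> nat \<Rightarrow> real) \<Rightarrow> (nat \<Rightarrow> bool) \<Rightarrow> nat \<Rightarrow> nat \<Rightarrow> bool" where
  "head K x u h T \<longleftrightarrow> (\<exists>m f. run prog K x u h = cfg 37 m f (played K x T) \<and> matches K (chain K obs x T) m)"

lemma run_add: "run P K x u (k + h) = (step P x u ^^ k) (run P K x u h)"
  by (simp add: run_def funpow_add)

lemma head_0: "\<exists>h\<le>40. head K x u h 0"
proof -
  have "(step prog x u ^^ 2) (init K) = cfg 2 ((\<lambda>_. 0)(0 := K, 1 := 2 ^ 64, 2 := 64)) 0 []"
    by (simp add: run_simps prog_nth(2)[unfolded One_nat_def] init_def)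
  moreover have "reach x u 30 (cfg 2 ((\<lambda>_. 0)(0 := K, 1 := 2 ^ 64, 2 := 64)) 0 []) K (64, 0, start, 0, 0)"
    by (rule at_EPOCH) auto
  ultimately have "reach x u 40 (init K) K (64, 0, start, 0, 0)"
    unfolding init_def using reach_steps by simp
  then obtain k m where "k \<le> 40" "(step prog x u ^^ k) (init K) = cfg 37 m (flips (init K)) (arms (init K))"
      "matches K (64, 0, start, 0, 0) m"
    unfolding reach_def by blast
  then show ?thesis
    by (intro exI[of _ k]) (auto simp: head_def run_def played_def init_def)
qed

lemma head_Suc:
  assumes K: "0 < K" and h: "head K x u h T"
  shows "\<exists>k. 0 < k \<and> k \<le> 131 \<and> head K x u (h + k) (Suc T)"
proof -
  obtain m f where r: "run prog K x u h = cfg 37 m f (played K x T)" and mt: "matches K (chain K obs x T) m"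
    using h by (auto simp: head_def)
  obtain L t b n S where c: "chain K obs x T = (L, t, b, n, S)" by (cases "chain K obs x T")
  note ok = chain_ok[OF K, of obs x T] time_ok_chain[OF K, of obs x T]
  have len: "length (played K x T) = T" by (simp add: played_def)
  have nxt: "chain_next K (L, t, b, n, S) (obs (2 ^ L) (x (block_arm b, length (played K x T)))) = chain K obs x (Suc T)"
    using c len by simp
  have pl: "played K x T @ [block_arm b] = played K x (Suc T)"
    using c by (simp add: played_def)
  obtain k m' where k: "k \<le> 130" "matches K (chain K obs x (Suc T)) m'"
    "(step prog x u ^^ k) (step prog x u (run prog K x u h))
      = cfg 37 m' (flips (step prog x u (run prog K x u h))) (played K x (Suc T))"
    using at_PULL(1)[OF mt[unfolded c] ok[unfolded c], of x u f "played K x T"]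
      at_PULL(2)[OF mt[unfolded c] ok[unfolded c], of x u f "played K x T"]
    unfolding r reach_def nxt pl by auto
  have "run prog K x u (h + Suc k) = (step prog x u ^^ k) (step prog x u (run prog K x u h))"
    using run_add[of prog K x u "Suc k" h] by (simp add: add.commute funpow_swap1)
  then show ?thesis using k by (intro exI[of _ "Suc k"]) (auto simp: head_def)
qed

lemma ex_head: "0 < K \<Longrightarrow> \<exists>h\<ge>T. head K x u h T"
proof (induction T)
  case 0
  then show ?case using head_0 by blast
next
  case (Suc T)
  then obtain h where h: "T \<le> h" "head K x u h T" by blast
  obtain k where "0 < k" "head K x u (h + k) (Suc T)" using head_Suc[OF Suc.prems h(2)] by blast
  then show ?case using h by (intro exI[of _ "h + k"]) auto
qed

text \<open>Memory is controlled exactly only when the program is about to pull. This lemma puts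
  every configuration a bounded number of steps after such a moment; 131 is the pull plus the 130
  steps allowed until the next one.\<close>

lemma head_before:
  assumes K: "0 < K"
  shows "n \<le> 40 \<or> (\<exists>h T. head K x u h T \<and> h \<le> n \<and> n \<le> h + 131)"
proof (induction n)
  case (Suc n)
  show ?case
  proof (cases "\<exists>h T. head K x u h T \<and> h \<le> n \<and> n \<le> h + 131")
    case True
    then obtain h T where h: "head K x u h T" "h \<le> n" "n \<le> h + 131" by blast
    obtain k where k: "0 < k" "k \<le> 131" "head K x u (h + k) (Suc T)" using head_Suc[OF K h(1)] by blast
    show ?thesis
    proof (cases "Suc n \<le> h + 131")
      case True
      then show ?thesis using h by (intro disjI2 exI[of _ h] exI[of _ T]) auto
    next
      case False
      then have "h + k \<le> Suc n" "Suc n \<le> h + k + 131" using h k by auto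
      then show ?thesis using k by blast
    qed
  next
    case False
    then have "n \<le> 40" using Suc by blast
    moreover obtain h where "h \<le> 40" "head K x u h 0" using head_0 by blast
    moreover from this have "n = 40 \<Longrightarrow> head K x u h 0 \<and> h \<le> Suc n \<and> Suc n \<le> h + 131" by simp
    ultimately show ?thesis by (metis le_SucE le_eq_less_or_eq less_eq_Suc_le)
  qed
qed simp

lemma arms_step: "\<exists>zs. arms (step P x u s) = arms s @ zs"
proof -
  have "\<exists>zs. arms (exec x u c s) = arms s @ zs" for c
    by (cases c) (auto simp: store_def)
  then show ?thesis by (simp add: step_def)
qed

lemma arms_mono: "n \<le> n' \<Longrightarrow> \<exists>zs. arms (run P K x u n') = arms (run P K x u n) @ zs"
proof (induction rule: dec_induct)
  case (step n')
  then show ?case using arms_step[of P x u "run P K x u n'"] by (auto simp: run_def)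
qed simp

lemma head_arms: "head K x u h T \<Longrightarrow> arms (run prog K x u h) = played K x T"
  by (auto simp: head_def)

lemma arms_played:
  assumes K: "0 < K" and t: "t < length (arms (run prog K x u n))"
  shows "arms (run prog K x u n) ! t = chain_arm (chain K obs x t)"
proof -
  obtain h where h: "n \<le> h" "head K x u h n" using ex_head[OF K] by blast
  obtain h' where h': "Suc t + n \<le> h'" "head K x u h' (Suc t + n)" using ex_head[OF K] by blast
  obtain zs where "played K x (Suc t + n) = arms (run prog K x u n) @ zs"
    using arms_mono[of n h' prog K x u] h' head_arms[OF h'(2)] by auto
  then have "arms (run prog K x u n) ! t = played K x (Suc t + n) ! t" using t by (simp add: nth_append)
  also have "\<dots> = chain_arm (chain K obs x t)"
    unfolding played_def by (subst nth_map) (auto simp del: upt_Suc)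
  finally show ?thesis .
qed

theorem bandit_algorithm_prog: "bandit_algorithm prog"
  unfolding bandit_algorithm_def
proof (intro allI impI conjI)
  fix K x u t n
  assume "1 \<le> (K::nat)"
  then have K: "0 < K" by simp
  obtain h where "head K x u h (Suc t)" using ex_head[OF K] by blast
  from head_arms[OF this] have "t < length (arms (run prog K x u h))" by (simp add: played_def)
  then show "\<exists>n. t < length (arms (run prog K x u n))" ..
  show "set (arms (run prog K x u n)) \<subseteq> {..<K}"
    using arms_played[OF K] chain_arm_less[OF K] by (auto simp: in_set_conv_nth)
qed

theorem chosen_arm_prog:
  assumes K: "0 < K"
  shows "chosen_arm prog K x u t = chain_arm (chain K obs x t)"
proof -
  obtain h where "head K x u h (Suc t)" using ex_head[OF K] by blast
  from head_arms[OF this] have "t < length (arms (run prog K x u h))" by (simp add: played_def)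
  then have "t < length (arms (run prog K x u (LEAST n. t < length (arms (run prog K x u n)))))"
    by (rule LeastI)
  then show ?thesis unfolding chosen_arm_def by (rule arms_played[OF K])
qed

section \<open>Space\<close>

fun operand_imm :: "operand \<Rightarrow> nat" where
  "operand_imm (Imm n) = n"
| "operand_imm (Reg r) = 0"

fun instr_imm :: "instr \<Rightarrow> nat" where
  "instr_imm (Add r a b) = max (operand_imm a) (operand_imm b)"
| "instr_imm (Sub r a b) = max (operand_imm a) (operand_imm b)"
| "instr_imm (Mul r a b) = max (operand_imm a) (operand_imm b)"
| "instr_imm (Div r a b) = max (operand_imm a) (operand_imm b)"
| "instr_imm (Mod r a b) = max (operand_imm a) (operand_imm b)"
| "instr_imm (Flip r) = 0"
| "instr_imm (JumpLess a b l) = max (operand_imm a) (operand_imm b)"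
| "instr_imm (Pull r a d) = max (operand_imm a) (operand_imm d)"

lemma val_le: "\<forall>r. mem s r \<le> B \<Longrightarrow> operand_imm a \<le> B \<Longrightarrow> val s a \<le> B"
  by (cases a) auto

lemma fixed_point_le: "y \<in> {0..1} \<Longrightarrow> nat \<lfloor>y * real d\<rfloor> \<le> d"
proof -
  assume "y \<in> {0..1}"
  then have "y * real d \<le> 1 * real d" by (intro mult_right_mono) auto
  then have "\<lfloor>y * real d\<rfloor> \<le> int d" by (simp add: floor_le_iff)
  then show ?thesis by simp
qed

lemma mem_exec_le:
  assumes B: "\<forall>r. mem s r \<le> B" "2 \<le> B" "instr_imm c \<le> B"
    and x: "reward_table K x" "set (arms (exec x u c s)) \<subseteq> {..<K}"
  shows "mem (exec x u c s) r \<le> B\<^sup>2"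
proof -
  have "2 * B \<le> B\<^sup>2" unfolding power2_eq_square by (rule mult_le_mono1[OF B(2)])
  then have B2: "B + B \<le> B\<^sup>2" "B \<le> B\<^sup>2" "1 \<le> B\<^sup>2" using B(2) by linarith+
  have le: "n \<le> B \<Longrightarrow> n \<le> B\<^sup>2" for n using B2(2) by linarith
  have m: "mem s r \<le> B\<^sup>2" for r using B(1) le by blast
  have add: "i \<le> B \<Longrightarrow> j \<le> B \<Longrightarrow> i + j \<le> B\<^sup>2" for i j using B2(1) by linarith
  have mul: "i \<le> B \<Longrightarrow> j \<le> B \<Longrightarrow> i * j \<le> B\<^sup>2" for i j using mult_le_mono[of i B j B] by (simp add: power2_eq_square)
  have sub: "i \<le> B \<Longrightarrow> i - j \<le> B\<^sup>2" for i j using B2(2) by linarith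
  have dv: "i \<le> B \<Longrightarrow> i div j \<le> B\<^sup>2" for i j using B2(2) div_le_dividend[of i j] by linarith
  have md: "i \<le> B \<Longrightarrow> i mod j \<le> B\<^sup>2" for i j using B2(2) mod_less_eq_dividend[of i j] by linarith
  show ?thesis
  proof (cases c)
    case (Pull q a d)
    then have "val s a < K" using x(2) by simp
    then have "x (val s a, length (arms s)) \<in> {0..1}" using x(1) by (simp add: reward_table_def)
    from fixed_point_le[OF this, of "val s d"] have "nat \<lfloor>x (val s a, length (arms s)) * real (val s d)\<rfloor> \<le> B\<^sup>2"
      using le[OF val_le[OF B(1), of d]] B(3) Pull by simp
    then show ?thesis using m Pull by (simp add: store_def)
  qed (use B(3) B2(3) m in \<open>auto simp: store_def intro!: add mul sub dv md val_le[OF B(1)]\<close>)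
qed

lemma instr_imm_prog: "c \<in> set prog \<Longrightarrow> instr_imm c \<le> 2 ^ 64"
proof -
  have "list_all (\<lambda>c. instr_imm c \<le> 2 ^ 64) prog" by (simp add: prog_def)
  then show "c \<in> set prog \<Longrightarrow> instr_imm c \<le> 2 ^ 64" by (simp add: list_all_iff)
qed

lemma mem_run_le:
  assumes K: "0 < K" and x: "reward_table K x"
    and B: "\<forall>r. mem (run prog K x u h) r \<le> B" "2 ^ 64 \<le> B"
  shows "mem (run prog K x u (k + h)) r \<le> B ^ 2 ^ k"
proof (induction k arbitrary: r)
  case 0
  then show ?case using B by simp
next
  case (Suc k)
  let ?c = "run prog K x u (k + h)"
  have sub: "set (arms (run prog K x u n)) \<subseteq> {..<K}" for n
    using bandit_algorithm_prog K x by (auto simp: bandit_algorithm_def)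
  have step: "run prog K x u (Suc k + h) = step prog x u ?c" by (simp add: run_def)
  have B1: "B \<le> B ^ 2 ^ k" using B(2) by (intro self_le_power) auto
  have "mem (step prog x u ?c) r \<le> (B ^ 2 ^ k)\<^sup>2"
  proof (cases "pc ?c < length prog")
    case True
    then have ex: "step prog x u ?c = exec x u (prog ! pc ?c) ?c" by (simp add: step_def)
    show ?thesis unfolding ex
    proof (rule mem_exec_le[OF _ _ _ x])
      show "\<forall>r. mem ?c r \<le> B ^ 2 ^ k" using Suc by blast
      have "2 \<le> (2::nat) ^ 64" by simp
      then show "2 \<le> B ^ 2 ^ k" by (rule order_trans[OF _ order_trans[OF B(2) B1]])
      show "instr_imm (prog ! pc ?c) \<le> B ^ 2 ^ k"
        by (rule order_trans[OF instr_imm_prog[OF nth_mem[OF True]] order_trans[OF B(2) B1]])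
      show "set (arms (exec x u (prog ! pc ?c) ?c)) \<subseteq> {..<K}" using sub[of "Suc k + h"] unfolding step ex .
    qed
  next
    case False
    then have "mem (step prog x u ?c) r \<le> B ^ 2 ^ k" using Suc by (simp add: step_def)
    also have "\<dots> \<le> (B ^ 2 ^ k)\<^sup>2" by (simp add: power2_nat_le_imp_le power2_eq_square)
    finally show ?thesis .
  qed
  also have "(B ^ 2 ^ k)\<^sup>2 = B ^ 2 ^ Suc k" by (simp flip: power_mult add: mult.commute)
  finally show ?case unfolding step .
qed

lemma size_ok_chain:
  assumes "0 < K" "reward_table K x" shows "size_ok (chain K obs x t)"
proof (induction t)
  case 0
  show ?case by (simp add: ref_size_def)
next
  case (Suc t)
  have "obs (chain_res (chain K obs x t)) (x (chain_arm (chain K obs x t), t)) \<le> chain_res (chain K obs x t)"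
    unfolding obs_def using chain_arm_less[OF assms(1)] assms(2)
    by (intro fixed_point_le) (auto simp: reward_table_def)
  then show ?case using size_ok_next[OF chain_ok[OF assms(1)] Suc] by (simp del: chain_next.simps)
qed

text \<open>An epoch with exponent \<open>2 * L\<close> starts only after the \<open>2 ^ L\<close>
  pulls of the previous one, so its length is quadratic in the time; the factor
  \<open>2 ^ 64\<close> covers the first epoch.\<close>

lemma chain_growth:
  "chain K ob x T = (L, t, b, n, S) \<Longrightarrow> t \<le> T \<and> 2 ^ L \<le> 2 ^ 64 * (T + 1)\<^sup>2"
proof (induction T arbitrary: L t b n S)
  case (Suc T)
  obtain L' t' b' n' S' where c: "chain K ob x T = (L', t', b', n', S')" by (cases "chain K ob x T")
  note IH = Suc.IH[OF c]
  have mono: "2 ^ 64 * (T + 1)\<^sup>2 \<le> (2::nat) ^ 64 * (Suc T + 1)\<^sup>2" by (intro mult_le_mono2 power_mono) auto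
  show ?case
  proof (cases "Suc t' < 2 ^ L'")
    case True
    then have "L = L'" "t = Suc t'" using Suc.prems c by (auto split: if_splits)
    then show ?thesis using IH order_trans[OF _ mono] by auto
  next
    case False
    then have "L = 2 * L'" "t = 0" using Suc.prems c by auto
    have "2 ^ L' \<le> Suc T + 1" using False IH by linarith
    then have "(2 ^ L')\<^sup>2 \<le> (Suc T + 1)\<^sup>2" by (rule power_mono) simp
    moreover have "(2 ^ L')\<^sup>2 = (2::nat) ^ (2 * L')" by (simp flip: power_mult add: mult.commute)
    moreover have "1 * (Suc T + 1)\<^sup>2 \<le> (2::nat) ^ 64 * (Suc T + 1)\<^sup>2" by (intro mult_le_mono1) simp
    ultimately have "2 ^ L \<le> (2::nat) ^ 64 * (Suc T + 1)\<^sup>2" unfolding \<open>L = 2 * L'\<close> by linarith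
    then show ?thesis using \<open>t = 0\<close> by blast
  qed
qed simp

lemma linear_le_exp: "2048 * L \<le> 2 ^ L" if "64 \<le> L"
  using that
proof (induction L rule: dec_induct)
  case (step n)
  then have "2048 * Suc n \<le> 2 * (2048 * n)" by simp
  with step show ?case by simp
qed simp

text \<open>With \<open>X = 2 ^ L\<close>, the largest register is the reward total of a test: fewer
  than \<open>X ^ 3\<close> pulls, each observed as at most \<open>X\<close>.\<close>

lemma regs_le:
  assumes mt: "matches K (L, t, b, n, S) m" and K: "0 < K"
    and ok: "chain_ok K (L, t, b, n, S)" "time_ok (L, t, b, n, S)" "size_ok (L, t, b, n, S)"
  shows "m r \<le> (2 ^ L * K) ^ 4"
proof -
  define X :: nat where "X = 2 ^ L"
  have L: "64 \<le> L" using ok by simp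
  have X: "2048 * L \<le> X" "1 \<le> X" using linear_le_exp[OF L] L by (auto simp: X_def)
  have XX: "X ^ i \<le> X ^ 4" if "i \<le> 4" for i using X(2) that by (intro power_increasing) auto
  have XK: "X ^ 4 \<le> (X * K) ^ 4" "K \<le> (X * K) ^ 4"
  proof -
    show "X ^ 4 \<le> (X * K) ^ 4" using K by (intro power_mono) auto
    have "K \<le> X * K" using X by simp
    also have "\<dots> \<le> (X * K) ^ 4" using K X by (intro self_le_power) auto
    finally show "K \<le> (X * K) ^ 4" .
  qed
  have X4: "j \<le> X ^ i \<Longrightarrow> i \<le> 4 \<Longrightarrow> j \<le> (X * K) ^ 4" for j i using XX[of i] XK by linarith
  have four: "(4::nat) ^ i = 2 ^ i * 2 ^ i" for i by (simp flip: power_mult_distrib)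
  have sm: "i \<le> 2 ^ i" for i :: nat using less_exp[of i] by (rule less_imp_le)
  have ref: "ref_size L s \<le> X\<^sup>2" if "4 ^ s \<le> X" for s
    using mult_le_mono[of "512 * L" X "4 ^ s" X] X that by (simp add: ref_size_def power2_eq_square)
  have low: "s \<le> X" "2 ^ s \<le> X" "4 ^ s \<le> X" if "4 ^ s \<le> X" for s
  proof -
    show "4 ^ s \<le> X" by fact
    moreover have "(2::nat) ^ s * 1 \<le> 2 ^ s * 2 ^ s" by (intro mult_le_mono2) simp
    ultimately show "2 ^ s \<le> X" unfolding four by linarith
    then show "s \<le> X" using sm[of s] by linarith
  qed
  have rest: "m r \<le> (X * K) ^ 4" if "r \<in> {0..18} \<Longrightarrow> m r \<le> (X * K) ^ 4"
  proof (cases "r \<le> 18")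
    case False
    have "m r = 0"
    proof (cases "r > 24")
      case False
      with \<open>\<not> r \<le> 18\<close> have "r = 19 \<or> r = 20 \<or> r = 21 \<or> r = 22 \<or> r = 23 \<or> r = 24" by linarith
      then show ?thesis using mt by (cases b) (auto simp: base_def tmp0_def)
    qed (use mt in \<open>cases b; auto simp: base_def\<close>)
    then show ?thesis by simp
  qed (use that in simp)
  have idx: "r \<in> {0..18} \<Longrightarrow> r \<in> {0, 1, 2, 3, 4, 5, 6, 7, 8, 9, 10, 11, 12, 13, 14, 15, 16, 17, 18}"
    by (auto simp: atLeastAtMost_upt upt_rec eval_nat_numeral)
  have "m r \<le> (X * K) ^ 4"
  proof (rule rest)
    assume "r \<in> {0..18}"
    note r = idx[OF this]
    show "m r \<le> (X * K) ^ 4"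
    proof (cases b)
      case (Ref s c E i)
      have t: "t < X" and s: "4 ^ s \<le> X"
        using ok by (auto simp: Ref X_def split: if_splits)
      note l = low[OF s]
      have v: "c < K" "i \<le> K" "E \<le> s" using ok by (auto simp: Ref)
      have n: "n \<le> X\<^sup>2" "S \<le> X ^ 3"
      proof -
        show n: "n \<le> X\<^sup>2" using ok ref[OF s] by (auto simp: Ref)
        have "S \<le> n * X" using ok by (auto simp: Ref X_def)
        also have "\<dots> \<le> X\<^sup>2 * X" using n by simp
        finally show "S \<le> X ^ 3" by (simp add: power2_eq_square power3_eq_cube)
      qed
      have x: "m 0 \<le> K" "m 1 \<le> X ^ 1" "m 2 \<le> X ^ 1" "m 3 \<le> X ^ 1" "m 4 \<le> X ^ 1" "m 5 \<le> K" "m 6 \<le> X ^ 1"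
        "m 7 \<le> K" "m 8 = 0" "m 9 = 0" "m 10 = 0" "m 11 = 0" "m 12 = 0" "m 13 \<le> X ^ 2" "m 14 \<le> X ^ 2" "m 15 \<le> X ^ 3"
        "m 16 \<le> K" "m 17 = 0" "m 18 \<le> X ^ 1"
        using mt v t l n X ref[OF s] by (auto simp: Ref base_def X_def[symmetric])
      show ?thesis using r XK(2) by (auto intro: X4[OF x(2)] X4[OF x(3)] X4[OF x(4)] X4[OF x(5)] X4[OF x(7)]
          X4[OF x(14)] X4[OF x(15)] X4[OF x(16)] X4[OF x(19)] order_trans[OF x(1)] order_trans[OF x(6)]
          order_trans[OF x(8)] order_trans[OF x(17)] simp: x(9-13,18) simp del: One_nat_def)
    next
      case (Test s c M E i e y)
      have t: "t < X" and s': "4 ^ Suc s \<le> X" using ok by (auto simp: Test X_def)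
      then have s: "4 ^ s \<le> X" "4 ^ s * 4 \<le> X" by auto
      note l = low[OF s(1)]
      have v: "c < K" "i < K" "E \<le> s" "e \<le> s" "y\<^sup>2 < 4 * L" using ok by (auto simp: Test)
      have e: "4 ^ e \<le> X" using power_increasing[OF v(4), of "4::nat"] s by linarith
      note le = low[OF e]
      have "s < X" using less_exp[of s] l by linarith
      then have cf: "conf E e \<le> X" using conf_le[of E e] v by linarith
      have y2: "512 * y\<^sup>2 \<le> X" using v X by linarith
      have y: "y \<le> X" using y2 self_le_power[of y 2] by (cases "y = 0") auto
      have ts: "test_size E e y \<le> X ^ 3"
      proof -
        have "test_size E e y = 4 ^ e * conf E e * (512 * y\<^sup>2)" by (simp add: test_size_def)
        also have "\<dots> \<le> X * X * X" by (intro mult_le_mono e cf y2)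
        finally show ?thesis by (simp add: power3_eq_cube)
      qed
      have n: "n \<le> X ^ 3" "S \<le> X ^ 4" "M \<le> X ^ 3"
      proof -
        show n: "n \<le> X ^ 3" using ok ts by (auto simp: Test)
        have "S \<le> n * X" using ok by (auto simp: Test X_def)
        also have "\<dots> \<le> X ^ 3 * X" using n by simp
        finally show "S \<le> X ^ 4" by (simp add: eval_nat_numeral ac_simps)
        have "M \<le> ref_size L s * X" using ok by (auto simp: Test X_def)
        also have "\<dots> \<le> X\<^sup>2 * X" using ref[OF s(1)] by simp
        finally show "M \<le> X ^ 3" by (simp add: power2_eq_square power3_eq_cube)
      qed
      have x: "m 0 \<le> K" "m 1 \<le> X ^ 1" "m 2 \<le> X ^ 1" "m 3 \<le> X ^ 1" "m 4 \<le> X ^ 1" "m 5 \<le> K" "m 6 \<le> X ^ 1"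
        "m 7 \<le> K" "m 8 \<le> X ^ 3" "m 9 \<le> X ^ 1" "m 10 \<le> X ^ 1" "m 11 \<le> X ^ 1" "m 12 \<le> X ^ 1" "m 13 \<le> X ^ 3"
        "m 14 \<le> X ^ 3" "m 15 \<le> X ^ 4" "m 16 \<le> K" "m 17 \<le> X ^ 1" "m 18 \<le> X ^ 1"
        using mt v t l n X ts cf y le by (auto simp: Test base_def X_def[symmetric])
      show ?thesis using r XK(2) by (auto intro: X4[OF x(2)] X4[OF x(3)] X4[OF x(4)] X4[OF x(5)] X4[OF x(7)]
          X4[OF x(9)] X4[OF x(10)] X4[OF x(11)] X4[OF x(12)] X4[OF x(13)]
          X4[OF x(14)] X4[OF x(15)] X4[OF x(16)] X4[OF x(18)] X4[OF x(19)] order_trans[OF x(1)] order_trans[OF x(6)]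
          order_trans[OF x(8)] order_trans[OF x(17)] simp del: One_nat_def)
    qed
  qed
  then show ?thesis by (simp add: X_def)
qed

lemma mem_prog_le:
  assumes K: "0 < K" and x: "reward_table K x" and T: "length (arms (run prog K x u n)) \<le> T"
  shows "mem (run prog K x u n) r \<le> ((2 ^ 64 * (T + 1)\<^sup>2 * K) ^ 4) ^ 2 ^ 131"
proof -
  define B :: nat where "B = (2 ^ 64 * (T + 1)\<^sup>2 * K) ^ 4"
  have B0: "2 ^ 64 * K \<le> B"
  proof -
    have "2 ^ 64 * K \<le> 2 ^ 64 * (T + 1)\<^sup>2 * K" by simp
    also have "\<dots> \<le> B" unfolding B_def using K by (intro self_le_power) auto
    finally show ?thesis .
  qed
  moreover have "2 ^ 64 \<le> 2 ^ 64 * K" using K by simp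
  ultimately have B: "2 ^ 64 \<le> B" by linarith
  have "\<exists>h k. n = k + h \<and> k \<le> 131 \<and> (\<forall>r. mem (run prog K x u h) r \<le> B)"
  proof (cases "n \<le> 40")
    case True
    have "mem (run prog K x u 0) r \<le> B" for r using B0 by (simp add: run_def init_def)
    then show ?thesis using True by (intro exI[of _ 0] exI[of _ n]) auto
  next
    case False
    then obtain h T' where h: "head K x u h T'" "h \<le> n" "n \<le> h + 131" using head_before[OF K, of n x u] by auto
    obtain zs where "arms (run prog K x u n) = arms (run prog K x u h) @ zs" using arms_mono[OF h(2)] by blast
    then have T': "T' \<le> T" using T head_arms[OF h(1)] by (simp add: played_def)
    obtain L t b m S where c: "chain K obs x T' = (L, t, b, m, S)" by (cases "chain K obs x T'")
    obtain mm f where r: "run prog K x u h = cfg 37 mm f (played K x T')" "matches K (L, t, b, m, S) mm"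
      using h(1) c by (auto simp: head_def)
    have "mm q \<le> B" for q
    proof -
      have "mm q \<le> (2 ^ L * K) ^ 4"
        using regs_le[OF r(2) K] chain_ok[OF K, of obs x T'] time_ok_chain[OF K, of obs x T']
          size_ok_chain[OF K x, of T'] unfolding c by blast
      also have "\<dots> \<le> B" unfolding B_def
      proof (intro power_mono mult_le_mono1)
        have "2 ^ L \<le> 2 ^ 64 * (T' + 1)\<^sup>2" using chain_growth[OF c] by blast
        also have "\<dots> \<le> 2 ^ 64 * (T + 1)\<^sup>2" using T' by (intro mult_le_mono2 power_mono) auto
        finally show "2 ^ L \<le> 2 ^ 64 * (T + 1)\<^sup>2" .
      qed simp
      finally show ?thesis .
    qed
    then show ?thesis using h r by (intro exI[of _ h] exI[of _ "n - h"]) auto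
  qed
  then obtain h k where hk: "n = k + h" "k \<le> 131" "\<forall>r. mem (run prog K x u h) r \<le> B" by blast
  have "mem (run prog K x u n) r \<le> B ^ 2 ^ k" unfolding hk(1) by (rule mem_run_le[OF K x hk(3) B])
  also have "\<dots> \<le> B ^ 2 ^ 131"
    using B hk(2) by (intro power_increasing) auto
  finally show ?thesis unfolding B_def .
qed

text \<open>\<open>2 ^ 64 * (T + 1)\<^sup>2 * K \<le> 2 ^ 66 * (K * T)\<^sup>2 \<le> exp (68 * lg (K
  * T))\<close>; the fourth power gives 272, and \<open>600 * ln 2 \<ge> 300\<close>.\<close>

lemma power_less_powr:
  assumes "1 \<le> K" "1 \<le> T" "0 < N"
  shows "real (((2 ^ 64 * (T + 1)\<^sup>2 * K) ^ 4) ^ N) < 2 powr (600 * real N * lg (real K * real T))"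
proof -
  define Z where "Z = real K * real T"
  have Z: "1 \<le> Z" unfolding Z_def using assms mult_mono[of 1 "real K" 1 "real T"] by simp
  have l: "1 \<le> lg Z" "ln Z \<le> lg Z" by (auto simp: lg_def)
  have "2 \<le> exp (1::real)" using exp_ge_add_one_self[of "1::real"] by simp
  then have "(2::real) ^ 66 \<le> exp 1 ^ 66" by (rule power_mono) simp
  also have "\<dots> = exp 66" by (simp flip: exp_of_nat_mult)
  finally have e: "(2::real) ^ 66 \<le> exp 66" .
  have "(real T + 1)\<^sup>2 \<le> (2 * real T)\<^sup>2" using assms by (intro power_mono) auto
  then have "2 ^ 64 * (real T + 1)\<^sup>2 * real K \<le> 2 ^ 64 * (2 * real T)\<^sup>2 * (real K)\<^sup>2"
    using assms by (intro mult_mono mult_left_mono self_le_power) auto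
  also have "\<dots> = 2 ^ 66 * Z\<^sup>2" by (simp add: Z_def power_mult_distrib)
  also have "\<dots> \<le> exp 66 * (exp (ln Z))\<^sup>2" using Z e by (intro mult_mono) auto
  also have "\<dots> = exp (66 + 2 * ln Z)" by (simp add: exp_add exp_double)
  also have "\<dots> \<le> exp (68 * lg Z)" using l by simp
  finally have "2 ^ 64 * (real T + 1)\<^sup>2 * real K \<le> exp (68 * lg Z)" .
  then have "((2 ^ 64 * (real T + 1)\<^sup>2 * real K) ^ 4) ^ N \<le> (exp (68 * lg Z) ^ 4) ^ N"
    by (intro power_mono) auto
  also have "\<dots> = exp (272 * real N * lg Z)"
    by (simp flip: exp_of_nat_mult add: ac_simps)
  also have "\<dots> < exp (600 * real N * lg Z * ln 2)"
  proof -
    have "0 < real N * lg Z" using assms l by simp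
    then have "272 * (real N * lg Z) < 600 * (real N * lg Z) * (1/2)" by linarith
    also have "\<dots> \<le> 600 * (real N * lg Z) * ln 2"
      by (intro mult_left_mono ln_2_ge) (use \<open>0 < real N * lg Z\<close> in linarith)
    finally show ?thesis by (simp add: ac_simps)
  qed
  finally show ?thesis by (simp add: powr_def Z_def ac_simps)
qed

text \<open>
  There are at most 131 steps from one pull to the next, and a single step at most squares the largest
  register; hence the exponent \<open>2 ^ 131\<close>.
\<close>

theorem runs_in_space_prog:
  "runs_in_space prog (card (\<Union> (instr_regs ` set prog))) (600 * 2 ^ 131)"
  unfolding runs_in_space_def
proof (intro conjI allI impI order_refl)
  fix K T x u n r
  assume a: "1 \<le> (K::nat)" "1 \<le> (T::nat)" "reward_table K x" "length (arms (run prog K x u n)) \<le> T"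
  define N :: nat where "N = 2 ^ 131"
  have N: "0 < N" "real N = 2 ^ 131" by (simp_all add: N_def)
  have "real (mem (run prog K x u n) r) \<le> real (((2 ^ 64 * (T + 1)\<^sup>2 * K) ^ 4) ^ N)"
    unfolding of_nat_le_iff N_def using mem_prog_le[OF _ a(3,4)] a(1) by simp
  also have "\<dots> < 2 powr (600 * real N * lg (real K * real T))"
    by (rule power_less_powr[OF a(1,2) N(1)])
  finally show "real (mem (run prog K x u n) r) < 2 powr (600 * 2 ^ 131 * lg (real K * real T))"
    unfolding N(2) .
qed

theorem theorem2:
  "\<exists>(W::nat) (b::real) (C::real). \<forall>\<gamma>::real. \<gamma> > 0 \<longrightarrow>
     (\<exists>P. bandit_algorithm P \<and> runs_in_space P W b \<and>
        (\<forall>(K::nat) (D :: nat \<Rightarrow> real measure) (T::nat).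
           K \<ge> 1 \<longrightarrow> T > 0 \<longrightarrow> (\<forall>i<K. reward_distribution (D i)) \<longrightarrow>
           pseudo_regret P K D T \<le>
             C * (\<Sum>i | i < K \<and> gap K D i > 0.
                    1 / gap K D i *
                    (lg (1 / gap K D i) powr \<gamma>
                     + ln (gap K D i / min_gap K D)
                       / (\<gamma> * lg (ln (gap K D i / min_gap K D))))
                    * lg (real T))))"
proof (intro exI allI impI conjI)
  show "bandit_algorithm prog" by (rule bandit_algorithm_prog)
  show "runs_in_space prog (card (\<Union> (instr_regs ` set prog))) (600 * 2 ^ 131)" by (rule runs_in_space_prog)
  fix \<gamma> :: real and K T :: nat and D :: "nat \<Rightarrow> real measure"
  assume \<gamma>: "0 < \<gamma>" and K: "1 \<le> K" and T: "0 < T" and D: "\<forall>i<K. reward_distribution (D i)"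
  interpret bandit K D using K D by unfold_locales auto
  have gap: "gap K D = gp" by (simp add: fun_eq_iff gap_def gp_def best_mean_def best_def)
  have min_gap: "min_gap K D = Min (gp ` {k. k < K \<and> 0 < gp k})"
    unfolding min_gap_def gap by (rule arg_cong[of _ _ Min]) auto
  have "pseudo_regret prog K D T = rg T (64, 0, start, 0, 0)"
    using chosen_arm_prog K by (intro pseudo_regret_eq_rg) auto
  also have "\<dots> \<le> 10 ^ 14 * (\<Sum>k | k < K \<and> 0 < gp k.
      1 / gp k * rate \<gamma> (gp k) (Min (gp ` {k. k < K \<and> 0 < gp k})) * lg (real T))"
    by (rule rg_bound[OF \<gamma> T])
  finally show "pseudo_regret prog K D T \<le> 10 ^ 14 * (\<Sum>i | i < K \<and> gap K D i > 0.
      1 / gap K D i * (lg (1 / gap K D i) powr \<gamma>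
        + ln (gap K D i / min_gap K D) / (\<gamma> * lg (ln (gap K D i / min_gap K D)))) * lg (real T))"
    unfolding gap min_gap rate_def .
qed

end
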